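(* Let $d\ge 2$, let $g\in C(S^{d-1})$ be a real-valued continuous function on the unit sphere, and let $c=\gamma_d\int_{S^{d-1}} g(\theta)\,d\theta$, where $\gamma_d=\frac{1}{\sqrt{\pi}}\frac{\Gamma((d+1)/2)}{\Gamma(d/2)}$. Then there exists a unique solution $u\in C^2(\mathbf{R}^d)$ of the partial differential equation $$\frac12\sum_{i,j=1}^d(\delta_{ij}+x_ix_j)\frac{\partial^2u}{\partial x_i\partial x_j}(x)=c,\qquad x\in\mathbf{R}^d,$$ with $u(0)=0$ and such that $$\lim_{r\to\infty}\sup_{\theta\in S^{d-1}}\left|\frac{u(r\theta)}{r}-g(\theta)\right|=0.$$
   Context: $S^{d-1}=\{x\in\mathbf{R}^d:|x|=1\}$, and $d\theta$ denotes Lebesgue (surface) measure on $S^{d-1}$ normalised so that $\int_{S^{d-1}}1\,d\theta=1$. $\delta_{ij}$ is the Kronecker delta. *)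

theory Defs
  imports "HOL-Analysis.Analysis"
begin

text \<open>The normalised surface measure of a Borel set \<open>A\<close> of the unit sphere is realised as the
  proportion of the unit ball that is occupied by the cone over \<open>A\<close>, i.e. as the image of the
  uniform distribution on the ball under radial projection. The lemmas below check that it has total
  mass 1 and is invariant under orthogonal maps, properties which characterise normalised surface
  measure. The space is cut down to the sphere so that functions need only be measurable there; the
  value of the projection at the origin (a null set) is irrelevant.\<close>

definition sphere_measure :: "'a::euclidean_space measure" where
  "sphere_measure =
     restrict_space (distr (uniform_measure lborel (ball 0 1)) borel (\<lambda>x. x /\<^sub>R norm x)) (sphere 0 1)"

lemma space_sphere_measure [simp]: "space sphere_measure = sphere 0 1"
  by (simp add: sphere_measure_def space_restrict_space)

lemma sets_sphere_measure:
  "sets sphere_measure = sets (restrict_space borel (sphere 0 1))"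
  by (simp add: sphere_measure_def sets_restrict_space)

lemma emeasure_sphere_measure:
  fixes A :: "'a::euclidean_space set"
  assumes "A \<in> sets sphere_measure"
  shows "emeasure sphere_measure A =
    emeasure lborel {x \<in> ball 0 1. x /\<^sub>R norm x \<in> A} / emeasure lborel (ball (0::'a) 1)"
proof -
  have A: "A \<in> sets borel" "A \<subseteq> sphere 0 1"
    using assms by (auto simp: sets_sphere_measure sets_restrict_space)
  have m: "(\<lambda>x::'a. x /\<^sub>R norm x) \<in> borel_measurable borel"
    by measurable
  have "{x \<in> ball 0 1. x /\<^sub>R norm x \<in> A} = ball 0 1 \<inter> (\<lambda>x. x /\<^sub>R norm x) -` A"
    by auto
  then show ?thesis
    using A m measurable_sets[OF m A(1)]
    by (simp add: sphere_measure_def emeasure_restrict_space emeasure_distr)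
qed

lemma emeasure_sphere_measure_space:
  "emeasure sphere_measure (sphere 0 1 :: 'a::euclidean_space set) = 1"
proof -
  let ?B = "ball (0::'a) 1"
  have S: "sphere 0 1 \<in> sets (sphere_measure :: 'a measure)"
    using sets.top[of "sphere_measure :: 'a measure"] by simp
  have "{x \<in> ?B. x /\<^sub>R norm x \<in> sphere 0 1} = ?B - {0}"
    by auto
  moreover have "emeasure lborel (?B - {0}) = emeasure lborel ?B"
    by (intro emeasure_Diff_null_set) auto
  moreover have "emeasure lborel ?B \<noteq> 0"
    using content_ball_pos[of 1 "0::'a"]
    by (simp add: emeasure_eq_ennreal_measure[OF less_imp_neq[OF emeasure_lborel_ball_finite, unfolded infinity_ennreal_def]])
  moreover have "emeasure lborel ?B < \<infinity>"
    by (rule emeasure_lborel_ball_finite)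
  ultimately show ?thesis
    by (simp add: emeasure_sphere_measure[OF S] ennreal_divide_self)
qed

lemma distr_sphere_measure_orthogonal:
  fixes T :: "real^'n::{finite,wellorder} \<Rightarrow> real^'n::_"
  assumes T: "orthogonal_transformation T"
  shows "distr sphere_measure sphere_measure T = sphere_measure"
proof (rule measure_eqI)
  show "sets (distr sphere_measure sphere_measure T) = sets (sphere_measure :: (real^'n::_) measure)"
    by simp
  fix A assume "A \<in> sets (distr sphere_measure sphere_measure T)"
  then have A: "A \<in> sets sphere_measure" by simp
  have lin: "linear T" and nrm: "\<And>x. norm (T x) = norm x"
    using T by (auto simp: orthogonal_transformation)
  have Tm: "T \<in> measurable sphere_measure sphere_measure"
  proof -
    have "T \<in> measurable (restrict_space borel (sphere 0 1)) (restrict_space borel (sphere 0 1))"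
      using lin nrm
      by (intro measurable_restrict_space3)
        (auto intro!: borel_measurable_continuous_onI linear_continuous_on simp: linear_conv_bounded_linear)
    then show ?thesis
      using measurable_cong_sets[OF sets_sphere_measure sets_sphere_measure] by blast
  qed
  let ?C = "\<lambda>A. {x \<in> ball 0 1. x /\<^sub>R norm x \<in> A} :: (real^'n::_) set"
  have C: "?C X \<in> sets borel" if "X \<in> sets sphere_measure" for X
  proof -
    have "X \<in> sets borel"
      using that by (auto simp: sets_sphere_measure sets_restrict_space)
    moreover have "(\<lambda>x::real^'n::_. x /\<^sub>R norm x) \<in> borel_measurable borel"
      by measurable
    ultimately have "(\<lambda>x. x /\<^sub>R norm x) -` X \<inter> space borel \<in> sets borel"
      by (rule measurable_sets[rotated])
    moreover have "?C X = ball 0 1 \<inter> ((\<lambda>x. x /\<^sub>R norm x) -` X \<inter> space borel)"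
      by auto
    ultimately show ?thesis by simp
  qed
  define B where "B = T -` A \<inter> sphere 0 1"
  have B: "B \<in> sets sphere_measure"
    using measurable_sets[OF Tm A] by (simp add: B_def)
  have fin: "emeasure lborel (?C X) < \<infinity>" for X
    by (rule le_less_trans[OF emeasure_mono emeasure_lborel_ball_finite[of 0 1]]) auto
  have CL: "?C B \<in> lmeasurable"
    using fin[of B] C[OF B] by (simp add: fmeasurable_def)
  have AS: "A \<subseteq> sphere 0 1"
    using sets.sets_into_space[OF A] by simp
  have sc: "T (x /\<^sub>R norm x) = T x /\<^sub>R norm (T x)" for x
    by (simp add: nrm linear_cmul[OF lin])
  have img: "T ` ?C B = ?C A"
  proof
    show "T ` ?C B \<subseteq> ?C A"
      using sc by (auto simp: B_def nrm)
    show "?C A \<subseteq> T ` ?C B"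
    proof
      fix y assume y: "y \<in> ?C A"
      obtain x where x: "y = T x"
        using orthogonal_transformation_surj[OF T] by (metis surj_def)
      have "norm (y /\<^sub>R norm y) = 1"
        using y AS by (auto simp: subset_iff)
      then have "norm (x /\<^sub>R norm x) = 1"
        by (simp add: x nrm)
      then have "x \<in> ?C B"
        using y sc[of x] by (simp add: B_def x nrm)
      then show "y \<in> T ` ?C B" using x by blast
    qed
  qed
  have "measure lebesgue (?C A) = measure lebesgue (?C B)"
    using measure_orthogonal_image[OF T CL] unfolding img .
  then have "measure lborel (?C A) = measure lborel (?C B)"
    using C[OF A] C[OF B] by (simp add: measure_completion)
  then have "emeasure lborel (?C A) = emeasure lborel (?C B)"
    using fin[of A] fin[of B] by (simp add: emeasure_eq_ennreal_measure less_top)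
  then show "emeasure (distr sphere_measure sphere_measure T) A = emeasure sphere_measure A"
    using A B by (simp add: emeasure_distr[OF Tm] emeasure_sphere_measure B_def)
qed

definition has_partial :: "'n \<Rightarrow> (real^'n \<Rightarrow> real) \<Rightarrow> real^'n \<Rightarrow> bool" where
  "has_partial i f x \<longleftrightarrow> (\<lambda>t. f (x + t *\<^sub>R axis i 1)) differentiable (at 0)"

definition partial_deriv :: "'n \<Rightarrow> (real^'n \<Rightarrow> real) \<Rightarrow> real^'n \<Rightarrow> real" where
  "partial_deriv i f x = deriv (\<lambda>t. f (x + t *\<^sub>R axis i 1)) 0"

definition C1 :: "(real^'n \<Rightarrow> real) \<Rightarrow> bool" where
  "C1 f \<longleftrightarrow> continuous_on UNIV f \<and> (\<forall>i x. has_partial i f x) \<and>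
     (\<forall>i. continuous_on UNIV (partial_deriv i f))"

definition C2 :: "(real^'n \<Rightarrow> real) \<Rightarrow> bool" where
  "C2 f \<longleftrightarrow> C1 f \<and> (\<forall>i. C1 (partial_deriv i f))"

end

theory Submission
  imports Defs "HOL-Probability.Distributions"
begin

text \<open>The function \<open>U(t, x) = t u(x / t)\<close> is homogeneous of degree 1 on the upper half space of dimension
  \<open>d + 1\<close>, and the equation for \<open>u\<close> says \<open>\<Delta>U = 2 c / t\<close>, with boundary values
  \<open>G(y) = |y| g(y / |y|)\<close> at \<open>t = 0\<close>. So \<open>u\<close> is the convolution of \<open>G\<close> with the Poisson kernel
  \<open>P(z) = (1 + |z|\<^sup>2)\<^sup>-\<^sup>(\<^sup>d\<^sup>+\<^sup>1\<^sup>)\<^sup>/\<^sup>2\<close>. The linear growth of \<open>G\<close> makes that integral diverge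
  logarithmically; replacing \<open>P(x - y)\<close> by \<open>P(x - y) - P(y)\<close> cures this, normalises \<open>u(0) = 0\<close> and
  produces the constant \<open>c\<close>: on each ray the integrand of the equation is an exact derivative, whose
  primitive tends to 1. The behaviour at infinity is the approximate identity property of \<open>P\<close>.

  For uniqueness, the difference \<open>w\<close> of two solutions is \<open>o(|x|)\<close> with \<open>w(0) = 0\<close>. Outside a small
  ball the operator has a strict radial supersolution of linear growth, so by the maximum principle
  \<open>w\<close> is bounded by its values near the origin.\<close>

section \<open>Second derivatives along lines\<close>

text \<open>The matrix delta_ij + x_i x_j is the identity plus a rank one matrix, so twice the
  operator is the sum of the second derivatives along the axes and along x itself, and the maximum
  principle reduces to one-variable calculus. It cannot be run on the whole space: a C^2 function
  tending to infinity has a minimum, where the operator is nonnegative, so no strict supersolution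
  of that growth exists globally. Hence the exterior domain, and hence the role of u(0) = 0, which
  controls the difference of two solutions on the small sphere that bounds it.

  In the existence part one rate governs all estimates: a kernel of size |z|^-(d+2) at infinity can
  be integrated against the linear growth of G, with a multiple of P as majorant. P misses this rate
  by one power; its increments and its derivatives reach it. To find c, polar coordinates are taken
  about the origin and not about x, because there the homogeneity of G separates direction from
  radius. The factor gamma_d is half the area of the unit sphere divided by the mass of P.\<close>

lemma C1_line_derivative:
  fixes f :: "real^'n \<Rightarrow> real"
  assumes "C1 f"
  shows "((\<lambda>t. f (x + t *\<^sub>R axis i 1)) has_real_derivative partial_deriv i f (x + s *\<^sub>R axis i 1)) (at s)"
proof -
  have "(\<lambda>t. f ((x + s *\<^sub>R axis i 1) + t *\<^sub>R axis i 1)) differentiable (at 0)"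
    using assms unfolding C1_def has_partial_def by blast
  then have "((\<lambda>t. f ((x + s *\<^sub>R axis i 1) + t *\<^sub>R axis i 1)) has_real_derivative
      partial_deriv i f (x + s *\<^sub>R axis i 1)) (at 0)"
    unfolding partial_deriv_def
    by (metis DERIV_deriv_iff_real_differentiable)
  then have "((\<lambda>t. f ((x + s *\<^sub>R axis i 1) + (t - s) *\<^sub>R axis i 1)) has_real_derivative
      partial_deriv i f (x + s *\<^sub>R axis i 1)) (at s)"
    using DERIV_shift[of "\<lambda>t. f ((x + s *\<^sub>R axis i 1) + t *\<^sub>R axis i 1)" _ s "-s"]
    by simp
  then show ?thesis
    by (simp add: algebra_simps)
qed

text \<open>Change the coordinates one at a time and apply the mean value theorem to each change;
  continuity of the partial derivatives makes the errors small. \<open>C1\<close> speaks of axis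
  directions only, whereas the maximum principle also differentiates in the direction of the point
  itself.\<close>

lemma C1_has_derivative:
  fixes f :: "real^'n \<Rightarrow> real"
  assumes "C1 f"
  shows "(f has_derivative (\<lambda>h. \<Sum>i\<in>UNIV. h $ i * partial_deriv i f x)) (at x)"
  unfolding has_derivative_at_alt
proof (intro conjI allI impI)
  show "bounded_linear (\<lambda>h::real^'n. \<Sum>i\<in>UNIV. h $ i * partial_deriv i f x)"
    by (intro bounded_linear_sum bounded_linear_mult_const bounded_linear_vec_nth)
  fix e :: real assume e: "0 < e"
  \<comment> \<open>The coordinate errors add up to \<open>e'\<close> times the sum of the absolute
    values of the coordinates of the increment, which is at most \<open>CARD('n)\<close> times its
    norm.\<close>
  define e' where "e' = e / real CARD('n)"
  have e': "e' > 0" using e by (simp add: e'_def)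
  have "\<exists>d>0. \<forall>y. dist y x < d \<longrightarrow> \<bar>partial_deriv i f y - partial_deriv i f x\<bar> < e'" for i
  proof -
    have "isCont (partial_deriv i f) x"
      using assms continuous_on_eq_continuous_at[OF open_UNIV] unfolding C1_def by blast
    then show ?thesis
      using e' unfolding continuous_at_eps_delta dist_real_def by blast
  qed
  then obtain d where d: "\<And>i. d i > 0"
    "\<And>i y. dist y x < d i \<Longrightarrow> \<bar>partial_deriv i f y - partial_deriv i f x\<bar> < e'"
    by metis
  define r where "r = Min (range d)"
  have r: "r > 0" "\<And>i. r \<le> d i"
    using d(1) by (auto simp: r_def)
  show "\<exists>r>0. \<forall>y. norm (y - x) < r \<longrightarrow>
      norm (f y - f x - (\<Sum>i\<in>UNIV. (y - x) $ i * partial_deriv i f x)) \<le> e * norm (y - x)"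
  proof (intro exI conjI allI impI)
    show "0 < r" by (rule r)
    fix y assume y: "norm (y - x) < r"
    define h where "h = y - x"
    \<comment> \<open>Componentwise domination by \<open>h\<close>: every mean value point used
      below is \<open>x\<close> plus such a sum, with coefficients 1 or \<open>c\<close>, and so
      stays within \<open>norm h\<close> of \<open>x\<close>.\<close>
    have bd: "norm (\<Sum>i\<in>A. (c i * h $ i) *\<^sub>R axis i (1::real)) \<le> norm h"
      if "\<And>i. \<bar>c i\<bar> \<le> 1" for c and A :: "'n set"
    proof (rule norm_le_componentwise_cart)
      fix i
      have "(\<Sum>i\<in>A. (c i * h $ i) *\<^sub>R axis i (1::real)) $ i = (\<Sum>k\<in>A. if k = i then c i * h $ i else 0)"
        unfolding sum_component by (intro sum.cong refl) (simp add: axis_def)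
      also have "\<dots> = (if i \<in> A then c i * h $ i else 0)"
        by (simp add: sum.delta)
      also have "norm \<dots> \<le> norm (h $ i)"
        using that[of i] by (auto simp: abs_mult mult_left_le_one_le)
      finally show "norm ((\<Sum>i\<in>A. (c i * h $ i) *\<^sub>R axis i (1::real)) $ i) \<le> norm (h $ i)" .
    qed
    have "\<bar>f (x + (\<Sum>i\<in>A. h $ i *\<^sub>R axis i (1::real))) - f x - (\<Sum>i\<in>A. h $ i * partial_deriv i f x)\<bar>
        \<le> e' * (\<Sum>i\<in>A. \<bar>h $ i\<bar>)" if "finite A" for A :: "'n set"
      using that
    proof induction
      case empty
      then show ?case by simp
    next
      case (insert j A)
      define z where "z = x + (\<Sum>i\<in>A. h $ i *\<^sub>R axis i 1)"
      have "\<exists>c. \<bar>c\<bar> \<le> 1 \<and> f (z + h $ j *\<^sub>R axis j 1) - f z = h $ j * partial_deriv j f (z + (c * h $ j) *\<^sub>R axis j 1)"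
      proof -
        have "((\<lambda>t. f (z + t *\<^sub>R (h $ j *\<^sub>R axis j 1))) has_real_derivative
            partial_deriv j f (z + (t * h $ j) *\<^sub>R axis j 1) * h $ j) (at t)" for t
        proof -
          have "((\<lambda>t. t * h $ j) has_real_derivative h $ j) (at t)"
            by (auto intro!: derivative_eq_intros)
          from DERIV_chain2[OF C1_line_derivative[OF assms] this] show ?thesis
            by simp
        qed
        from MVT2[of 0 1, OF _ this] obtain t where
          "0 < t" "t < 1" "f (z + 1 *\<^sub>R (h $ j *\<^sub>R axis j 1)) - f (z + 0 *\<^sub>R (h $ j *\<^sub>R axis j 1)) =
            (1 - 0) * (partial_deriv j f (z + (t * h $ j) *\<^sub>R axis j 1) * h $ j)"
          by auto
        then show ?thesis
          by (intro exI[of _ t]) (auto simp: mult.commute)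
      qed
      then obtain c where c: "\<bar>c\<bar> \<le> 1"
        "f (z + h $ j *\<^sub>R axis j 1) - f z = h $ j * partial_deriv j f (z + (c * h $ j) *\<^sub>R axis j 1)"
        by blast
      have "dist (z + (c * h $ j) *\<^sub>R axis j 1) x =
          norm (\<Sum>i\<in>insert j A. ((if i = j then c else 1) * h $ i) *\<^sub>R axis i (1::real))"
      proof -
        have "(\<Sum>i\<in>insert j A. ((if i = j then c else 1) * h $ i) *\<^sub>R axis i (1::real)) =
           (c * h $ j) *\<^sub>R axis j 1 + (\<Sum>i\<in>A. h $ i *\<^sub>R axis i 1)"
          using insert.hyps by (auto simp: sum.insert intro!: sum.cong)
        then show ?thesis by (simp add: z_def dist_norm algebra_simps)
      qed
      also have "\<dots> \<le> norm h"
        by (rule bd) (use c in auto)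
      also have "\<dots> < d j"
        using y r(2)[of j] by (simp add: h_def)
      finally have "\<bar>partial_deriv j f (z + (c * h $ j) *\<^sub>R axis j 1) - partial_deriv j f x\<bar> < e'"
        by (rule d)
      then have "\<bar>h $ j\<bar> * \<bar>partial_deriv j f (z + (c * h $ j) *\<^sub>R axis j 1) - partial_deriv j f x\<bar>
          \<le> \<bar>h $ j\<bar> * e'"
        by (intro mult_left_mono) auto
      then have 1: "\<bar>f (z + h $ j *\<^sub>R axis j 1) - f z - h $ j * partial_deriv j f x\<bar> \<le> e' * \<bar>h $ j\<bar>"
        unfolding c by (simp add: abs_mult[symmetric] algebra_simps)
      have zz: "x + (\<Sum>i\<in>insert j A. h $ i *\<^sub>R axis i 1) = z + h $ j *\<^sub>R axis j 1"
        using insert.hyps by (simp add: z_def algebra_simps)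
      show ?case
        unfolding zz using 1 insert.IH[folded z_def] insert.hyps
        by (simp add: distrib_left)
    qed
    from this[of UNIV] have "\<bar>f (x + (\<Sum>i\<in>UNIV. h $ i *\<^sub>R axis i 1)) - f x - (\<Sum>i\<in>UNIV. h $ i * partial_deriv i f x)\<bar>
        \<le> e' * (\<Sum>i\<in>UNIV. \<bar>h $ i\<bar>)" by simp
    also have "(\<Sum>i\<in>UNIV. h $ i *\<^sub>R axis i 1) = h"
      by (simp add: vec_eq_iff sum_component axis_def if_distrib cong: if_cong)
    also have "e' * (\<Sum>i\<in>UNIV. \<bar>h $ i\<bar>) \<le> e' * (\<Sum>i\<in>(UNIV::'n set). norm h)"
      using e' by (intro mult_left_mono sum_mono component_le_norm_cart) auto
    finally show "norm (f y - f x - (\<Sum>i\<in>UNIV. (y - x) $ i * partial_deriv i f x)) \<le> e * norm (y - x)"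
      using e' by (simp add: h_def e'_def)
  qed
qed

lemma C1_has_real_derivative_line:
  fixes f :: "real^'n \<Rightarrow> real"
  assumes "C1 f"
  shows "((\<lambda>t. f (x + t *\<^sub>R v)) has_real_derivative
    (\<Sum>i\<in>UNIV. v $ i * partial_deriv i f (x + t *\<^sub>R v))) (at t)"
proof -
  have "((\<lambda>t. x + t *\<^sub>R v) has_derivative (\<lambda>s. s *\<^sub>R v)) (at t)"
    by (auto intro!: derivative_eq_intros)
  from has_derivative_compose[OF this C1_has_derivative[OF assms]] show ?thesis
    unfolding has_field_derivative_def
    by (rule back_subst[of "\<lambda>D. (_ has_derivative D) _"])
      (simp add: fun_eq_iff sum_distrib_left mult_ac)
qed

lemma C2_has_real_derivative_line:
  fixes f :: "real^'n \<Rightarrow> real"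
  assumes "C2 f"
  shows "((\<lambda>t. \<Sum>j\<in>UNIV. v $ j * partial_deriv j f (x + t *\<^sub>R v)) has_real_derivative
    (\<Sum>i\<in>UNIV. \<Sum>j\<in>UNIV. v $ i * v $ j * partial_deriv i (partial_deriv j f) (x + t *\<^sub>R v))) (at t)"
proof -
  have "C1 (partial_deriv j f)" for j
    using assms by (simp add: C2_def)
  then have "((\<lambda>t. \<Sum>j\<in>UNIV. v $ j * partial_deriv j f (x + t *\<^sub>R v)) has_real_derivative
    (\<Sum>j\<in>UNIV. v $ j * (\<Sum>i\<in>UNIV. v $ i * partial_deriv i (partial_deriv j f) (x + t *\<^sub>R v)))) (at t)"
    by (intro DERIV_sum DERIV_cmult C1_has_real_derivative_line)
  also have "(\<Sum>j\<in>UNIV. v $ j * (\<Sum>i\<in>UNIV. v $ i * partial_deriv i (partial_deriv j f) (x + t *\<^sub>R v))) =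
    (\<Sum>i\<in>UNIV. \<Sum>j\<in>UNIV. v $ i * v $ j * partial_deriv i (partial_deriv j f) (x + t *\<^sub>R v))"
    unfolding sum_distrib_left by (subst sum.swap) (simp add: mult_ac)
  finally show ?thesis .
qed

text \<open>Otherwise \<open>\<phi>'\<close>, which vanishes at 0, is positive just to the right of
  0, and by the mean value theorem \<open>\<phi>\<close> rises above its maximum. Differentiability
  of \<open>\<phi>'\<close> at the single point 0 is enough, so continuity of the second derivative
  does not enter.\<close>

lemma second_derivative_le_0_at_local_max:
  fixes \<phi> :: "real \<Rightarrow> real"
  assumes "e > 0"
    and d1: "\<And>t. \<bar>t\<bar> < e \<Longrightarrow> (\<phi> has_real_derivative \<phi>' t) (at t)"
    and d2: "(\<phi>' has_real_derivative D) (at 0)"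
    and mx: "\<And>t. \<bar>t\<bar> < e \<Longrightarrow> \<phi> t \<le> \<phi> 0"
  shows "D \<le> 0"
proof (rule ccontr)
  assume "\<not> D \<le> 0"
  then have "D > 0" by simp
  from DERIV_pos_inc_right[OF d2 this] obtain d where
    d: "d > 0" "\<And>h. 0 < h \<Longrightarrow> h < d \<Longrightarrow> \<phi>' 0 < \<phi>' h"
    by auto
  have "\<phi>' 0 = 0"
    using DERIV_local_max[OF d1[of 0] \<open>e > 0\<close>] \<open>e > 0\<close> mx by simp
  define t where "t = min d e / 2"
  have t: "0 < t" "t < d" "t < e" using d \<open>e > 0\<close> by (auto simp: t_def)
  have "\<exists>z. 0 < z \<and> z < t \<and> \<phi> t - \<phi> 0 = (t - 0) * \<phi>' z"
    by (rule MVT2) (use t d1 in auto)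
  then obtain z where z: "0 < z" "z < t" "\<phi> t - \<phi> 0 = t * \<phi>' z" by auto
  have "\<phi>' z > 0" using d(2)[of z] z t \<open>\<phi>' 0 = 0\<close> by simp
  then have "\<phi> t > \<phi> 0" by (metis diff_gt_0_iff_gt mult_pos_pos z(3) t(1))
  then show False using mx[of t] t by simp
qed

section \<open>Maximum principle in exterior domains\<close>

text \<open>In terms of \<open>s = |x|\<^sup>2\<close>, the left-hand side of the last inequality is twice the operator
  applied to \<open>F(|x|\<^sup>2)\<close>, so \<open>F\<close> is a strict supersolution of linear growth off the ball of radius \<open>\<delta>\<close>.\<close>

lemma barrier_exists:
  fixes \<delta> :: real and n :: nat
  assumes "\<delta> > 0"
  obtains F F' F'' :: "real \<Rightarrow> real" where
    "F (\<delta>\<^sup>2) = 0" "\<And>s. s \<ge> \<delta>\<^sup>2 \<Longrightarrow> sqrt s - \<delta> \<le> F s" "continuous_on {\<delta>\<^sup>2..} F"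
    "\<And>s. s > \<delta>\<^sup>2 \<Longrightarrow> (F has_real_derivative F' s) (at s)"
    "\<And>s. s > \<delta>\<^sup>2 \<Longrightarrow> (F' has_real_derivative F'' s) (at s)"
    "\<And>s. s > \<delta>\<^sup>2 \<Longrightarrow> 4 * s * (1 + s) * F'' s + 2 * (real n + s) * F' s < 0"
proof -
  \<comment> \<open>The first factor is the derivative of \<open>sqrt s\<close> and gives linear
    growth, but alone it turns the expression into \<open>2 * (n - 1)\<close> times itself, which
    has the wrong sign. The second factor is at least 1, so it preserves the growth, and its
    logarithmic derivative \<open>- n / (s * (s + 1))\<close> contributes \<open>- 4 * n\<close>,
    leaving \<open>- 2 - 2 * n\<close>.\<close>
  define F' :: "real \<Rightarrow> real" where "F' = (\<lambda>s. 1 / (2 * sqrt s) * (1 + 1 / s) ^ n)"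
  define F'' :: "real \<Rightarrow> real" where "F'' = (\<lambda>s. F' s * (- 1 / (2 * s) - real n / (s * (s + 1))))"
  define F where "F = (\<lambda>s. integral {\<delta>\<^sup>2..s} F')"
  have \<delta>2: "\<delta>\<^sup>2 > 0" using assms by simp
  have cont: "continuous_on {\<delta>\<^sup>2..b} F'" for b
    unfolding F'_def using \<delta>2 by (intro continuous_intros) auto
  have derw: "(F has_real_derivative F' s) (at s within {\<delta>\<^sup>2..b})" if "s \<in> {\<delta>\<^sup>2..b}" for s b
    unfolding F_def by (rule integral_has_real_derivative[OF cont that])
  have der: "(F has_real_derivative F' s) (at s)" if "s > \<delta>\<^sup>2" for s
    using derw[of s "s+1"] that at_within_interior[of s "{\<delta>\<^sup>2..s+1}"] by simp
  have der2: "(F' has_real_derivative F'' s) (at s)" if "s > \<delta>\<^sup>2" for s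
  proof -
    have s: "s > 0" using that \<delta>2 by linarith
    have a: "((\<lambda>s. 1 / (2 * sqrt s)) has_real_derivative 1 / (2 * sqrt s) * (- 1 / (2 * s))) (at s)"
    proof -
      define r where "r = sqrt s"
      have r: "r > 0" "s = r * r" using s by (simp_all add: r_def)
      have "((\<lambda>s. 1 / (2 * sqrt s)) has_real_derivative - (2 * (inverse (sqrt s) / 2)) / (2 * sqrt s)\<^sup>2) (at s)"
        using s by (auto intro!: derivative_eq_intros simp: power2_eq_square)
      also have "- (2 * (inverse (sqrt s) / 2)) / (2 * sqrt s)\<^sup>2 = 1 / (2 * sqrt s) * (- 1 / (2 * s))"
        unfolding r_def[symmetric] using r(1) by (simp add: r(2) field_simps power2_eq_square)
      finally show ?thesis .
    qed
    have b: "((\<lambda>s. (1 + 1 / s) ^ n) has_real_derivative (1 + 1 / s) ^ n * (- real n / (s * (s + 1)))) (at s)"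
    proof (cases n)
      case (Suc m)
      have "((\<lambda>s. 1 + 1 / s) has_real_derivative - 1 / s\<^sup>2) (at s)"
        using s by (auto intro!: derivative_eq_intros simp: power2_eq_square)
      from DERIV_power[OF this, of n]
      have "((\<lambda>s. (1 + 1 / s) ^ n) has_real_derivative real n * (- 1 / s\<^sup>2 * (1 + 1 / s) ^ m)) (at s)"
        by (simp add: Suc)
      also have "real n * (- 1 / s\<^sup>2 * (1 + 1 / s) ^ m) = (1 + 1 / s) ^ m * ((1 + 1 / s) * (- real n / (s * (s + 1))))"
      proof -
        have "(1 + 1 / s) * (- real n / (s * (s + 1))) = real n * (- 1 / s\<^sup>2)"
          using s by (simp add: divide_simps power2_eq_square)
        then show ?thesis by (simp only: mult_ac)
      qed
      finally show ?thesis by (simp only: Suc power_Suc mult_ac)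
    qed simp
    from DERIV_mult[OF a b] show ?thesis
      unfolding F'_def F''_def
      by (rule back_subst[of "\<lambda>D. (_ has_real_derivative D) _"]) (simp add: algebra_simps)
  qed
  have F'_ge: "F' s \<ge> 1 / (2 * sqrt s)" "F' s > 0" if "s \<ge> \<delta>\<^sup>2" for s
  proof -
    have s: "s > 0" using that \<delta>2 by linarith
    have "1 / (2 * sqrt s) * 1 \<le> F' s"
      unfolding F'_def using s by (intro mult_left_mono one_le_power) auto
    then show "F' s \<ge> 1 / (2 * sqrt s)" by simp
    moreover have "1 / (2 * sqrt s) > 0" using s by simp
    ultimately show "F' s > 0" by linarith
  qed
  have F0: "F (\<delta>\<^sup>2) = 0" by (simp add: F_def)
  have cF: "continuous_on {\<delta>\<^sup>2..b} F" for b
    using derw by (intro continuous_on_eq_continuous_within[THEN iffD2] ballI) (metis DERIV_continuous)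
  show thesis
  proof
    show "F (\<delta>\<^sup>2) = 0" by (rule F0)
    show "continuous_on {\<delta>\<^sup>2..} F"
    proof (rule continuous_on_eq_continuous_within[THEN iffD2], intro ballI)
      fix s assume s: "s \<in> {\<delta>\<^sup>2..}"
      have "at s within {\<delta>\<^sup>2..} = at s within {\<delta>\<^sup>2..s+1}"
        by (rule at_within_nhd[of s "{s-1<..<s+1}"]) auto
      moreover have "continuous (at s within {\<delta>\<^sup>2..s+1}) F"
        using derw[of s "s+1"] s DERIV_continuous by auto
      ultimately show "continuous (at s within {\<delta>\<^sup>2..}) F" by simp
    qed
    fix s assume s: "s \<ge> \<delta>\<^sup>2"
    have "F (\<delta>\<^sup>2) - sqrt (\<delta>\<^sup>2) \<le> F s - sqrt s"
    proof (rule DERIV_nonneg_imp_increasing_open[OF s])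
      fix x assume x: "\<delta>\<^sup>2 < x" "x < s"
      then have "x > 0" using \<delta>2 by linarith
      with x have "((\<lambda>s. F s - sqrt s) has_real_derivative F' x - 1 / (2 * sqrt x)) (at x)"
        by (auto intro!: derivative_eq_intros der simp: field_simps)
      then show "\<exists>y. ((\<lambda>s. F s - sqrt s) has_real_derivative y) (at x) \<and> 0 \<le> y"
        using F'_ge(1)[of x] x by (intro exI conjI) auto
    qed (intro continuous_intros cF)
    then show "sqrt s - \<delta> \<le> F s" using F0 assms by simp
  next
    fix s assume s: "s > \<delta>\<^sup>2"
    then have s0: "s > 0" using \<delta>2 by linarith
    show "(F has_real_derivative F' s) (at s)" by (rule der[OF s])
    show "(F' has_real_derivative F'' s) (at s)" by (rule der2[OF s])
    have "4 * s * (1 + s) * F'' s + 2 * (real n + s) * F' s = F' s * (- 2 - 2 * real n)"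
      unfolding F''_def using s0 by (simp add: divide_simps) (simp add: algebra_simps)
    also have "\<dots> < 0" using F'_ge(2)[of s] s by (simp add: mult_less_0_iff)
    finally show "4 * s * (1 + s) * F'' s + 2 * (real n + s) * F' s < 0" .
  qed
qed

text \<open>Twice the operator of the theorem.\<close>

definition ell_op :: "(real^'n \<Rightarrow> real) \<Rightarrow> real^'n \<Rightarrow> real" where
  "ell_op u x = (\<Sum>i\<in>UNIV. \<Sum>j\<in>UNIV.
     ((if i = j then 1 else 0) + x $ i * x $ j) * partial_deriv i (partial_deriv j u) x)"

text \<open>The rank one part of the coefficient matrix yields the second derivative at
  \<open>x\<close> in the direction \<open>x\<close>, so only second derivatives along lines
  remain.\<close>

lemma ell_op_eq:
  "ell_op u x = (\<Sum>k\<in>UNIV. partial_deriv k (partial_deriv k u) x) +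
     (\<Sum>i\<in>UNIV. \<Sum>j\<in>UNIV. x $ i * x $ j * partial_deriv i (partial_deriv j u) x)"
proof -
  have "ell_op u x = (\<Sum>i\<in>UNIV. \<Sum>j\<in>UNIV. (if i = j then partial_deriv i (partial_deriv j u) x else 0) +
     x $ i * x $ j * partial_deriv i (partial_deriv j u) x)"
    unfolding ell_op_def by (intro sum.cong refl) (simp add: algebra_simps)
  then show ?thesis by (simp add: sum.distrib)
qed

text \<open>If the bound failed, \<open>v\<close> would have a maximum \<open>p\<close> strictly
  inside a shell, and none of its second derivatives at \<open>p\<close> along the axes and along
  \<open>p\<close> would be positive. Their sum, however, is
  \<open>ell_op u1 p - ell_op u2 p = 0\<close> minus \<open>\<epsilon>\<close> times the negative
  barrier expression, which is positive.\<close>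

lemma exterior_comparison:
  fixes u1 u2 :: "real^'n \<Rightarrow> real"
  assumes C2: "C2 u1" "C2 u2"
    and eq: "\<And>x. ell_op u1 x = ell_op u2 x"
    and "\<delta> > 0" "\<epsilon> > 0" "\<eta> \<ge> 0"
    and bdry: "\<And>x. norm x = \<delta> \<Longrightarrow> u1 x - u2 x \<le> \<eta>"
    and inf: "\<And>x. norm x \<ge> R \<Longrightarrow> u1 x - u2 x \<le> \<epsilon> * (norm x - \<delta>)"
    and F: "F (\<delta>\<^sup>2) = 0" "\<And>s. s \<ge> \<delta>\<^sup>2 \<Longrightarrow> sqrt s - \<delta> \<le> F s" "continuous_on {\<delta>\<^sup>2..} F"
    "\<And>s. s > \<delta>\<^sup>2 \<Longrightarrow> (F has_real_derivative F' s) (at s)"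
    "\<And>s. s > \<delta>\<^sup>2 \<Longrightarrow> (F' has_real_derivative F'' s) (at s)"
    "\<And>s. s > \<delta>\<^sup>2 \<Longrightarrow> 4 * s * (1 + s) * F'' s + 2 * (real CARD('n) + s) * F' s < 0"
    and x: "norm x \<ge> \<delta>"
  shows "u1 x - u2 x - \<epsilon> * F ((norm x)\<^sup>2) \<le> \<eta>"
proof (rule ccontr)
  define v where "v = (\<lambda>x. u1 x - u2 x - \<epsilon> * F ((norm x)\<^sup>2))"
  assume "\<not> ?thesis"
  then have vx: "v x > \<eta>" by (simp add: v_def)
  have sq: "\<delta>\<^sup>2 \<le> (norm y)\<^sup>2" if "norm y \<ge> \<delta>" for y :: "real^'n"
    using that \<open>\<delta> > 0\<close> by (intro power_mono) auto
  \<comment> \<open>Beyond \<open>R\<close> the barrier dominates the difference, so the maximum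
    over the shell is not attained on the outer sphere; the second entry makes the shell contain
    \<open>x\<close>.\<close>
  define S where "S = max R (norm x + 1)"
  define K where "K = cball 0 S - ball (0::real^'n) \<delta>"
  have "compact K" unfolding K_def by (intro compact_diff) auto
  moreover have "x \<in> K" using x by (auto simp: K_def S_def)
  moreover have "continuous_on K v"
  proof -
    have "continuous_on UNIV u1" "continuous_on UNIV u2"
      using C2 by (auto simp: C2_def C1_def)
    moreover have "continuous_on K (\<lambda>x. F ((norm x)\<^sup>2))"
      by (rule continuous_on_compose2[OF F(3)]) (auto intro!: continuous_intros sq simp: K_def)
    ultimately show ?thesis unfolding v_def
      by (intro continuous_intros) (auto intro: continuous_on_subset)
  qed
  ultimately obtain p where p: "p \<in> K" "\<And>y. y \<in> K \<Longrightarrow> v y \<le> v p"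
    using continuous_attains_sup[of K v] by blast
  have vp: "v p > \<eta>" using p(2)[OF \<open>x \<in> K\<close>] vx by simp
  have n1: "norm p \<noteq> \<delta>"
    using bdry[of p] vp F(1) by (auto simp: v_def)
  have n2: "norm p < S"
  proof (rule ccontr)
    assume "\<not> norm p < S"
    then have a: "norm p \<ge> R" by (auto simp: S_def)
    have "norm p \<ge> \<delta>" using p(1) by (auto simp: K_def)
    then have "\<epsilon> * (norm p - \<delta>) \<le> \<epsilon> * F ((norm p)\<^sup>2)"
      using F(2)[OF sq[of p]] \<open>\<epsilon> > 0\<close> by (intro mult_left_mono) auto
    with inf[OF a] have "v p \<le> 0"
      by (simp add: v_def)
    then show False using vp \<open>\<eta> \<ge> 0\<close> by simp
  qed
  have pK: "p \<in> ball 0 S - cball 0 \<delta>" using p(1) n1 n2 by (auto simp: K_def)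
  have "open (ball 0 S - cball (0::real^'n) \<delta>)" by (intro open_Diff) auto
  with pK obtain e where e: "e > 0" "ball p e \<subseteq> ball 0 S - cball 0 \<delta>"
    by (meson open_contains_ball)
  define H where "H = (\<lambda>u h. \<Sum>i\<in>UNIV. \<Sum>j\<in>UNIV. h $ i * h $ j * partial_deriv i (partial_deriv j u) p)"
  define s where "s = (norm p)\<^sup>2"
  have s: "s > \<delta>\<^sup>2" unfolding s_def using pK \<open>\<delta> > 0\<close> by (intro power_strict_mono) auto
  have le: "H u1 h - H u2 h - \<epsilon> * (F'' s * (2 * (p \<bullet> h))\<^sup>2 + F' s * (2 * (norm h)\<^sup>2)) \<le> 0" if h: "norm h > 0" for h :: "real^'n"
  proof (rule second_derivative_le_0_at_local_max)
    show "e / norm h > 0" using e h by simp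
    have nn: "(norm (p + t *\<^sub>R h))\<^sup>2 = s + 2 * (p \<bullet> h) * t + (norm h)\<^sup>2 * t\<^sup>2" for t
      unfolding s_def power2_norm_eq_inner by (simp add: inner_simps algebra_simps power2_eq_square inner_commute)
    define \<rho> where "\<rho> = (\<lambda>t. s + 2 * (p \<bullet> h) * t + (norm h)\<^sup>2 * t\<^sup>2)"
    define \<rho>' where "\<rho>' = (\<lambda>t. 2 * (p \<bullet> h) + (norm h)\<^sup>2 * (2 * t))"
    have d\<rho>: "(\<rho> has_real_derivative \<rho>' t) (at t)" for t
      unfolding \<rho>_def \<rho>'_def by (auto intro!: derivative_eq_intros)
    have d\<rho>': "(\<rho>' has_real_derivative 2 * (norm h)\<^sup>2) (at t)" for t
      unfolding \<rho>'_def by (auto intro!: derivative_eq_intros)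
    have inb: "p + t *\<^sub>R h \<in> ball p e" if "\<bar>t\<bar> < e / norm h" for t
      using that h by (simp add: dist_norm field_simps)
    define \<phi>' where "\<phi>' = (\<lambda>t. (\<Sum>j\<in>UNIV. h $ j * partial_deriv j u1 (p + t *\<^sub>R h)) -
       (\<Sum>j\<in>UNIV. h $ j * partial_deriv j u2 (p + t *\<^sub>R h)) - \<epsilon> * (F' (\<rho> t) * \<rho>' t))"
    show "((\<lambda>t. v (p + t *\<^sub>R h)) has_real_derivative \<phi>' t) (at t)" if "\<bar>t\<bar> < e / norm h" for t
    proof -
      have "norm (p + t *\<^sub>R h) > \<delta>" using inb[OF that] e(2) by (auto simp: subset_iff)
      then have "\<delta>\<^sup>2 < \<rho> t" unfolding \<rho>_def nn[symmetric]
        using \<open>\<delta> > 0\<close> by (intro power_strict_mono) auto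
      then have "((\<lambda>t. F (\<rho> t)) has_real_derivative F' (\<rho> t) * \<rho>' t) (at t)"
        by (intro DERIV_chain2[OF F(4) d\<rho>])
      then show ?thesis
        unfolding v_def nn \<phi>'_def \<rho>_def[symmetric] using C2
        by (intro DERIV_diff DERIV_cmult C1_has_real_derivative_line) (auto simp: C2_def \<rho>_def)
    qed
    have \<rho>0: "\<rho> 0 = s" "\<rho>' 0 = 2 * (p \<bullet> h)" by (simp_all add: \<rho>_def \<rho>'_def)
    have "((\<lambda>t. F' (\<rho> t)) has_real_derivative F'' (\<rho> 0) * \<rho>' 0) (at 0)"
      using s by (intro DERIV_chain2[OF F(5) d\<rho>]) (simp add: \<rho>0)
    from DERIV_mult[OF this d\<rho>'[of 0]]
    have "((\<lambda>t. F' (\<rho> t) * \<rho>' t) has_real_derivative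
        (F'' s * (2 * (p \<bullet> h))\<^sup>2 + F' s * (2 * (norm h)\<^sup>2))) (at 0)"
      by (simp add: \<rho>0 power2_eq_square algebra_simps)
    then show "(\<phi>' has_real_derivative
      H u1 h - H u2 h - \<epsilon> * (F'' s * (2 * (p \<bullet> h))\<^sup>2 + F' s * (2 * (norm h)\<^sup>2))) (at 0)"
      unfolding \<phi>'_def H_def
      using C2_has_real_derivative_line[OF C2(1), of h p 0] C2_has_real_derivative_line[OF C2(2), of h p 0]
      by (intro DERIV_diff DERIV_cmult) auto
    show "v (p + t *\<^sub>R h) \<le> v (p + 0 *\<^sub>R h)" if "\<bar>t\<bar> < e / norm h" for t
      using inb[OF that] e(2) p(2)[of "p + t *\<^sub>R h"] by (force simp: K_def)
  qed
  have H_axis: "H u (axis k 1) = partial_deriv k (partial_deriv k u) p" for u k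
  proof -
    have "H u (axis k 1) = (\<Sum>i\<in>UNIV. if i = k then (\<Sum>j\<in>UNIV. if j = k then partial_deriv i (partial_deriv j u) p else 0) else 0)"
      unfolding H_def by (intro sum.cong refl) (simp add: axis_def mult_delta_left)
    then show ?thesis by simp
  qed
  have op: "ell_op u p = (\<Sum>k\<in>UNIV. H u (axis k 1)) + H u p" for u
    unfolding ell_op_eq H_axis by (simp add: H_def)
  \<comment> \<open>\<open>Q h\<close> is the second derivative at \<open>p\<close> in direction
    \<open>h\<close> of \<open>F\<close> composed with the squared norm. Over the axes and
    \<open>p\<close> it sums to the left-hand side of the last barrier inequality.\<close>
  define Q where "Q = (\<lambda>h. F'' s * (2 * (p \<bullet> h))\<^sup>2 + F' s * (2 * (norm h)\<^sup>2))"
  have Qle: "H u1 h - H u2 h \<le> \<epsilon> * Q h" if "norm h > 0" for h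
    using le[OF that] by (simp add: Q_def)
  have "(\<Sum>k\<in>UNIV. H u1 (axis k 1) - H u2 (axis k 1)) + (H u1 p - H u2 p)
      \<le> (\<Sum>k\<in>UNIV. \<epsilon> * Q (axis k 1)) + \<epsilon> * Q p"
    using pK \<open>\<delta> > 0\<close> by (intro add_mono sum_mono Qle) (auto simp: norm_axis_1)
  also have "(\<Sum>k\<in>UNIV. H u1 (axis k 1) - H u2 (axis k 1)) + (H u1 p - H u2 p) = 0"
    using eq[of p] unfolding op by (simp add: sum_subtractf)
  finally have "0 \<le> \<epsilon> * ((\<Sum>k\<in>UNIV. Q (axis k 1)) + Q p)"
    by (simp add: sum_distrib_left distrib_left)
  then have "0 \<le> (\<Sum>k\<in>UNIV. Q (axis k 1)) + Q p"
    using \<open>\<epsilon> > 0\<close> by (simp add: zero_le_mult_iff)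
  also have "(\<Sum>k\<in>UNIV. Q (axis k 1)) = F'' s * 4 * s + F' s * 2 * real CARD('n)"
  proof -
    have sum_p: "(\<Sum>k\<in>UNIV. (p $ k)\<^sup>2) = s"
      by (simp add: s_def norm_vec_def L2_set_def sum_nonneg)
    have "(\<Sum>k\<in>UNIV. Q (axis k 1)) = (\<Sum>k\<in>UNIV. F'' s * 4 * (p $ k)\<^sup>2 + F' s * 2)"
      by (intro sum.cong refl) (simp add: Q_def norm_axis_1 inner_axis power_mult_distrib)
    also have "\<dots> = F'' s * 4 * s + F' s * 2 * real CARD('n)"
      unfolding sum.distrib sum_distrib_left[symmetric] sum_p by simp
    finally show ?thesis .
  qed
  also have "Q p = F'' s * (4 * s\<^sup>2) + F' s * (2 * s)"
    by (simp add: Q_def s_def dot_square_norm power_mult_distrib)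
  finally show False using F(6)[OF s] by (simp add: algebra_simps power2_eq_square)
qed

text \<open>Two limits in this order: continuity and the common value at 0 keep the difference below
  \<open>\<eta>\<close> on a small sphere; with that sphere fixed, \<open>\<epsilon>\<close> tends
  to 0 in \<open>exterior_comparison\<close>, and only then \<open>\<eta>\<close> tends to
  0.\<close>

lemma ell_op_comparison:
  fixes u1 u2 :: "real^'n \<Rightarrow> real"
  assumes C2: "C2 u1" "C2 u2"
    and eq: "\<And>x. ell_op u1 x = ell_op u2 x"
    and zero: "u1 0 = u2 0"
    and growth: "\<And>\<epsilon>. \<epsilon> > 0 \<Longrightarrow> \<exists>R. \<forall>x. norm x \<ge> R \<longrightarrow> u1 x - u2 x \<le> \<epsilon> * norm x"
  shows "u1 x \<le> u2 x"
proof (cases "x = 0")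
  case True
  then show ?thesis using zero by simp
next
  case False
  have "u1 x - u2 x \<le> \<eta>" if \<eta>: "\<eta> > 0" for \<eta>
  proof -
    have "continuous_on UNIV (\<lambda>x. u1 x - u2 x)"
      using C2 by (intro continuous_intros) (auto simp: C2_def C1_def)
    then have "isCont (\<lambda>x. u1 x - u2 x) 0"
      using continuous_on_eq_continuous_at[OF open_UNIV] by blast
    then obtain d where d: "d > 0" "\<And>y. norm y < d \<Longrightarrow> \<bar>u1 y - u2 y\<bar> < \<eta>"
      using \<eta> zero unfolding continuous_at_eps_delta dist_real_def by force
    \<comment> \<open>The minimum with \<open>norm x\<close> keeps \<open>x\<close> in the exterior
      domain.\<close>
    define \<delta> where "\<delta> = min (d / 2) (norm x)"
    have \<delta>: "\<delta> > 0" "\<delta> < d" "\<delta> \<le> norm x" using d False by (auto simp: \<delta>_def)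
    obtain F F' F'' where F: "F (\<delta>\<^sup>2) = 0" "\<And>s. s \<ge> \<delta>\<^sup>2 \<Longrightarrow> sqrt s - \<delta> \<le> F s" "continuous_on {\<delta>\<^sup>2..} F"
      "\<And>s. s > \<delta>\<^sup>2 \<Longrightarrow> (F has_real_derivative F' s) (at s)"
      "\<And>s. s > \<delta>\<^sup>2 \<Longrightarrow> (F' has_real_derivative F'' s) (at s)"
      "\<And>s. s > \<delta>\<^sup>2 \<Longrightarrow> 4 * s * (1 + s) * F'' s + 2 * (real CARD('n) + s) * F' s < 0"
      using barrier_exists[OF \<delta>(1)] by metis
    have "u1 x - u2 x - \<epsilon> * F ((norm x)\<^sup>2) \<le> \<eta>" if \<epsilon>: "\<epsilon> > 0" for \<epsilon>
    proof -
      \<comment> \<open>The other half of \<open>\<epsilon>\<close> pays for the shift by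
        \<open>\<delta>\<close>: once \<open>norm y\<close> is at least \<open>2 * \<delta>\<close>,
        half of \<open>norm y\<close> is at most \<open>norm y - \<delta>\<close>.\<close>
      obtain R where R: "\<And>y. norm y \<ge> R \<Longrightarrow> u1 y - u2 y \<le> \<epsilon> / 2 * norm y"
        using growth[of "\<epsilon> / 2"] \<epsilon> by auto
      show ?thesis
      proof (rule exterior_comparison[OF C2 eq \<delta>(1) \<epsilon> _ _ _ F \<delta>(3)])
        show "u1 y - u2 y \<le> \<eta>" if "norm y = \<delta>" for y
          using d(2)[of y] that \<delta> by force
        show "u1 y - u2 y \<le> \<epsilon> * (norm y - \<delta>)" if "norm y \<ge> max R (2 * \<delta>)" for y
        proof -
          have "u1 y - u2 y \<le> \<epsilon> * (norm y / 2)" using R[of y] that by simp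
          also have "\<dots> \<le> \<epsilon> * (norm y - \<delta>)" using that \<epsilon> by (intro mult_left_mono) auto
          finally show ?thesis .
        qed
      qed (use \<eta> in auto)
    qed
    note a = this
    have "((\<lambda>\<epsilon>. u1 x - u2 x - \<epsilon> * F ((norm x)\<^sup>2)) \<longlongrightarrow> u1 x - u2 x - 0 * F ((norm x)\<^sup>2)) (at_right 0)"
      by (intro tendsto_intros)
    then have "u1 x - u2 x - 0 * F ((norm x)\<^sup>2) \<le> \<eta>"
      by (rule tendsto_upperbound) (auto intro!: a eventually_at_right_less[THEN eventually_mono])
    then show ?thesis by simp
  qed
  then show ?thesis
    by (metis diff_le_0_iff_le field_le_epsilon add_0)
qed

section \<open>Polar coordinates and the integral of the Poisson kernel\<close>

lemma nn_integral_lborel_scaleR: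
  fixes f :: "'a::euclidean_space \<Rightarrow> ennreal"
  assumes [measurable]: "f \<in> borel_measurable borel" and "c \<noteq> 0"
  shows "(\<integral>\<^sup>+y. f y \<partial>lborel) = ennreal (\<bar>c\<bar> ^ DIM('a)) * (\<integral>\<^sup>+z. f (c *\<^sub>R z) \<partial>lborel)"
  by (subst lborel_affine[OF \<open>c \<noteq> 0\<close>, of 0])
    (simp add: nn_integral_density nn_integral_distr nn_integral_cmult)

lemma nn_integral_power_tail:
  fixes a :: real and n :: nat
  assumes a: "a > 0" and n: "n > 0"
  shows "(\<integral>\<^sup>+t. ennreal (real n * a ^ n / t ^ (n + 1)) * indicator {a<..} t \<partial>lborel) = 1"
proof -
  have "(\<integral>\<^sup>+t. ennreal (real n * a ^ n / t ^ (n + 1)) * indicator {a<..} t \<partial>lborel) =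
      (\<integral>\<^sup>+t. ennreal (real n * a ^ n / t ^ (n + 1)) * indicator {a..} t \<partial>lborel)"
    using AE_lborel_singleton[of a]
    by (intro nn_integral_cong_AE) (auto elim!: eventually_mono simp: indicator_def)
  also have "\<dots> = ennreal (0 - (- (a ^ n / a ^ n)))"
  proof (rule nn_integral_FTC_atLeast[where F = "\<lambda>t. - (a ^ n / t ^ n)" and T = 0])
    fix t assume "a \<le> t"
    then have t: "t > 0" using a by linarith
    show "0 \<le> real n * a ^ n / t ^ (n + 1)" using a t by simp
    have "((\<lambda>t. - (a ^ n * inverse (t ^ n))) has_real_derivative
        a ^ n * (inverse (t ^ n) * (real n * t ^ (n - 1)) * inverse (t ^ n))) (at t)"
      using t by (auto intro!: derivative_eq_intros)
    also have "a ^ n * (inverse (t ^ n) * (real n * t ^ (n - 1)) * inverse (t ^ n)) = real n * a ^ n / t ^ (n + 1)"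
    proof -
      obtain m where "n = Suc m" using n by (cases n) auto
      then show ?thesis using t by (simp add: field_simps)
    qed
    finally show "((\<lambda>t. - (a ^ n / t ^ n)) has_real_derivative real n * a ^ n / t ^ (n + 1)) (at t)"
      by (simp add: divide_inverse)
  next
    have "((\<lambda>t::real. - (a ^ n * inverse (t ^ n))) \<longlongrightarrow> - (a ^ n * 0)) at_top"
      by (intro tendsto_intros tendsto_inverse_0_at_top filterlim_pow_at_top filterlim_ident) (use n in auto)
    then show "((\<lambda>t. - (a ^ n / t ^ n)) \<longlongrightarrow> 0) at_top"
      by (simp add: divide_inverse)
  qed auto
  also have "\<dots> = 1" using a by simp
  finally show ?thesis .
qed

text \<open>The direction is represented by a point \<open>z\<close> of the unit ball, of which only
  \<open>z /\<^sub>R norm z\<close> matters, exactly as in \<open>sphere_measure\<close>. The factor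
  \<open>DIM('a)\<close> is the ratio of the area of the unit sphere to the volume of the unit
  ball.\<close>

definition polar_weight :: "'a::euclidean_space \<times> real \<Rightarrow> real" where
  "polar_weight = (\<lambda>(z, s). real DIM('a) * s ^ (DIM('a) - 1) * indicator (ball 0 1) z * indicator {0<..} s)"

lemma polar_weight_nonneg: "polar_weight p \<ge> 0"
  by (auto simp: polar_weight_def indicator_def split: prod.split)

lemma polar_weight_measurable [measurable]:
  "(polar_weight :: 'a::euclidean_space \<times> real \<Rightarrow> real) \<in> borel_measurable (borel \<Otimes>\<^sub>M borel)"
proof -
  have "polar_weight = (\<lambda>p::'a \<times> real. real DIM('a) * snd p ^ (DIM('a) - 1) *
      (if norm (fst p) < 1 \<and> 0 < snd p then 1 else 0))"
    by (auto simp: polar_weight_def indicator_def fun_eq_iff)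
  then show ?thesis by (rule ssubst) measurable
qed

text \<open>Insert the factor \<open>1 = \<integral> D |y|\<^sup>D t\<^sup>-\<^sup>D\<^sup>-\<^sup>1 dt\<close> over \<open>t > |y|\<close>, substitute \<open>y = t z\<close> with
  \<open>z\<close> in the unit ball, and finally \<open>s = t |z|\<close>.\<close>

lemma nn_integral_lborel_polar:
  fixes f :: "'a::euclidean_space \<Rightarrow> ennreal"
  assumes [measurable]: "f \<in> borel_measurable borel"
  shows "(\<integral>\<^sup>+y. f y \<partial>lborel) =
    (\<integral>\<^sup>+z. \<integral>\<^sup>+s. ennreal (polar_weight (z, s)) * f (s *\<^sub>R (z /\<^sub>R norm z)) \<partial>lborel \<partial>lborel)"
proof -
  let ?D = "DIM('a)"
  define h :: "'a \<Rightarrow> real \<Rightarrow> ennreal" where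
    "h = (\<lambda>y t. ennreal (real ?D * norm y ^ ?D / t ^ (?D + 1)) * indicator {norm y<..} t)"
  have [measurable]: "(\<lambda>p. h (fst p) (snd p)) \<in> borel_measurable (borel \<Otimes>\<^sub>M borel)"
  proof -
    have "(\<lambda>p. h (fst p) (snd p)) = (\<lambda>p::'a \<times> real. ennreal (real ?D * norm (fst p) ^ ?D / snd p ^ (?D + 1)) *
        (if norm (fst p) < snd p then 1 else 0))"
      by (auto simp: h_def indicator_def fun_eq_iff)
    then show ?thesis by simp
  qed
  have "(\<integral>\<^sup>+y. f y \<partial>lborel) = (\<integral>\<^sup>+y. \<integral>\<^sup>+t. h y t * f y \<partial>lborel \<partial>lborel)"
  proof (rule nn_integral_cong_AE)
    \<comment> \<open>At \<open>y = 0\<close> the inserted factor integrates to 0 instead of 1, so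
      equality can fail there.\<close>
    show "AE y in lborel. f y = (\<integral>\<^sup>+t. h y t * f y \<partial>lborel)"
      using AE_lborel_singleton[of "0::'a"]
    proof eventually_elim
      case (elim y)
      have "(\<integral>\<^sup>+t. h y t * f y \<partial>lborel) = (\<integral>\<^sup>+t. h y t \<partial>lborel) * f y"
        by (subst nn_integral_multc) (auto simp: h_def)
      also have "(\<integral>\<^sup>+t. h y t \<partial>lborel) = 1"
        unfolding h_def by (rule nn_integral_power_tail) (use elim in auto)
      finally show ?case by simp
    qed
  qed
  also have "\<dots> = (\<integral>\<^sup>+t. \<integral>\<^sup>+y. h y t * f y \<partial>lborel \<partial>lborel)"
    by (rule lborel_pair.Fubini'[symmetric]) (simp add: split_beta')
  also have "\<dots> = (\<integral>\<^sup>+t. \<integral>\<^sup>+z. ennreal (real ?D * norm z ^ ?D * t ^ (?D - 1) * (if norm z < 1 \<and> 0 < t then 1 else 0))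
      * f (t *\<^sub>R z) \<partial>lborel \<partial>lborel)"
  proof (rule nn_integral_cong)
    fix t :: real
    show "(\<integral>\<^sup>+y. h y t * f y \<partial>lborel) = (\<integral>\<^sup>+z. ennreal (real ?D * norm z ^ ?D * t ^ (?D - 1) * (if norm z < 1 \<and> 0 < t then 1 else 0))
      * f (t *\<^sub>R z) \<partial>lborel)"
    proof (cases "t > 0")
      case False
      then have "h y t = 0" for y by (auto simp: h_def indicator_def dest: le_less_trans[OF norm_ge_zero])
      then show ?thesis using False by simp
    next
      case True
      have "(\<lambda>y. h y t) = (\<lambda>y. ennreal (real ?D * norm y ^ ?D / t ^ (?D + 1)) * (if norm y < t then 1 else 0))"
        by (auto simp: h_def indicator_def fun_eq_iff)
      then have [measurable]: "(\<lambda>y. h y t) \<in> borel_measurable borel" by simp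
      have m: "(\<lambda>y. h y t * f y) \<in> borel_measurable borel" by measurable
      have "(\<integral>\<^sup>+y. h y t * f y \<partial>lborel) = ennreal (t ^ ?D) * (\<integral>\<^sup>+z. h (t *\<^sub>R z) t * f (t *\<^sub>R z) \<partial>lborel)"
        using True nn_integral_lborel_scaleR[OF m, of t] by simp
      also have "\<dots> = (\<integral>\<^sup>+z. ennreal (t ^ ?D) * (h (t *\<^sub>R z) t * f (t *\<^sub>R z)) \<partial>lborel)"
        by (subst nn_integral_cmult) simp_all
      also have "\<dots> = (\<integral>\<^sup>+z. ennreal (real ?D * norm z ^ ?D * t ^ (?D - 1) * (if norm z < 1 \<and> 0 < t then 1 else 0))
      * f (t *\<^sub>R z) \<partial>lborel)"
      proof (rule nn_integral_cong)
        fix z :: 'a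
        have "ennreal (t ^ ?D) * h (t *\<^sub>R z) t =
           ennreal (t ^ ?D * (real ?D * norm (t *\<^sub>R z) ^ ?D / t ^ (?D + 1))) * indicator {norm (t *\<^sub>R z)<..} t"
          unfolding h_def mult.assoc[symmetric] using True by (subst ennreal_mult) auto
        also have "t ^ ?D * (real ?D * norm (t *\<^sub>R z) ^ ?D / t ^ (?D + 1)) = real ?D * norm z ^ ?D * t ^ (?D - 1)"
        proof -
          obtain m where "?D = Suc m" using DIM_positive[where 'a='a] by (cases ?D) auto
          then show ?thesis using True by (simp add: power_mult_distrib field_simps)
        qed
        also have "ennreal (real ?D * norm z ^ ?D * t ^ (?D - 1)) * indicator {norm (t *\<^sub>R z)<..} t =
           ennreal (real ?D * norm z ^ ?D * t ^ (?D - 1) * (if norm z < 1 \<and> 0 < t then 1 else 0))"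
          using True by (auto simp: indicator_def)
        finally show "ennreal (t ^ ?D) * (h (t *\<^sub>R z) t * f (t *\<^sub>R z)) = ennreal (real ?D * norm z ^ ?D * t ^ (?D - 1) * (if norm z < 1 \<and> 0 < t then 1 else 0)) * f (t *\<^sub>R z)"
          by (simp add: mult.assoc[symmetric])
      qed
      finally show ?thesis .
    qed
  qed
  also have "\<dots> = (\<integral>\<^sup>+z. \<integral>\<^sup>+t. ennreal (real ?D * norm z ^ ?D * t ^ (?D - 1) * (if norm z < 1 \<and> 0 < t then 1 else 0))
      * f (t *\<^sub>R z) \<partial>lborel \<partial>lborel)"
    by (rule lborel_pair.Fubini') (simp add: split_beta')
  also have "\<dots> = (\<integral>\<^sup>+z. \<integral>\<^sup>+s. ennreal (polar_weight (z, s)) * f (s *\<^sub>R (z /\<^sub>R norm z)) \<partial>lborel \<partial>lborel)"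
  proof (rule nn_integral_cong_AE)
    show "AE z in lborel. (\<integral>\<^sup>+t. ennreal (real ?D * norm z ^ ?D * t ^ (?D - 1) * (if norm z < 1 \<and> 0 < t then 1 else 0))
        * f (t *\<^sub>R z) \<partial>lborel) = (\<integral>\<^sup>+s. ennreal (polar_weight (z, s)) * f (s *\<^sub>R (z /\<^sub>R norm z)) \<partial>lborel)"
      using AE_lborel_singleton[of "0::'a"]
    proof eventually_elim
      case (elim z)
      have m: "(\<lambda>s. ennreal (polar_weight (z, s)) * f (s *\<^sub>R (z /\<^sub>R norm z))) \<in> borel_measurable borel"
        by measurable
      have "(\<integral>\<^sup>+s. ennreal (polar_weight (z, s)) * f (s *\<^sub>R (z /\<^sub>R norm z)) \<partial>lborel) =
         (\<integral>\<^sup>+t. ennreal (norm z) * (ennreal (polar_weight (z, norm z * t)) * f ((norm z * t) *\<^sub>R (z /\<^sub>R norm z))) \<partial>lborel)"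
        using nn_integral_real_affine[OF m, of "norm z" 0] elim
        by (subst nn_integral_cmult) simp_all
      also have "\<dots> = (\<integral>\<^sup>+t. ennreal (real ?D * norm z ^ ?D * t ^ (?D - 1) * (if norm z < 1 \<and> 0 < t then 1 else 0))
        * f (t *\<^sub>R z) \<partial>lborel)"
      proof (rule nn_integral_cong)
        fix t :: real
        have "norm z * polar_weight (z, norm z * t) = real ?D * norm z ^ ?D * t ^ (?D - 1) * (if norm z < 1 \<and> 0 < t then 1 else 0)"
        proof -
          obtain m where "?D = Suc m" using DIM_positive[where 'a='a] by (cases ?D) auto
          then show ?thesis using elim
            by (auto simp: polar_weight_def indicator_def power_mult_distrib zero_less_mult_iff)
        qed
        moreover have "(norm z * t) *\<^sub>R (z /\<^sub>R norm z) = t *\<^sub>R z" using elim by simp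
        moreover have "ennreal (norm z) * ennreal (polar_weight (z, norm z * t)) = ennreal (norm z * polar_weight (z, norm z * t))"
          by (simp add: ennreal_mult polar_weight_nonneg)
        ultimately show "ennreal (norm z) * (ennreal (polar_weight (z, norm z * t)) * f ((norm z * t) *\<^sub>R (z /\<^sub>R norm z))) =
          ennreal (real ?D * norm z ^ ?D * t ^ (?D - 1) * (if norm z < 1 \<and> 0 < t then 1 else 0)) * f (t *\<^sub>R z)"
          by (metis mult.assoc)
      qed
      finally show ?case by simp
    qed
  qed
  finally show ?thesis .
qed

text \<open>As an identity of measures the polar formula carries over to integrability and to signed
  integrands by the rules for image measures and densities, without splitting into positive and
  negative parts.\<close>

lemma lborel_eq_distr_polar:
  "(lborel :: 'a::euclidean_space measure) =
     distr (density (lborel \<Otimes>\<^sub>M lborel) polar_weight) borel (\<lambda>(z, s). s *\<^sub>R (z /\<^sub>R norm z))"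
proof (rule measure_eqI)
  show "sets (lborel :: 'a measure) = sets (distr (density (lborel \<Otimes>\<^sub>M lborel) polar_weight) borel (\<lambda>(z, s). s *\<^sub>R (z /\<^sub>R norm z)))"
    by simp
  fix A :: "'a set" assume "A \<in> sets lborel"
  then have [measurable]: "A \<in> sets borel" by simp
  have "emeasure lborel A = (\<integral>\<^sup>+y. indicator A y \<partial>lborel)" by simp
  also have "\<dots> = (\<integral>\<^sup>+z. \<integral>\<^sup>+s. ennreal (polar_weight (z, s)) * indicator A (s *\<^sub>R (z /\<^sub>R norm z)) \<partial>lborel \<partial>lborel)"
    by (rule nn_integral_lborel_polar) simp
  also have "\<dots> = (\<integral>\<^sup>+p. ennreal (polar_weight p) * indicator A (snd p *\<^sub>R (fst p /\<^sub>R norm (fst p))) \<partial>(lborel \<Otimes>\<^sub>M lborel))"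
    by (subst lborel.nn_integral_fst[symmetric]) simp_all
  also have "\<dots> = (\<integral>\<^sup>+y. indicator A y \<partial>distr (density (lborel \<Otimes>\<^sub>M lborel) polar_weight) borel (\<lambda>(z, s). s *\<^sub>R (z /\<^sub>R norm z)))"
    by (simp add: nn_integral_distr nn_integral_density split_beta' del: nn_integral_indicator)
  finally show "emeasure lborel A = emeasure (distr (density (lborel \<Otimes>\<^sub>M lborel) polar_weight) borel (\<lambda>(z, s). s *\<^sub>R (z /\<^sub>R norm z))) A"
    by simp
qed

text \<open>Fubini also gives integrability along almost every ray, which the fundamental theorem of
  calculus on a half line will require.\<close>

lemma
  fixes f :: "'a::euclidean_space \<Rightarrow> real"
  assumes f: "integrable lborel f"
  shows AE_integrable_polar: "AE z in lborel. integrable lborel (\<lambda>s. polar_weight (z, s) * f (s *\<^sub>R (z /\<^sub>R norm z)))"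
    and integral_lborel_polar:
      "(\<integral>y. f y \<partial>lborel) = (\<integral>z. \<integral>s. polar_weight (z, s) * f (s *\<^sub>R (z /\<^sub>R norm z)) \<partial>lborel \<partial>lborel)"
proof -
  have [measurable]: "f \<in> borel_measurable borel" using f by auto
  have "integrable (distr (density (lborel \<Otimes>\<^sub>M lborel) polar_weight) borel (\<lambda>(z, s). s *\<^sub>R (z /\<^sub>R norm z))) f"
    using f by (subst lborel_eq_distr_polar[symmetric])
  then have i: "integrable (lborel \<Otimes>\<^sub>M lborel) (\<lambda>(z, s). polar_weight (z, s) * f (s *\<^sub>R (z /\<^sub>R norm z)))"
    by (simp add: integrable_distr_eq integrable_density split_beta' polar_weight_nonneg)
  show "AE z in lborel. integrable lborel (\<lambda>s. polar_weight (z, s) * f (s *\<^sub>R (z /\<^sub>R norm z)))"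
    using lborel_pair.AE_integrable_fst'[OF i] by simp
  have "(\<integral>y. f y \<partial>lborel) = (\<integral>y. f y \<partial>distr (density (lborel \<Otimes>\<^sub>M lborel) polar_weight) borel (\<lambda>(z, s). s *\<^sub>R (z /\<^sub>R norm z)))"
    by (subst lborel_eq_distr_polar[symmetric]) (rule refl)
  also have "\<dots> = (\<integral>p. (\<lambda>(z, s). polar_weight (z, s) * f (s *\<^sub>R (z /\<^sub>R norm z))) p \<partial>(lborel \<Otimes>\<^sub>M lborel))"
    by (simp add: integral_distr integral_density split_beta' polar_weight_nonneg)
  also have "\<dots> = (\<integral>z. \<integral>s. polar_weight (z, s) * f (s *\<^sub>R (z /\<^sub>R norm z)) \<partial>lborel \<partial>lborel)"
    using lborel_pair.integral_fst'[OF i] by simp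
  finally show "(\<integral>y. f y \<partial>lborel) = (\<integral>z. \<integral>s. polar_weight (z, s) * f (s *\<^sub>R (z /\<^sub>R norm z)) \<partial>lborel \<partial>lborel)" .
qed

section \<open>Total mass of the Poisson kernel\<close>

lemma nn_integral_Gamma_scaled:
  assumes a: "a > 0" and q: "q > (0::real)"
  shows "(\<integral>\<^sup>+t. ennreal (indicator {0..} t * t powr (a - 1) * exp (- (t * q))) \<partial>lborel) = ennreal (Gamma a * q powr (- a))"
proof -
  have "ennreal (Gamma a) = (\<integral>\<^sup>+t. ennreal (indicator {0..} t * t powr (a - 1) / exp t) \<partial>lborel)"
    by (rule Gamma_conv_nn_integral_real[OF a])
  also have "\<dots> = ennreal q * (\<integral>\<^sup>+t. ennreal (indicator {0..} (q * t) * (q * t) powr (a - 1) / exp (q * t)) \<partial>lborel)"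
    by (subst nn_integral_real_affine[where c = q and t = 0]) (use q in simp_all)
  also have "\<dots> = (\<integral>\<^sup>+t. ennreal (q powr a) * ennreal (indicator {0..} t * t powr (a - 1) * exp (- (t * q))) \<partial>lborel)"
  proof (subst nn_integral_cmult[symmetric], simp, rule nn_integral_cong)
    fix t :: real
    have "q * (indicator {0..} (q * t) * (q * t) powr (a - 1) / exp (q * t)) =
        q powr a * (indicator {0..} t * t powr (a - 1) * exp (- (t * q)))"
    proof (cases "t \<ge> 0")
      case True
      have "q powr a = q * q powr (a - 1)" using q by (simp add: powr_mult_base)
      then show ?thesis using True q by (simp add: powr_mult exp_minus field_simps)
    next
      case False
      then show ?thesis using q by (simp add: indicator_def zero_le_mult_iff)
    qed
    then show "ennreal q * ennreal (indicator {0..} (q * t) * (q * t) powr (a - 1) / exp (q * t)) =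
      ennreal (q powr a) * ennreal (indicator {0..} t * t powr (a - 1) * exp (- (t * q)))"
      using q by (subst (1 2) ennreal_mult[symmetric]) (auto simp: indicator_def)
  qed
  also have "\<dots> = ennreal (q powr a) * (\<integral>\<^sup>+t. ennreal (indicator {0..} t * t powr (a - 1) * exp (- (t * q))) \<partial>lborel)"
    by (subst nn_integral_cmult) simp_all
  finally have "ennreal (q powr (- a)) * ennreal (Gamma a) =
     ennreal (q powr (- a)) * ennreal (q powr a) * (\<integral>\<^sup>+t. ennreal (indicator {0..} t * t powr (a - 1) * exp (- (t * q))) \<partial>lborel)"
    by (simp add: mult.assoc)
  also have "ennreal (q powr (- a)) * ennreal (q powr a) = 1"
    using q by (simp add: ennreal_mult''[symmetric] powr_add[symmetric])
  finally show ?thesis using a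
    by (simp add: ennreal_mult''[symmetric] mult.commute Gamma_real_pos less_imp_le)
qed

lemma nn_integral_gaussian_real:
  assumes t: "t > (0::real)"
  shows "(\<integral>\<^sup>+x. ennreal (exp (- (t * x\<^sup>2))) \<partial>lborel) = ennreal (sqrt (pi / t))"
proof -
  define \<sigma> where "\<sigma> = sqrt (1 / (2 * t))"
  have \<sigma>: "\<sigma> > 0" "\<sigma>\<^sup>2 = 1 / (2 * t)" using t by (simp_all add: \<sigma>_def)
  interpret prob_space "density lborel (normal_density 0 \<sigma>)" by (rule prob_space_normal_density[OF \<sigma>(1)])
  have "1 = (\<integral>\<^sup>+x. ennreal (normal_density 0 \<sigma> x) \<partial>lborel)"
    using emeasure_space_1 by (simp add: emeasure_density)
  also have "\<dots> = (\<integral>\<^sup>+x. ennreal (1 / sqrt (pi / t)) * ennreal (exp (- (t * x\<^sup>2))) \<partial>lborel)"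
    unfolding normal_density_def \<sigma> using t
    by (intro nn_integral_cong) (simp add: ennreal_mult[symmetric] field_simps)
  also have "\<dots> = ennreal (1 / sqrt (pi / t)) * (\<integral>\<^sup>+x. ennreal (exp (- (t * x\<^sup>2))) \<partial>lborel)"
    by (subst nn_integral_cmult) simp_all
  finally have "ennreal (sqrt (pi / t)) * 1 =
     ennreal (sqrt (pi / t)) * ennreal (1 / sqrt (pi / t)) * (\<integral>\<^sup>+x. ennreal (exp (- (t * x\<^sup>2))) \<partial>lborel)"
    by (simp add: mult.assoc)
  also have "ennreal (sqrt (pi / t)) * ennreal (1 / sqrt (pi / t)) = 1"
    using t by (subst ennreal_mult[symmetric]) simp_all
  finally show ?thesis by simp
qed

lemma nn_integral_gaussian:
  assumes t: "t > (0::real)"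
  shows "(\<integral>\<^sup>+(z::'a::euclidean_space). ennreal (exp (- (t * (norm z)\<^sup>2))) \<partial>lborel) = ennreal ((pi / t) powr (real DIM('a) / 2))"
proof -
  have "(\<integral>\<^sup>+(z::'a). ennreal (exp (- (t * (norm z)\<^sup>2))) \<partial>lborel) =
      (\<integral>\<^sup>+(z::'a). (\<Prod>b\<in>Basis. ennreal (exp (- (t * (z \<bullet> b)\<^sup>2)))) \<partial>lborel)"
  proof (rule nn_integral_cong)
    fix z :: 'a
    have "(norm z)\<^sup>2 = (\<Sum>b\<in>Basis. (z \<bullet> b)\<^sup>2)"
      unfolding power2_norm_eq_inner by (subst euclidean_inner) (simp add: power2_eq_square)
    then show "ennreal (exp (- (t * (norm z)\<^sup>2))) = (\<Prod>b\<in>Basis. ennreal (exp (- (t * (z \<bullet> b)\<^sup>2))))"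
      by (simp add: prod_ennreal exp_sum sum_distrib_left sum_negf[symmetric])
  qed
  also have "\<dots> = (\<Prod>b\<in>(Basis::'a set). ennreal (sqrt (pi / t)))"
    by (subst nn_integral_lborel_prod) (simp_all add: nn_integral_gaussian_real[OF t])
  also have "\<dots> = ennreal (sqrt (pi / t) ^ DIM('a))"
    by (simp add: ennreal_power t less_imp_le)
  also have "sqrt (pi / t) ^ DIM('a) = (pi / t) powr (real DIM('a) / 2)"
  proof -
    have "sqrt (pi / t) ^ DIM('a) = sqrt (pi / t) powr real DIM('a)"
      using t by (simp add: powr_realpow)
    also have "\<dots> = ((pi / t) powr (1 / 2)) powr real DIM('a)" using t by (simp add: powr_half_sqrt)
    finally show ?thesis by (simp add: powr_powr)
  qed
  finally show ?thesis .
qed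

text \<open>Subordination: the Gamma integral writes the power of 1 + |z|^2 as a mixture of
  Gaussians with weight \<open>w\<close>, so Tonelli and the Gaussian integral apply. Since
  \<open>a = (d + 1) / 2\<close>, the power of \<open>t\<close> that remains is -1/2 in every
  dimension; hence the factor \<open>Gamma (1 / 2)\<close>, the square root of pi.\<close>

lemma nn_integral_poisson:
  "(\<integral>\<^sup>+(z::'a::euclidean_space). ennreal ((1 + (norm z)\<^sup>2) powr (- ((real DIM('a) + 1) / 2))) \<partial>lborel) =
     ennreal (pi powr ((real DIM('a) + 1) / 2) / Gamma ((real DIM('a) + 1) / 2))"
proof -
  define a where "a = (real DIM('a) + 1) / 2"
  have a: "a > 0" by (simp add: a_def)
  have Ga: "Gamma a > 0" using a by (rule Gamma_real_pos)
  define w where "w = (\<lambda>t::real. indicator {0..} t * t powr (a - 1) * exp (- t))"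
  have w0: "w t \<ge> 0" for t by (simp add: w_def)
  have [measurable]: "w \<in> borel_measurable borel" unfolding w_def by simp
  have "ennreal (Gamma a) * (\<integral>\<^sup>+(z::'a). ennreal ((1 + (norm z)\<^sup>2) powr (- a)) \<partial>lborel) =
      (\<integral>\<^sup>+(z::'a). ennreal (Gamma a * (1 + (norm z)\<^sup>2) powr (- a)) \<partial>lborel)"
    using Ga by (subst nn_integral_cmult[symmetric]) (auto simp: ennreal_mult)
  also have "\<dots> = (\<integral>\<^sup>+(z::'a). \<integral>\<^sup>+t. ennreal (w t * exp (- (t * (norm z)\<^sup>2))) \<partial>lborel \<partial>lborel)"
  proof (rule nn_integral_cong)
    fix z :: 'a
    have "1 + (norm z)\<^sup>2 > 0" by (simp add: add_pos_nonneg)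
    from nn_integral_Gamma_scaled[OF a this]
    show "ennreal (Gamma a * (1 + (norm z)\<^sup>2) powr (- a)) = (\<integral>\<^sup>+t. ennreal (w t * exp (- (t * (norm z)\<^sup>2))) \<partial>lborel)"
      by (simp add: w_def ring_distribs exp_add exp_diff exp_minus field_simps)
  qed
  also have "\<dots> = (\<integral>\<^sup>+t. \<integral>\<^sup>+(z::'a). ennreal (w t * exp (- (t * (norm z)\<^sup>2))) \<partial>lborel \<partial>lborel)"
    by (rule lborel_pair.Fubini') simp
  also have "\<dots> = (\<integral>\<^sup>+t. ennreal (pi powr (real DIM('a) / 2)) * ennreal (indicator {0..} t * t powr (1 / 2 - 1) / exp t) \<partial>lborel)"
  proof (rule nn_integral_cong_AE)
    show "AE t in lborel. (\<integral>\<^sup>+(z::'a). ennreal (w t * exp (- (t * (norm z)\<^sup>2))) \<partial>lborel) =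
       ennreal (pi powr (real DIM('a) / 2)) * ennreal (indicator {0..} t * t powr (1 / 2 - 1) / exp t)"
      using AE_lborel_singleton[of "0::real"]
    proof eventually_elim
      case (elim t)
      show ?case
      proof (cases "t > 0")
        case False
        then have "t < 0" using elim by simp
        then show ?thesis by (simp add: w_def)
      next
        case True
        have "(\<integral>\<^sup>+(z::'a). ennreal (w t * exp (- (t * (norm z)\<^sup>2))) \<partial>lborel) =
            ennreal (w t) * ennreal ((pi / t) powr (real DIM('a) / 2))"
          by (simp add: ennreal_mult w0 nn_integral_cmult nn_integral_gaussian[OF True])
        also have "\<dots> = ennreal (w t * (pi / t) powr (real DIM('a) / 2))"
          by (simp add: ennreal_mult w0)
        also have "w t * (pi / t) powr (real DIM('a) / 2) =
            pi powr (real DIM('a) / 2) * (indicator {0..} t * t powr (1 / 2 - 1) / exp t)"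
        proof -
          have "t powr (a - 1) = t powr (1 / 2 - 1) * t powr (real DIM('a) / 2)"
            by (simp add: powr_add[symmetric] a_def field_simps)
          then show ?thesis using True
            by (simp add: w_def powr_divide exp_minus field_simps)
        qed
        also have "ennreal (pi powr (real DIM('a) / 2) * (indicator {0..} t * t powr (1 / 2 - 1) / exp t)) =
            ennreal (pi powr (real DIM('a) / 2)) * ennreal (indicator {0..} t * t powr (1 / 2 - 1) / exp t)"
          by (rule ennreal_mult) auto
        finally show ?thesis .
      qed
    qed
  qed
  also have "\<dots> = ennreal (pi powr (real DIM('a) / 2)) * ennreal (Gamma (1 / 2))"
    by (subst nn_integral_cmult) (simp_all add: Gamma_conv_nn_integral_real)
  also have "\<dots> = ennreal (pi powr a)"
    by (simp add: Gamma_one_half_real ennreal_mult[symmetric] powr_half_sqrt[symmetric] powr_add[symmetric] a_def add_divide_distrib)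
  finally have eq: "ennreal (Gamma a) * (\<integral>\<^sup>+(z::'a). ennreal ((1 + (norm z)\<^sup>2) powr (- a)) \<partial>lborel) = ennreal (pi powr a)" .
  have "(\<integral>\<^sup>+(z::'a). ennreal ((1 + (norm z)\<^sup>2) powr (- a)) \<partial>lborel) =
     ennreal (1 / Gamma a) * ennreal (Gamma a) * (\<integral>\<^sup>+(z::'a). ennreal ((1 + (norm z)\<^sup>2) powr (- a)) \<partial>lborel)"
    using Ga by (subst ennreal_mult[symmetric]) simp_all
  also have "\<dots> = ennreal (1 / Gamma a) * ennreal (pi powr a)"
    by (simp add: mult.assoc eq)
  also have "\<dots> = ennreal (pi powr a / Gamma a)"
    using Ga by (subst ennreal_mult[symmetric]) simp_all
  finally show ?thesis by (simp add: a_def)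
qed

section \<open>The Poisson kernel\<close>

lemma has_real_derivative_integral:
  fixes f f' :: "real \<Rightarrow> 'a \<Rightarrow> real"
  assumes e: "e > 0"
    and int: "\<And>t. \<bar>t\<bar> < e \<Longrightarrow> integrable M (f t)"
    and der: "\<And>t y. \<bar>t\<bar> < e \<Longrightarrow> ((\<lambda>t. f t y) has_real_derivative f' t y) (at t)"
    and bound: "\<And>t y. \<bar>t\<bar> < e \<Longrightarrow> \<bar>f' t y\<bar> \<le> w y"
    and w: "integrable M w"
    and meas: "f' 0 \<in> borel_measurable M"
  shows "((\<lambda>t. \<integral>y. f t y \<partial>M) has_real_derivative (\<integral>y. f' 0 y \<partial>M)) (at 0)"
proof -
  have "((\<lambda>h. ((\<integral>y. f (0 + h) y \<partial>M) - (\<integral>y. f 0 y \<partial>M)) / h) \<longlongrightarrow> (\<integral>y. f' 0 y \<partial>M)) (at 0)"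
    unfolding tendsto_at_iff_sequentially comp_def
  proof (intro allI impI)
    fix X :: "nat \<Rightarrow> real"
    assume X: "\<forall>i. X i \<in> UNIV - {0}" "X \<longlonglongrightarrow> 0"
    \<comment> \<open>Dominated convergence wants measurability and the bound for every index. Where
      \<open>X i\<close> still lies outside the range of the hypotheses, the difference quotient is
      replaced by its limit; this happens only finitely often.\<close>
    define s where "s = (\<lambda>i y. if \<bar>X i\<bar> < e then (f (X i) y - f 0 y) / X i else f' 0 y)"
    have m: "f t \<in> borel_measurable M" if "\<bar>t\<bar> < e" for t
      using int[OF that] by simp
    have ev: "\<forall>\<^sub>F i in sequentially. \<bar>X i\<bar> < e"
      using tendstoD[OF X(2) e] by (simp add: dist_real_def)
    have "(\<lambda>i. \<integral>y. s i y \<partial>M) \<longlonglongrightarrow> (\<integral>y. f' 0 y \<partial>M)"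
    proof (rule integral_dominated_convergence)
      show "f' 0 \<in> borel_measurable M" by (rule meas)
      show "s i \<in> borel_measurable M" for i
      proof (cases "\<bar>X i\<bar> < e")
        case True
        then have "s i = (\<lambda>y. (f (X i) y - f 0 y) / X i)" by (simp add: s_def)
        then show ?thesis using m[OF True] m[of 0] e by simp
      next
        case False
        then have "s i = f' 0" by (simp add: s_def)
        then show ?thesis using meas by simp
      qed
      show "integrable M w" by (rule w)
      show "AE y in M. (\<lambda>i. s i y) \<longlonglongrightarrow> f' 0 y"
      proof (rule AE_I2)
        fix y
        have "((\<lambda>h. (f (0 + h) y - f 0 y) / h) \<longlongrightarrow> f' 0 y) (at 0)"
          using der[of 0 y] e by (simp add: DERIV_def)
        then have "(\<lambda>i. (f (X i) y - f 0 y) / X i) \<longlonglongrightarrow> f' 0 y"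
          using X unfolding tendsto_at_iff_sequentially comp_def by simp
        then show "(\<lambda>i. s i y) \<longlonglongrightarrow> f' 0 y"
          by (rule Lim_transform_eventually) (use ev in \<open>auto elim!: eventually_mono simp: s_def\<close>)
      qed
      show "AE y in M. norm (s i y) \<le> w y" for i
      proof (rule AE_I2)
        fix y
        show "norm (s i y) \<le> w y"
        proof (cases "\<bar>X i\<bar> < e")
          case True
          \<comment> \<open>The mean value inequality passes the bound on the derivative on to the
            difference quotients.\<close>
          have "norm (f (X i) y - f 0 y) \<le> w y * norm (X i - 0)"
          proof (rule field_differentiable_bound[where S = "{-e<..<e}" and f' = "\<lambda>t. f' t y"])
            show "((\<lambda>t. f t y) has_field_derivative f' t y) (at t within {-e<..<e})" if "t \<in> {-e<..<e}" for t
              by (rule has_field_derivative_at_within[OF der]) (use that in auto)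
            show "norm (f' t y) \<le> w y" if "t \<in> {-e<..<e}" for t
              using that bound[of t y] by auto
          qed (use True e in auto)
          then show ?thesis using True X(1) by (simp add: s_def field_simps)
        next
          case False
          then show ?thesis using bound[of 0 y] e by (simp add: s_def)
        qed
      qed
    qed
    then show "(\<lambda>i. ((\<integral>y. f (0 + X i) y \<partial>M) - (\<integral>y. f 0 y \<partial>M)) / X i) \<longlonglongrightarrow> (\<integral>y. f' 0 y \<partial>M)"
    proof (rule Lim_transform_eventually)
      show "\<forall>\<^sub>F i in sequentially. (\<integral>y. s i y \<partial>M) = ((\<integral>y. f (0 + X i) y \<partial>M) - (\<integral>y. f 0 y \<partial>M)) / X i"
        using ev
      proof eventually_elim
        case (elim i)
        then have "(\<integral>y. s i y \<partial>M) = (\<integral>y. (f (X i) y - f 0 y) / X i \<partial>M)" by (simp add: s_def)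
        also have "\<dots> = (\<integral>y. f (X i) y - f 0 y \<partial>M) / X i" by simp
        also have "(\<integral>y. f (X i) y - f 0 y \<partial>M) = (\<integral>y. f (X i) y \<partial>M) - (\<integral>y. f 0 y \<partial>M)"
          by (rule Bochner_Integration.integral_diff) (use int[OF elim] int[of 0] e in auto)
        finally show ?case by simp
      qed
    qed
  qed
  then show ?thesis by (simp add: DERIV_def)
qed

text \<open>A majorant that is uniform only on balls suffices, because a convergent sequence stays
  in some ball.\<close>

lemma continuous_on_integral_dominated:
  fixes k :: "'b::real_normed_vector \<Rightarrow> 'a \<Rightarrow> real"
  assumes cont: "\<And>y. continuous_on UNIV (\<lambda>x. k x y)"
    and meas: "\<And>x. k x \<in> borel_measurable M"
    and bound: "\<And>R x y. norm x \<le> R \<Longrightarrow> \<bar>k x y\<bar> \<le> w R y"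
    and w: "\<And>R. integrable M (w R)"
  shows "continuous_on UNIV (\<lambda>x. \<integral>y. k x y \<partial>M)"
  unfolding continuous_on_sequentially comp_def
proof (intro allI impI ballI, elim conjE)
  fix X :: "nat \<Rightarrow> 'b" and a
  assume X: "X \<longlonglongrightarrow> a"
  then have "Bseq X" by (intro convergent_imp_Bseq convergentI)
  then obtain R where R: "\<And>n. norm (X n) \<le> R" unfolding Bseq_def by blast
  show "(\<lambda>n. \<integral>y. k (X n) y \<partial>M) \<longlonglongrightarrow> (\<integral>y. k a y \<partial>M)"
  proof (rule integral_dominated_convergence[where w = "w R"])
    show "AE y in M. (\<lambda>i. k (X i) y) \<longlonglongrightarrow> k a y"
      using continuous_on_tendsto_compose[OF cont X] by simp
    show "AE y in M. norm (k (X i) y) \<le> w R y" for i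
      using bound[OF R] by simp
  qed (use meas w in auto)
qed

section \<open>Decay measured in powers of 1 + |z|^2\<close>

definition bracket :: "'a::real_normed_vector \<Rightarrow> real" where
  "bracket z = 1 + (norm z)\<^sup>2"

lemma bracket_ge_1: "bracket z \<ge> 1" and bracket_pos: "bracket z > 0" and bracket_nonzero: "bracket z \<noteq> 0"
proof -
  have "(norm z)\<^sup>2 \<ge> 0" by simp
  then show "bracket z \<ge> 1" "bracket z > 0" "bracket z \<noteq> 0" unfolding bracket_def by linarith+
qed

lemma bracket_minus [simp]: "bracket (- z) = bracket z"
  by (simp add: bracket_def)

lemma continuous_on_bracket [continuous_intros]:
  "continuous_on S f \<Longrightarrow> continuous_on S (\<lambda>x. bracket (f x))"
  unfolding bracket_def by (intro continuous_intros)

lemma continuous_on_bracket_powr: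
  "continuous_on S f \<Longrightarrow> continuous_on S (\<lambda>x. bracket (f x) powr b)"
  by (intro continuous_on_powr continuous_intros) (auto simp: bracket_nonzero)

text \<open>A form of Peetre's inequality. It converts decay in \<open>x - y\<close> into decay in
  \<open>y\<close>, uniformly for \<open>x\<close> in a ball, and so produces majorants that are
  independent of \<open>x\<close>.\<close>

lemma bracket_translate_le: 
  assumes "norm x \<le> R"
  shows "bracket y \<le> 2 * (1 + R\<^sup>2) * bracket (x - y)"
proof -
  have "norm y \<le> norm x + norm (x - y)"
    using norm_triangle_ineq4[of x "x - y"] by simp
  also have "\<dots> \<le> R + norm (x - y)" using assms by simp
  finally have "(norm y)\<^sup>2 \<le> (R + norm (x - y))\<^sup>2" by (intro power_mono) auto
  also have "\<dots> \<le> 2 * R\<^sup>2 + 2 * (norm (x - y))\<^sup>2"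
    using sum_squares_bound[of R "norm (x - y)"] by (simp add: power2_sum)
  finally have "bracket y \<le> 1 + 2 * R\<^sup>2 + 2 * (norm (x - y))\<^sup>2" by (simp add: bracket_def)
  also have "\<dots> \<le> 2 * (1 + R\<^sup>2) * bracket (x - y)"
    by (simp add: bracket_def algebra_simps)
  finally show ?thesis .
qed

lemma norm_le_bracket_powr: "norm z \<le> bracket z powr (1 / 2)"
proof -
  have "norm z = sqrt ((norm z)\<^sup>2)" by simp
  also have "\<dots> \<le> sqrt (bracket z)" unfolding bracket_def by (intro real_sqrt_le_mono) simp
  also have "\<dots> = bracket z powr (1 / 2)" using bracket_pos[of z] by (simp add: powr_half_sqrt)
  finally show ?thesis .
qed

text \<open>A factor \<open>norm z\<close> costs half a power of \<open>bracket z\<close>. All decay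
  estimates below are instances of this exchange.\<close>

lemma norm_mult_bracket_powr_le: "norm z * bracket z powr (- (b + 1 / 2)) \<le> bracket z powr (- b)"
proof -
  have "norm z * bracket z powr (- (b + 1 / 2)) \<le> bracket z powr (1 / 2) * bracket z powr (- (b + 1 / 2))"
    by (intro mult_right_mono norm_le_bracket_powr) simp
  then show ?thesis by (simp add: powr_add[symmetric])
qed

lemma bracket_powr_le:
  assumes "bracket y \<le> c * bracket z" "b \<ge> 0" "c > 0"
  shows "bracket z powr (- b) \<le> c powr b * bracket y powr (- b)"
proof -
  have "bracket y powr b \<le> (c * bracket z) powr b"
    using assms bracket_pos[of y] by (intro powr_mono2) auto
  also have "\<dots> = c powr b * bracket z powr b"
    using assms bracket_pos[of z] by (simp add: powr_mult)
  finally show ?thesis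
    using bracket_pos[of y] bracket_pos[of z] by (simp add: powr_minus field_simps)
qed

lemma DERIV_bracket_line:
  fixes z v :: "'a::real_inner"
  shows "((\<lambda>t. bracket (z + t *\<^sub>R v)) has_real_derivative 2 * ((z + t *\<^sub>R v) \<bullet> v)) (at t)"
proof -
  have "bracket (z + t *\<^sub>R v) = 1 + (norm z)\<^sup>2 + 2 * t * (z \<bullet> v) + t\<^sup>2 * (norm v)\<^sup>2" for t
    unfolding bracket_def power2_norm_eq_inner
    by (simp add: inner_simps power2_eq_square inner_commute algebra_simps)
  then show ?thesis
    by (auto intro!: derivative_eq_intros simp: inner_simps power2_norm_eq_inner)
qed

lemma DERIV_bracket_powr_line:
  fixes z v :: "'a::real_inner"
  shows "((\<lambda>t. bracket (z + t *\<^sub>R v) powr (- b)) has_real_derivative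
    - 2 * b * ((z + t *\<^sub>R v) \<bullet> v) * bracket (z + t *\<^sub>R v) powr (- (b + 1))) (at t)"
  by (rule DERIV_powr[THEN DERIV_cong, OF DERIV_bracket_line bracket_pos DERIV_const])
    (simp add: powr_diff powr_minus bracket_pos bracket_nonzero field_simps powr_add abs_of_pos[OF bracket_pos])

text \<open>The Poisson kernel of the half space at height 1, up to normalisation.\<close>

definition poisson :: "'a::euclidean_space \<Rightarrow> real" where
  "poisson z = bracket z powr (- ((real DIM('a) + 1) / 2))"

lemma poisson_pos: "poisson z > 0"
  unfolding poisson_def using bracket_pos[of z] by simp

lemma continuous_on_poisson: "continuous_on S f \<Longrightarrow> continuous_on S (\<lambda>x. poisson (f x))"
  unfolding poisson_def by (intro continuous_on_bracket_powr)

lemma borel_measurable_poisson [measurable]: "poisson \<in> borel_measurable borel"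
  by (intro borel_measurable_continuous_onI continuous_on_poisson continuous_intros)

lemma has_bochner_integral_poisson:
  "has_bochner_integral lborel (poisson :: 'a::euclidean_space \<Rightarrow> real)
     (pi powr ((real DIM('a) + 1) / 2) / Gamma ((real DIM('a) + 1) / 2))"
proof (rule has_bochner_integral_nn_integral)
  show "(\<integral>\<^sup>+x. ennreal (poisson (x::'a)) \<partial>lborel) =
      ennreal (pi powr ((real DIM('a) + 1) / 2) / Gamma ((real DIM('a) + 1) / 2))"
    using nn_integral_poisson[where 'a='a] by (simp add: poisson_def bracket_def)
qed (auto simp: less_imp_le poisson_pos Gamma_real_pos)

lemma integrable_poisson: "integrable lborel (poisson :: 'a::euclidean_space \<Rightarrow> real)"
  using has_bochner_integral_poisson by (rule integrable.intros)

lemma DERIV_poisson_line: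
  fixes z v :: "'a::euclidean_space"
  shows "((\<lambda>t. poisson (z + t *\<^sub>R v)) has_real_derivative
    - (real DIM('a) + 1) * ((z + t *\<^sub>R v) \<bullet> v) * bracket (z + t *\<^sub>R v) powr (- ((real DIM('a) + 3) / 2))) (at t)"
proof -
  have e: "(real DIM('a) + 1) / 2 + 1 = (real DIM('a) + 3) / 2" by (simp add: field_simps)
  have e2: "- 2 * ((real DIM('a) + 1) / 2) = - (real DIM('a) + 1)" by simp
  show ?thesis
    unfolding poisson_def
    using DERIV_bracket_powr_line[of z v "(real DIM('a) + 1) / 2" t] unfolding e e2 .
qed

text \<open>Mean value inequality along the segment from \<open>- y\<close> to \<open>x - y\<close>:
  the gradient of the kernel decays by half a power of \<open>bracket\<close> better than the
  kernel, just enough to absorb the linear growth of the datum. The comparison constant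
  \<open>c\<close> stays free because it is used in two ways: depending on a radius for local
  bounds, and equal to 4 in the far field, where the estimate must not depend on the scale.\<close>

lemma abs_poisson_diff_le:
  fixes x y :: "'a::euclidean_space"
  assumes c: "c > 0" and le: "\<And>t. 0 \<le> t \<Longrightarrow> t \<le> 1 \<Longrightarrow> bracket y \<le> c * bracket (t *\<^sub>R x - y)"
  shows "\<bar>poisson (x - y) - poisson y\<bar> \<le>
    (real DIM('a) + 1) * norm x * c powr ((real DIM('a) + 2) / 2) * bracket y powr (- ((real DIM('a) + 2) / 2))"
proof -
  let ?d = "\<lambda>t. - (real DIM('a) + 1) * ((- y + t *\<^sub>R x) \<bullet> x) * bracket (- y + t *\<^sub>R x) powr (- ((real DIM('a) + 3) / 2))"
  let ?B = "(real DIM('a) + 1) * norm x * c powr ((real DIM('a) + 2) / 2) * bracket y powr (- ((real DIM('a) + 2) / 2))"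
  have "norm (poisson (- y + 1 *\<^sub>R x) - poisson (- y + 0 *\<^sub>R x)) \<le> ?B * norm (1 - 0 :: real)"
  proof (rule field_differentiable_bound[where S = "{0..1}" and f = "\<lambda>t. poisson (- y + t *\<^sub>R x)" and f' = ?d])
    show "((\<lambda>t. poisson (- y + t *\<^sub>R x)) has_field_derivative ?d t) (at t within {0..1})" for t
      by (rule has_field_derivative_at_within[OF DERIV_poisson_line])
    fix t :: real assume t: "t \<in> {0..1}"
    define z where "z = - y + t *\<^sub>R x"
    have le': "bracket y \<le> c * bracket z"
      using le[of t] t by (simp add: z_def add.commute)
    have e: "(real DIM('a) + 2) / 2 + 1 / 2 = (real DIM('a) + 3) / 2" by (simp add: field_simps)
    have "norm (?d t) = (real DIM('a) + 1) * \<bar>z \<bullet> x\<bar> * bracket z powr (- ((real DIM('a) + 3) / 2))"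
      by (simp add: z_def abs_mult)
    also have "\<dots> \<le> (real DIM('a) + 1) * (norm z * norm x) * bracket z powr (- ((real DIM('a) + 3) / 2))"
      by (intro mult_right_mono mult_left_mono Cauchy_Schwarz_ineq2) auto
    also have "\<dots> = (real DIM('a) + 1) * norm x * (norm z * bracket z powr (- ((real DIM('a) + 3) / 2)))"
      by simp
    also have "\<dots> \<le> (real DIM('a) + 1) * norm x * bracket z powr (- ((real DIM('a) + 2) / 2))"
      using norm_mult_bracket_powr_le[of z "(real DIM('a) + 2) / 2"] unfolding e by (intro mult_left_mono) auto
    also have "\<dots> \<le> (real DIM('a) + 1) * norm x * (c powr ((real DIM('a) + 2) / 2) * bracket y powr (- ((real DIM('a) + 2) / 2)))"
      by (intro mult_left_mono bracket_powr_le[OF le' _ c]) auto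
    finally show "norm (?d t) \<le> ?B" by (simp add: mult.assoc)
  qed auto
  then show ?thesis by (simp add: poisson_def)
qed

text \<open>The required decay is |z|^-(d+2), one power more than \<open>poisson\<close> has; it
  makes the product with a function of linear growth integrable.\<close>

definition rapid_kernel :: "(real^'n \<Rightarrow> real) \<Rightarrow> bool" where
  "rapid_kernel Q \<longleftrightarrow> continuous_on UNIV Q \<and>
     (\<exists>K. \<forall>z. \<bar>Q z\<bar> \<le> K * bracket z powr (- ((real CARD('n) + 2) / 2)))"

lemma rapid_kernelD: "rapid_kernel Q \<Longrightarrow> continuous_on UNIV Q"
  by (simp add: rapid_kernel_def)

section \<open>Gradient and Hessian of the kernel\<close>

definition poisson_grad :: "'n::finite \<Rightarrow> real^'n \<Rightarrow> real" where
  "poisson_grad i z = - (real CARD('n) + 1) * z $ i * bracket z powr (- ((real CARD('n) + 3) / 2))"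

definition poisson_hess :: "'n::finite \<Rightarrow> 'n \<Rightarrow> real^'n \<Rightarrow> real" where
  "poisson_hess i j z =
     - (real CARD('n) + 1) * (if i = j then 1 else 0) * bracket z powr (- ((real CARD('n) + 3) / 2)) +
     (real CARD('n) + 1) * (real CARD('n) + 3) * (z $ i * z $ j) * bracket z powr (- ((real CARD('n) + 5) / 2))"

lemma DERIV_poisson_axis:
  fixes z :: "real^'n"
  shows "((\<lambda>t. poisson (z + t *\<^sub>R axis i 1)) has_real_derivative poisson_grad i (z + t *\<^sub>R axis i 1)) (at t)"
  using DERIV_poisson_line[of z "axis i 1" t] by (simp add: poisson_grad_def inner_axis)

lemma DERIV_poisson_grad_axis:
  fixes z :: "real^'n"
  shows "((\<lambda>t. poisson_grad j (z + t *\<^sub>R axis i 1)) has_real_derivative poisson_hess i j (z + t *\<^sub>R axis i 1)) (at t)"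
proof -
  have e: "(real CARD('n) + 3) / 2 + 1 = (real CARD('n) + 5) / 2" by (simp add: field_simps)
  have "((\<lambda>t. (z + t *\<^sub>R axis i 1) $ j) has_real_derivative (if i = j then 1 else 0)) (at t)"
    by (auto simp: axis_def intro!: derivative_eq_intros)
  from DERIV_mult[OF DERIV_cmult[OF this, of "- (real CARD('n) + 1)"] DERIV_bracket_powr_line[of z "axis i 1" "(real CARD('n) + 3) / 2" t], unfolded e]
  show ?thesis
    unfolding poisson_grad_def
    by (rule DERIV_cong) (simp add: poisson_hess_def inner_axis algebra_simps)
qed

lemma bracket_powr_antimono: "a \<le> b \<Longrightarrow> bracket z powr (- b) \<le> bracket z powr (- a)"
  using bracket_ge_1[of z] by (intro powr_mono) auto

lemma rapid_kernel_poisson_grad: "rapid_kernel (poisson_grad i :: real^'n \<Rightarrow> real)"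
  unfolding rapid_kernel_def
proof (intro conjI exI allI)
  show "continuous_on UNIV (poisson_grad i :: real^'n \<Rightarrow> real)"
    unfolding poisson_grad_def by (intro continuous_intros continuous_on_bracket_powr)
  fix z :: "real^'n"
  have e: "(real CARD('n) + 2) / 2 + 1 / 2 = (real CARD('n) + 3) / 2" by (simp add: field_simps)
  have "\<bar>poisson_grad i z\<bar> = (real CARD('n) + 1) * (\<bar>z $ i\<bar> * bracket z powr (- ((real CARD('n) + 3) / 2)))"
    by (simp add: poisson_grad_def abs_mult)
  also have "\<dots> \<le> (real CARD('n) + 1) * (norm z * bracket z powr (- ((real CARD('n) + 3) / 2)))"
    by (intro mult_left_mono mult_right_mono component_le_norm_cart) auto
  also have "\<dots> \<le> (real CARD('n) + 1) * bracket z powr (- ((real CARD('n) + 2) / 2))"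
    using norm_mult_bracket_powr_le[of z "(real CARD('n) + 2) / 2"] unfolding e by (intro mult_left_mono) auto
  finally show "\<bar>poisson_grad i z\<bar> \<le> (real CARD('n) + 1) * bracket z powr (- ((real CARD('n) + 2) / 2))" .
qed

lemma rapid_kernel_poisson_hess: "rapid_kernel (poisson_hess i j :: real^'n \<Rightarrow> real)"
  unfolding rapid_kernel_def
proof (intro conjI exI allI)
  let ?N = "real CARD('n)"
  show "continuous_on UNIV (poisson_hess i j :: real^'n \<Rightarrow> real)"
    unfolding poisson_hess_def by (intro continuous_intros continuous_on_bracket_powr)
  fix z :: "real^'n"
  have e1: "(?N + 4) / 2 + 1 / 2 = (?N + 5) / 2" and e2: "(?N + 3) / 2 + 1 / 2 = (?N + 4) / 2" by (simp_all add: field_simps)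
  let ?B = "bracket z powr (- ((?N + 3) / 2))"
  have "\<bar>z $ i * z $ j\<bar> * bracket z powr (- ((?N + 5) / 2)) \<le> norm z * norm z * bracket z powr (- ((?N + 5) / 2))"
    unfolding abs_mult by (intro mult_right_mono mult_mono component_le_norm_cart) auto
  also have "\<dots> = norm z * (norm z * bracket z powr (- ((?N + 5) / 2)))" by simp
  also have "\<dots> \<le> norm z * bracket z powr (- ((?N + 4) / 2))"
    using norm_mult_bracket_powr_le[of z "(?N + 4) / 2"] unfolding e1 by (intro mult_left_mono) auto
  also have "\<dots> \<le> ?B"
    using norm_mult_bracket_powr_le[of z "(?N + 3) / 2"] unfolding e2 .
  finally have 1: "\<bar>z $ i * z $ j\<bar> * bracket z powr (- ((?N + 5) / 2)) \<le> ?B" .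
  have "\<bar>poisson_hess i j z\<bar> \<le> (?N + 1) * ?B + (?N + 1) * (?N + 3) * (\<bar>z $ i * z $ j\<bar> * bracket z powr (- ((?N + 5) / 2)))"
    unfolding poisson_hess_def by (rule order_trans[OF abs_triangle_ineq]) (auto simp: abs_mult add.commute)
  also have "\<dots> \<le> (?N + 1) * ?B + (?N + 1) * (?N + 3) * ?B"
    by (intro add_left_mono mult_left_mono 1) auto
  also have "\<dots> = ((?N + 1) + (?N + 1) * (?N + 3)) * ?B" by (simp add: algebra_simps)
  also have "\<dots> \<le> ((?N + 1) + (?N + 1) * (?N + 3)) * bracket z powr (- ((?N + 2) / 2))"
    by (intro mult_left_mono bracket_powr_antimono) auto
  finally show "\<bar>poisson_hess i j z\<bar> \<le> ((?N + 1) + (?N + 1) * (?N + 3)) * bracket z powr (- ((?N + 2) / 2))" .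
qed

section \<open>The operator applied to the kernel, along rays\<close>

definition op_kernel :: "real^'n \<Rightarrow> real^'n \<Rightarrow> real" where
  "op_kernel x z = - (real CARD('n) + 1) *
     ((real CARD('n) + (norm x)\<^sup>2) * bracket z powr (- ((real CARD('n) + 3) / 2)) -
      (real CARD('n) + 3) * ((norm z)\<^sup>2 + (x \<bullet> z)\<^sup>2) * bracket z powr (- ((real CARD('n) + 5) / 2)))"

text \<open>\<open>op_kernel x z\<close> is the Hessian of the kernel at \<open>z\<close> contracted
  with the coefficients at \<open>x\<close>. It sees \<open>z\<close> only through
  \<open>norm z\<close> and \<open>x \<bullet> z\<close>; on a ray
  \<open>z = x - s *\<^sub>R \<theta>\<close> it therefore depends only on \<open>s\<close>,
  \<open>norm x\<close> and \<open>x \<bullet> \<theta>\<close>.\<close>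

lemma sum_poisson_hess:
  fixes x z :: "real^'n"
  shows "(\<Sum>i\<in>UNIV. \<Sum>j\<in>UNIV. ((if i = j then 1 else 0) + x $ i * x $ j) * poisson_hess i j z) = op_kernel x z"
proof -
  let ?N = "real CARD('n)"
  define A where "A = (?N + 1) * bracket z powr (- ((?N + 3) / 2))"
  define B where "B = (?N + 1) * (?N + 3) * bracket z powr (- ((?N + 5) / 2))"
  have sq: "(\<Sum>i\<in>UNIV. (y $ i)\<^sup>2) = (norm y)\<^sup>2" for y :: "real^'n"
    by (simp add: norm_vec_def L2_set_def sum_nonneg)
  have xz: "(\<Sum>i\<in>UNIV. \<Sum>j\<in>UNIV. (x $ i * z $ i) * (x $ j * z $ j)) = (x \<bullet> z)\<^sup>2"
    by (simp add: inner_vec_def power2_eq_square sum_product)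
  have "(\<Sum>i\<in>UNIV. \<Sum>j\<in>UNIV. ((if i = j then 1 else 0) + x $ i * x $ j) * poisson_hess i j z) =
     (\<Sum>i\<in>UNIV. \<Sum>j\<in>UNIV. (if i = j then - A + B * (z $ i)\<^sup>2 - A * (x $ i)\<^sup>2 else 0) +
       B * ((x $ i * z $ i) * (x $ j * z $ j)))"
    by (intro sum.cong refl)
      (auto simp: poisson_hess_def A_def B_def power2_eq_square algebra_simps)
  also have "\<dots> = (\<Sum>i\<in>UNIV. - A + B * (z $ i)\<^sup>2 - A * (x $ i)\<^sup>2) + B * (x \<bullet> z)\<^sup>2"
  proof -
    have "(\<Sum>i\<in>UNIV. \<Sum>j\<in>UNIV. B * ((x $ i * z $ i) * (x $ j * z $ j))) = B * (x \<bullet> z)\<^sup>2"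
      unfolding xz[symmetric] by (simp only: sum_distrib_left)
    then show ?thesis unfolding sum.distrib by simp
  qed
  also have "(\<Sum>i\<in>UNIV. - A + B * (z $ i)\<^sup>2 - A * (x $ i)\<^sup>2) = - A * ?N + B * (norm z)\<^sup>2 - A * (norm x)\<^sup>2"
    unfolding sum_subtractf sum.distrib sum_distrib_left[symmetric] sq by simp
  finally show ?thesis
    by (simp add: op_kernel_def A_def B_def algebra_simps)
qed

text \<open>Here \<open>\<rho> = |x|\<^sup>2\<close> and \<open>b = x \<bullet> \<theta>\<close>, so that \<open>1 + \<rho> - 2 s b + s\<^sup>2 = 1 + |x - s \<theta>|\<^sup>2\<close>. The polynomial factor
  arises by collecting \<open>-s\<^sup>d\<^sup>+\<^sup>1 (y \<bullet> \<nabla>P(z) + d P(z) + 2 z \<bullet> \<nabla>P(z))\<close> at \<open>y = s \<theta>\<close>, \<open>z = x - y\<close>.\<close>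

definition radial_primitive :: "nat \<Rightarrow> real \<Rightarrow> real \<Rightarrow> real \<Rightarrow> real" where
  "radial_primitive n \<rho> b s = s ^ (n + 1) * ((real n + 1) * (s * b - s\<^sup>2) + (real n + 2) * (1 + \<rho> - 2 * s * b + s\<^sup>2) - 2 * (real n + 1)) *
     (1 + \<rho> - 2 * s * b + s\<^sup>2) powr (- ((real n + 3) / 2))"

text \<open>Every term contains \<open>s ^ n\<close> and the power \<open>A\<close> of the quadratic
  \<open>q\<close> with the lowest exponent. Once these are taken out, a polynomial identity in
  \<open>s\<close>, \<open>b\<close>, \<open>\<rho>\<close> and \<open>n\<close> remains.\<close>

lemma DERIV_radial_primitive:
  assumes pos: "1 + \<rho> - 2 * s * b + s\<^sup>2 > 0"
  shows "(radial_primitive n \<rho> b has_real_derivative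
    s ^ n * (- (real n + 1) * ((real n + \<rho>) * (1 + \<rho> - 2 * s * b + s\<^sup>2) powr (- ((real n + 3) / 2)) -
      (real n + 3) * ((\<rho> - 2 * s * b + s\<^sup>2) + (\<rho> - s * b)\<^sup>2) * (1 + \<rho> - 2 * s * b + s\<^sup>2) powr (- ((real n + 5) / 2))))) (at s)"
proof -
  define q where "q = 1 + \<rho> - 2 * s * b + s\<^sup>2"
  define w where "w = (real n + 1) * (s * b - s\<^sup>2) + (real n + 2) * q - 2 * (real n + 1)"
  define A where "A = q powr (- ((real n + 5) / 2))"
  have q: "q > 0" using pos by (simp add: q_def)
  have qA: "q powr (- ((real n + 3) / 2)) = q * A"
  proof -
    have "- ((real n + 3) / 2) = 1 + - ((real n + 5) / 2)" by (simp add: field_simps)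
    then have "q powr (- ((real n + 3) / 2)) = q powr (1 + - ((real n + 5) / 2))" by (simp only:)
    also have "\<dots> = q powr 1 * A" unfolding A_def by (rule powr_add)
    finally show ?thesis using q by simp
  qed
  have dq: "((\<lambda>s. 1 + \<rho> - 2 * s * b + s\<^sup>2) has_real_derivative 2 * s - 2 * b) (at s)"
    by (auto intro!: derivative_eq_intros)
  have dw: "((\<lambda>s. (real n + 1) * (s * b - s\<^sup>2) + (real n + 2) * (1 + \<rho> - 2 * s * b + s\<^sup>2) - 2 * (real n + 1))
      has_real_derivative 2 * s - (real n + 3) * b) (at s)"
    by (auto intro!: derivative_eq_intros) (simp add: algebra_simps)
  have dp: "((\<lambda>s. (1 + \<rho> - 2 * s * b + s\<^sup>2) powr (- ((real n + 3) / 2))) has_real_derivative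
      - (real n + 3) * (s - b) * A) (at s)"
  proof -
    have e: "- ((real n + 3) / 2) - 1 = - ((real n + 5) / 2)" by (simp add: field_simps)
    show ?thesis
      unfolding A_def q_def e[symmetric]
    proof (rule DERIV_cong[OF DERIV_fun_powr[OF dq pos, of "- ((real n + 3) / 2)"]])
      have "- ((real n + 3) / 2) * B * (2 * s - 2 * b) = - (real n + 3) * (s - b) * B" for B
        by (simp add: field_simps)
      then show "- ((real n + 3) / 2) * (1 + \<rho> - 2 * s * b + s\<^sup>2) powr (- ((real n + 3) / 2) - of_nat 1) * (2 * s - 2 * b) =
        - (real n + 3) * (s - b) * (1 + \<rho> - 2 * s * b + s\<^sup>2) powr (- ((real n + 3) / 2) - 1)"
        by simp
    qed
  qed
  have ds: "((\<lambda>s. s ^ (n + 1)) has_real_derivative (real n + 1) * s ^ n) (at s)"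
    using DERIV_pow[of "n + 1" s] by (simp add: add.commute)
  have "(radial_primitive n \<rho> b has_real_derivative
     ((real n + 1) * s ^ n * w + (2 * s - (real n + 3) * b) * s ^ (n + 1)) * (q * A) +
       (- (real n + 3) * (s - b) * A) * (s ^ (n + 1) * w)) (at s)"
    using DERIV_mult[OF DERIV_mult[OF ds dw] dp]
    unfolding radial_primitive_def[abs_def] q_def[symmetric] w_def[symmetric] qA .
  also have "((real n + 1) * s ^ n * w + (2 * s - (real n + 3) * b) * s ^ (n + 1)) * (q * A) +
       (- (real n + 3) * (s - b) * A) * (s ^ (n + 1) * w) =
     s ^ n * A * ((real n + 1) * w * q + (2 * s - (real n + 3) * b) * s * q - (real n + 3) * (s - b) * s * w)"
    by (simp add: algebra_simps)
  also have "(real n + 1) * w * q + (2 * s - (real n + 3) * b) * s * q - (real n + 3) * (s - b) * s * w =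
     - (real n + 1) * ((real n + \<rho>) * q - (real n + 3) * ((\<rho> - 2 * s * b + s\<^sup>2) + (\<rho> - s * b)\<^sup>2))"
    unfolding w_def q_def by (simp add: algebra_simps power2_eq_square)
  finally show ?thesis
    unfolding q_def[symmetric] A_def[symmetric] qA
    by (rule DERIV_cong) (simp add: algebra_simps)
qed

text \<open>The polynomial factor has degree n + 3, which the power of the quadratic cancels
  exactly, and its leading coefficient is (n + 2) - (n + 1) = 1. The limit depends neither on
  \<open>\<rho>\<close> nor on \<open>b\<close>, that is, neither on the point nor on the direction;
  for this reason the operator maps the potential to a constant.\<close>

lemma radial_primitive_tendsto_1:
  "(radial_primitive n \<rho> b \<longlongrightarrow> 1) at_top"
proof -
  define q where "q = (\<lambda>s. (1 + \<rho>) * (inverse s)\<^sup>2 - 2 * b * inverse s + 1)"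
  define w where "w = (\<lambda>s. (real n + 1) * (b * inverse s - 1) + (real n + 2) * q s - 2 * (real n + 1) * (inverse s)\<^sup>2)"
  have inv: "((\<lambda>s::real. inverse s) \<longlongrightarrow> 0) at_top"
    by (rule tendsto_inverse_0_at_top[OF filterlim_ident])
  have q: "(q \<longlongrightarrow> (1 + \<rho>) * 0\<^sup>2 - 2 * b * 0 + 1) at_top"
    unfolding q_def by (intro tendsto_intros inv)
  then have q1: "(q \<longlongrightarrow> 1) at_top" by simp
  have w: "(w \<longlongrightarrow> (real n + 1) * (b * 0 - 1) + (real n + 2) * 1 - 2 * (real n + 1) * 0\<^sup>2) at_top"
    unfolding w_def by (intro tendsto_intros inv q1)
  have "((\<lambda>s. w s * q s powr (- ((real n + 3) / 2))) \<longlongrightarrow> 1 * 1 powr (- ((real n + 3) / 2))) at_top"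
    using w by (intro tendsto_intros q1) (auto simp: algebra_simps)
  then have "((\<lambda>s. w s * q s powr (- ((real n + 3) / 2))) \<longlongrightarrow> 1) at_top" by simp
  then show ?thesis
  proof (rule Lim_transform_eventually)
    have "\<forall>\<^sub>F s in at_top. q s > 0"
      using order_tendstoD(1)[OF q1, of 0] by simp
    then show "\<forall>\<^sub>F s in at_top. w s * q s powr (- ((real n + 3) / 2)) = radial_primitive n \<rho> b s"
      using eventually_gt_at_top[of 0]
    proof eventually_elim
      case (elim s)
      have Q: "1 + \<rho> - 2 * s * b + s\<^sup>2 = s\<^sup>2 * q s"
        using elim by (simp add: q_def field_simps power2_eq_square)
      have W: "(real n + 1) * (s * b - s\<^sup>2) + (real n + 2) * (s\<^sup>2 * q s) - 2 * (real n + 1) = s\<^sup>2 * w s"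
        using elim by (simp add: w_def field_simps power2_eq_square)
      have "s\<^sup>2 powr (- ((real n + 3) / 2)) = (s powr 2) powr (- ((real n + 3) / 2))"
        using elim by simp
      also have "\<dots> = s powr (- real (n + 3))"
      proof -
        have "2 * - ((real n + 3) / 2) = - real (n + 3)" by (simp add: field_simps)
        then show ?thesis by (simp only: powr_powr)
      qed
      also have "\<dots> = inverse (s ^ (n + 3))" using elim by (simp only: powr_minus powr_realpow)
      finally have P: "s\<^sup>2 powr (- ((real n + 3) / 2)) = inverse (s ^ (n + 3))" .
      have "s ^ (n + 1) * s\<^sup>2 = s ^ (n + 3)"
        unfolding power_add[symmetric] by (simp add: numeral_eq_Suc)
      then have P: "s ^ (n + 1) * s\<^sup>2 * s\<^sup>2 powr (- ((real n + 3) / 2)) = 1"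
        unfolding P using elim by simp
      have "radial_primitive n \<rho> b s = s ^ (n + 1) * (s\<^sup>2 * w s) * (s\<^sup>2 * q s) powr (- ((real n + 3) / 2))"
        unfolding radial_primitive_def Q W ..
      also have "\<dots> = (s ^ (n + 1) * s\<^sup>2 * s\<^sup>2 powr (- ((real n + 3) / 2))) * (w s * q s powr (- ((real n + 3) / 2)))"
        using elim by (simp add: powr_mult)
      finally show ?case unfolding P by simp
    qed
  qed
qed

lemma op_kernel_radial:
  fixes x \<theta> :: "real^'n"
  assumes \<theta>: "norm \<theta> = 1"
  shows "(radial_primitive CARD('n) ((norm x)\<^sup>2) (x \<bullet> \<theta>) has_real_derivative
     s ^ CARD('n) * op_kernel x (x - s *\<^sub>R \<theta>)) (at s)"
proof -
  have n: "(norm (x - s *\<^sub>R \<theta>))\<^sup>2 = (norm x)\<^sup>2 - 2 * s * (x \<bullet> \<theta>) + s\<^sup>2"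
  proof -
    have "\<theta> \<bullet> \<theta> = 1" using \<theta> by (simp add: dot_square_norm)
    then show ?thesis unfolding power2_norm_eq_inner
      by (simp add: inner_simps inner_commute power2_eq_square algebra_simps)
  qed
  have i: "x \<bullet> (x - s *\<^sub>R \<theta>) = (norm x)\<^sup>2 - s * (x \<bullet> \<theta>)"
    by (simp add: inner_simps power2_norm_eq_inner)
  have q: "bracket (x - s *\<^sub>R \<theta>) = 1 + (norm x)\<^sup>2 - 2 * s * (x \<bullet> \<theta>) + s\<^sup>2"
    unfolding bracket_def n by simp
  show ?thesis
    using DERIV_radial_primitive[of "(norm x)\<^sup>2" s "x \<bullet> \<theta>" "CARD('n)"] bracket_pos[of "x - s *\<^sub>R \<theta>"]
    unfolding op_kernel_def q n i by simp
qed

lemma continuous_on_op_kernel: "continuous_on UNIV (op_kernel x)"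
  unfolding op_kernel_def by (intro continuous_intros continuous_on_bracket_powr)

text \<open>The exponent \<open>CARD('n)\<close> is one more than in the polar Jacobian; the extra
  factor \<open>s\<close> is the homogeneity of the datum. The primitive vanishes at 0 because of
  its factor \<open>s ^ (n + 1)\<close>.\<close>

lemma integral_op_kernel_ray:
  fixes x \<theta> :: "real^'n"
  assumes \<theta>: "norm \<theta> = 1"
    and int: "set_integrable lborel {0<..} (\<lambda>s. s ^ CARD('n) * op_kernel x (x - s *\<^sub>R \<theta>))"
  shows "(LINT s:{0<..}|lborel. s ^ CARD('n) * op_kernel x (x - s *\<^sub>R \<theta>)) = 1"
proof -
  let ?F = "radial_primitive CARD('n) ((norm x)\<^sup>2) (x \<bullet> \<theta>)"
  let ?f = "\<lambda>s. s ^ CARD('n) * op_kernel x (x - s *\<^sub>R \<theta>)"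
  have e: "einterval (ereal 0) \<infinity> = {0<..}" by (auto simp: einterval_def)
  have "(LBINT s=ereal 0..\<infinity>. ?f s) = 1 - 0"
  proof (rule interval_integral_FTC_integrable[where F = ?F])
    show "(?F has_vector_derivative ?f s) (at s)" for s
      using op_kernel_radial[OF \<theta>] by (simp add: has_real_derivative_iff_has_vector_derivative)
    show "isCont ?f s" for s
    proof -
      have "continuous_on UNIV ?f"
        by (intro continuous_intros continuous_on_compose2[OF continuous_on_op_kernel[of x]]) auto
      then show ?thesis by (simp add: continuous_on_eq_continuous_at)
    qed
    show "set_integrable lborel (einterval (ereal 0) \<infinity>) ?f" unfolding e by (rule int)
    have "(?F \<longlongrightarrow> ?F 0) (at_right 0)"
      using DERIV_isCont[OF op_kernel_radial[OF \<theta>, of x 0]]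
      by (simp add: isCont_def filterlim_at_split)
    then show "((?F \<circ> real_of_ereal) \<longlongrightarrow> 0) (at_right (ereal 0))"
      by (simp add: ereal_tendsto_simps radial_primitive_def)
    show "((?F \<circ> real_of_ereal) \<longlongrightarrow> 1) (at_left \<infinity>)"
      using radial_primitive_tendsto_1 by (simp add: ereal_tendsto_simps)
  qed simp
  then show ?thesis by (simp add: interval_lebesgue_integral_def e)
qed

section \<open>Poisson integral of a homogeneous function\<close>

lemma lborel_eq_distr_reflect: "(lborel :: 'a::euclidean_space measure) = distr lborel borel (\<lambda>z. x - z)"
  using lborel_affine[of "-1" x] by (simp add: density_1)

lemma integral_lborel_reflect:
  fixes f :: "'a::euclidean_space \<Rightarrow> real"
  assumes [measurable]: "f \<in> borel_measurable borel"
  shows "(\<integral>y. f y \<partial>lborel) = (\<integral>z. f (x - z) \<partial>lborel)"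
  by (subst lborel_eq_distr_reflect[of x]) (simp add: integral_distr)

lemma integrable_lborel_reflect:
  fixes f :: "'a::euclidean_space \<Rightarrow> real"
  assumes "integrable lborel f"
  shows "integrable lborel (\<lambda>z. f (x - z))"
proof -
  have "integrable (distr lborel borel (\<lambda>z. x - z)) f"
    using assms by (subst lborel_eq_distr_reflect[symmetric])
  then show ?thesis using assms by (simp add: integrable_distr_eq)
qed

text \<open>The existence proof uses the cone extension of the boundary datum through these
  properties only. In the application the datum is divided by the mass of \<open>poisson\<close>, so
  the kernel can stay unnormalised.\<close>

locale homogeneous_datum =
  fixes G :: "real^'n \<Rightarrow> real" and M :: real
  assumes continuous_G: "continuous_on UNIV G"
    and M_nonneg: "M \<ge> 0"
    and G_le: "\<bar>G y\<bar> \<le> M * norm y"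
    and G_scaleR: "r \<ge> 0 \<Longrightarrow> G (r *\<^sub>R y) = r * G y"
begin

lemma borel_measurable_G [measurable]: "G \<in> borel_measurable borel"
  using continuous_G by (rule borel_measurable_continuous_onI)

text \<open>Rapid decay times linear growth is dominated by the Poisson kernel itself, which thereby
  becomes the majorant for every integral in this locale.\<close>

lemma bracket_powr_mult_G_le:
  "bracket y powr (- ((real CARD('n) + 2) / 2)) * \<bar>G y\<bar> \<le> M * poisson y"
proof -
  have e: "(real CARD('n) + 1) / 2 + 1 / 2 = (real CARD('n) + 2) / 2" by (simp add: field_simps)
  have "bracket y powr (- ((real CARD('n) + 2) / 2)) * \<bar>G y\<bar> \<le> bracket y powr (- ((real CARD('n) + 2) / 2)) * (M * norm y)"
    by (intro mult_left_mono G_le) auto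
  also have "\<dots> = M * (norm y * bracket y powr (- ((real CARD('n) + 2) / 2)))" by simp
  also have "\<dots> \<le> M * poisson y"
    using norm_mult_bracket_powr_le[of y "(real CARD('n) + 1) / 2"] M_nonneg
    unfolding e poisson_def by (intro mult_left_mono) auto
  finally show ?thesis .
qed

section \<open>Convolution with rapidly decaying kernels\<close>

definition conv :: "(real^'n \<Rightarrow> real) \<Rightarrow> real^'n \<Rightarrow> real" where
  "conv Q x = (\<integral>y. Q (x - y) * G y \<partial>lborel)"

text \<open>For each \<open>R\<close> this is one integrable majorant valid for all \<open>x\<close>
  in the ball of radius \<open>R\<close>, as differentiation and continuity under the integral sign
  demand.\<close>

lemma rapid_kernel_bound:
  assumes "rapid_kernel Q"
  obtains K where "\<And>R x y. norm x \<le> R \<Longrightarrow>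
    \<bar>Q (x - y) * G y\<bar> \<le> K * (2 * (1 + R\<^sup>2)) powr ((real CARD('n) + 2) / 2) * M * poisson y"
proof -
  obtain K where K: "\<And>z. \<bar>Q z\<bar> \<le> K * bracket z powr (- ((real CARD('n) + 2) / 2))"
    using assms unfolding rapid_kernel_def by blast
  have "0 \<le> K * bracket (0::real^'n) powr (- ((real CARD('n) + 2) / 2))"
    using K[of 0] by linarith
  then have K0: "K \<ge> 0" by (simp add: bracket_def)
  show thesis
  proof
    fix R x y assume x: "norm (x::real^'n) \<le> R"
    let ?c = "2 * (1 + R\<^sup>2)"
    have c: "?c > 0" by (simp add: add_pos_nonneg)
    have "\<bar>Q (x - y)\<bar> \<le> K * bracket (x - y) powr (- ((real CARD('n) + 2) / 2))" by (rule K)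
    also have "\<dots> \<le> K * (?c powr ((real CARD('n) + 2) / 2) * bracket y powr (- ((real CARD('n) + 2) / 2)))"
      by (intro mult_left_mono bracket_powr_le[OF bracket_translate_le[OF x] _ c] K0) auto
    finally have "\<bar>Q (x - y) * G y\<bar> \<le> K * (?c powr ((real CARD('n) + 2) / 2) * bracket y powr (- ((real CARD('n) + 2) / 2))) * \<bar>G y\<bar>"
      unfolding abs_mult by (intro mult_right_mono) auto
    also have "\<dots> = K * ?c powr ((real CARD('n) + 2) / 2) * (bracket y powr (- ((real CARD('n) + 2) / 2)) * \<bar>G y\<bar>)"
      by simp
    also have "\<dots> \<le> K * ?c powr ((real CARD('n) + 2) / 2) * (M * poisson y)"
      by (intro mult_left_mono bracket_powr_mult_G_le) (use K0 in auto)
    finally show "\<bar>Q (x - y) * G y\<bar> \<le> K * ?c powr ((real CARD('n) + 2) / 2) * M * poisson y"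
      by simp
  qed
qed

lemma measurable_conv_integrand:
  assumes "continuous_on UNIV Q"
  shows "(\<lambda>y. Q (x - y) * G y) \<in> borel_measurable borel"
proof -
  have "continuous_on UNIV (\<lambda>y. Q (x - y))"
    by (rule continuous_on_compose2[OF assms]) (auto intro!: continuous_intros)
  then show ?thesis by (intro borel_measurable_times borel_measurable_continuous_onI continuous_G)
qed

lemma integrable_conv_integrand:
  assumes "rapid_kernel Q"
  shows "integrable lborel (\<lambda>y. Q (x - y) * G y)"
proof -
  obtain K where K: "\<And>R x y. norm x \<le> R \<Longrightarrow>
    \<bar>Q (x - y) * G y\<bar> \<le> K * (2 * (1 + R\<^sup>2)) powr ((real CARD('n) + 2) / 2) * M * poisson y"
    using rapid_kernel_bound[OF assms] by blast
  have i: "integrable lborel (\<lambda>y::real^'n. K * (2 * (1 + (norm x)\<^sup>2)) powr ((real CARD('n) + 2) / 2) * M * poisson y)"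
    by (intro integrable_mult_right integrable_poisson)
  show ?thesis
  proof (rule Bochner_Integration.integrable_bound[OF i])
    show "(\<lambda>y. Q (x - y) * G y) \<in> borel_measurable lborel"
      using measurable_conv_integrand[OF rapid_kernelD[OF assms]] by simp
    show "AE y in lborel. norm (Q (x - y) * G y) \<le> norm (K * (2 * (1 + (norm x)\<^sup>2)) powr ((real CARD('n) + 2) / 2) * M * poisson y)"
      using K[OF order.refl, of x] by (intro AE_I2) (metis abs_ge_self order_trans real_norm_def)
  qed
qed

lemma continuous_on_conv:
  assumes "rapid_kernel Q"
  shows "continuous_on UNIV (conv Q)"
proof -
  obtain K where K: "\<And>R x y. norm x \<le> R \<Longrightarrow>
    \<bar>Q (x - y) * G y\<bar> \<le> K * (2 * (1 + R\<^sup>2)) powr ((real CARD('n) + 2) / 2) * M * poisson y"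
    using rapid_kernel_bound[OF assms] by blast
  show ?thesis unfolding conv_def
  proof (rule continuous_on_integral_dominated[where w = "\<lambda>R y. K * (2 * (1 + R\<^sup>2)) powr ((real CARD('n) + 2) / 2) * M * poisson y", OF _ _ K])
    show "continuous_on UNIV (\<lambda>x. Q (x - y) * G y)" for y
      by (intro continuous_intros continuous_on_compose2[OF rapid_kernelD[OF assms]]) auto
    show "(\<lambda>y. Q (x - y) * G y) \<in> borel_measurable lborel" for x
      using measurable_conv_integrand[OF rapid_kernelD[OF assms]] by simp
  qed (assumption, intro integrable_mult_right integrable_poisson)
qed

text \<open>Stated for a general family \<open>k\<close> so as to cover both \<open>conv Q\<close>
  and the potential, whose integrand is not a convolution because of the subtracted term.\<close>

lemma DERIV_conv_general:
  fixes k :: "real \<Rightarrow> real^'n \<Rightarrow> real"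
  assumes Q: "rapid_kernel Q'"
    and int: "\<And>t. integrable lborel (k t)"
    and der: "\<And>y t. ((\<lambda>t. k t y) has_real_derivative Q' (x + t *\<^sub>R axis i 1 - y) * G y) (at t)"
  shows "((\<lambda>t. \<integral>y. k t y \<partial>lborel) has_real_derivative conv Q' x) (at 0)"
proof -
  obtain K where K: "\<And>R x y. norm x \<le> R \<Longrightarrow>
    \<bar>Q' (x - y) * G y\<bar> \<le> K * (2 * (1 + R\<^sup>2)) powr ((real CARD('n) + 2) / 2) * M * poisson y"
    using rapid_kernel_bound[OF Q] by blast
  have "((\<lambda>t. \<integral>y. k t y \<partial>lborel) has_real_derivative (\<integral>y. Q' (x + 0 *\<^sub>R axis i 1 - y) * G y \<partial>lborel)) (at 0)"
  proof (rule has_real_derivative_integral[where e = 1 and f' = "\<lambda>t y. Q' (x + t *\<^sub>R axis i 1 - y) * G y", OF _ int der K])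
    show "norm (x + t *\<^sub>R axis i 1) \<le> norm x + 1" if "\<bar>t\<bar> < 1" for t
      using norm_triangle_ineq[of x "t *\<^sub>R axis i 1"] that by (simp add: norm_axis_1)
    show "(\<lambda>y. Q' (x + 0 *\<^sub>R axis i 1 - y) * G y) \<in> borel_measurable lborel"
      using measurable_conv_integrand[OF rapid_kernelD[OF Q]] by simp
  qed (auto intro: integrable_mult_right integrable_poisson)
  then show ?thesis by (simp add: conv_def)
qed

lemma DERIV_conv:
  assumes Q: "rapid_kernel Q" "rapid_kernel Q'"
    and der: "\<And>z t. ((\<lambda>t. Q (z + t *\<^sub>R axis i 1)) has_real_derivative Q' (z + t *\<^sub>R axis i 1)) (at t)"
  shows "((\<lambda>t. conv Q (x + t *\<^sub>R axis i 1)) has_real_derivative conv Q' x) (at 0)"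
  unfolding conv_def[of Q]
proof (rule DERIV_conv_general[OF Q(2)])
  show "integrable lborel (\<lambda>y. Q (x + t *\<^sub>R axis i 1 - y) * G y)" for t
    by (rule integrable_conv_integrand[OF Q(1)])
  show "((\<lambda>t. Q (x + t *\<^sub>R axis i 1 - y) * G y) has_real_derivative Q' (x + t *\<^sub>R axis i 1 - y) * G y) (at t)" for y t
    using DERIV_cmult_right[OF der[of "x - y" t], of "G y"] by (simp add: algebra_simps)
qed

section \<open>The potential, its regularity and its equation\<close>

definition pot :: "real^'n \<Rightarrow> real" where
  "pot x = (\<integral>y. (poisson (x - y) - poisson y) * G y \<partial>lborel)"

lemma pot_0: "pot 0 = 0"
  by (simp add: pot_def poisson_def)

lemma pot_integrand_le:
  assumes "norm x \<le> R"
  shows "\<bar>(poisson (x - y) - poisson y) * G y\<bar> \<le>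
    (real CARD('n) + 1) * R * (2 * (1 + R\<^sup>2)) powr ((real CARD('n) + 2) / 2) * M * poisson y"
proof -
  let ?c = "2 * (1 + R\<^sup>2)"
  have R: "R \<ge> 0" using assms norm_ge_zero order_trans by blast
  have c: "?c > 0" by (simp add: add_pos_nonneg)
  have "bracket y \<le> ?c * bracket (t *\<^sub>R x - y)" if "0 \<le> t" "t \<le> 1" for t
  proof (rule bracket_translate_le)
    have "t * norm x \<le> 1 * norm x" using that by (intro mult_right_mono) auto
    then show "norm (t *\<^sub>R x) \<le> R" using that assms by simp
  qed
  from abs_poisson_diff_le[OF c this]
  have "\<bar>poisson (x - y) - poisson y\<bar> \<le> (real CARD('n) + 1) * norm x * ?c powr ((real CARD('n) + 2) / 2) * bracket y powr (- ((real CARD('n) + 2) / 2))"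
    by simp
  also have "\<dots> \<le> (real CARD('n) + 1) * R * ?c powr ((real CARD('n) + 2) / 2) * bracket y powr (- ((real CARD('n) + 2) / 2))"
    using assms by (intro mult_right_mono mult_left_mono) auto
  finally have "\<bar>(poisson (x - y) - poisson y) * G y\<bar> \<le>
     (real CARD('n) + 1) * R * ?c powr ((real CARD('n) + 2) / 2) * bracket y powr (- ((real CARD('n) + 2) / 2)) * \<bar>G y\<bar>"
    unfolding abs_mult by (intro mult_right_mono) auto
  also have "\<dots> = (real CARD('n) + 1) * R * ?c powr ((real CARD('n) + 2) / 2) * (bracket y powr (- ((real CARD('n) + 2) / 2)) * \<bar>G y\<bar>)"
    by simp
  also have "\<dots> \<le> (real CARD('n) + 1) * R * ?c powr ((real CARD('n) + 2) / 2) * (M * poisson y)"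
    using R by (intro mult_left_mono bracket_powr_mult_G_le) auto
  finally show ?thesis by simp
qed

lemma measurable_pot_integrand: "(\<lambda>y. (poisson (x - y) - poisson y) * G y) \<in> borel_measurable borel"
  by measurable

lemma integrable_pot_integrand: "integrable lborel (\<lambda>y. (poisson (x - y) - poisson y) * G y)"
proof -
  have i: "integrable lborel (\<lambda>y::real^'n. (real CARD('n) + 1) * norm x * (2 * (1 + (norm x)\<^sup>2)) powr ((real CARD('n) + 2) / 2) * M * poisson y)"
    by (intro integrable_mult_right integrable_poisson)
  show ?thesis
  proof (rule Bochner_Integration.integrable_bound[OF i])
    show "(\<lambda>y. (poisson (x - y) - poisson y) * G y) \<in> borel_measurable lborel"
      using measurable_pot_integrand by simp
    show "AE y in lborel. norm ((poisson (x - y) - poisson y) * G y) \<le>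
        norm ((real CARD('n) + 1) * norm x * (2 * (1 + (norm x)\<^sup>2)) powr ((real CARD('n) + 2) / 2) * M * poisson y)"
      by (intro AE_I2) (simp only: real_norm_def, rule order_trans[OF pot_integrand_le[OF order.refl] abs_ge_self])
  qed
qed

lemma continuous_on_pot: "continuous_on UNIV pot"
  unfolding pot_def
proof (rule continuous_on_integral_dominated[where w = "\<lambda>R y. (real CARD('n) + 1) * R * (2 * (1 + R\<^sup>2)) powr ((real CARD('n) + 2) / 2) * M * poisson y", OF _ _ pot_integrand_le])
  show "continuous_on UNIV (\<lambda>x. (poisson (x - y) - poisson y) * G y)" for y
    by (intro continuous_intros continuous_on_poisson)
  show "(\<lambda>y. (poisson (x - y) - poisson y) * G y) \<in> borel_measurable lborel" for x
    using measurable_pot_integrand by simp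
qed (assumption, intro integrable_mult_right integrable_poisson)

text \<open>The subtracted \<open>poisson y\<close> is constant in \<open>x\<close> and drops out,
  so all derivatives of the potential are genuine convolutions with rapidly decaying
  kernels.\<close>

lemma DERIV_pot: "((\<lambda>t. pot (x + t *\<^sub>R axis i 1)) has_real_derivative conv (poisson_grad i) x) (at 0)"
  unfolding pot_def
proof (rule DERIV_conv_general[OF rapid_kernel_poisson_grad])
  show "integrable lborel (\<lambda>y. (poisson (x + t *\<^sub>R axis i 1 - y) - poisson y) * G y)" for t
    by (rule integrable_pot_integrand)
  show "((\<lambda>t. (poisson (x + t *\<^sub>R axis i 1 - y) - poisson y) * G y) has_real_derivative
      poisson_grad i (x + t *\<^sub>R axis i 1 - y) * G y) (at t)" for y t
    using DERIV_cmult_right[OF DERIV_diff[OF DERIV_poisson_axis[of "x - y" i t] DERIV_const], of "poisson y" "G y"]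
    by (simp add: algebra_simps)
qed

lemma partial_deriv_pot: "partial_deriv i pot = conv (poisson_grad i)"
  using DERIV_imp_deriv[OF DERIV_pot] by (simp add: partial_deriv_def fun_eq_iff)

lemma partial_deriv_conv_poisson_grad: "partial_deriv i (conv (poisson_grad j)) = conv (poisson_hess i j)"
  using DERIV_imp_deriv[OF DERIV_conv[OF rapid_kernel_poisson_grad rapid_kernel_poisson_hess DERIV_poisson_grad_axis]]
  by (simp add: partial_deriv_def fun_eq_iff)

lemma C2_pot: "C2 pot"
  unfolding C2_def C1_def has_partial_def partial_deriv_pot partial_deriv_conv_poisson_grad real_differentiable_def
  using continuous_on_pot continuous_on_conv[OF rapid_kernel_poisson_grad] continuous_on_conv[OF rapid_kernel_poisson_hess]
    DERIV_pot DERIV_conv[OF rapid_kernel_poisson_grad rapid_kernel_poisson_hess DERIV_poisson_grad_axis]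
  by blast

lemma
  shows integrable_op_kernel: "integrable lborel (\<lambda>y. op_kernel x (x - y) * G y)"
    and ell_op_pot_eq: "ell_op pot x = (\<integral>y. op_kernel x (x - y) * G y \<partial>lborel)"
proof -
  let ?h = "\<lambda>i j y. ((if i = j then 1 else 0) + x $ i * x $ j) * (poisson_hess i j (x - y) * G y)"
  have eq: "(\<Sum>i\<in>UNIV. \<Sum>j\<in>UNIV. ?h i j y) = op_kernel x (x - y) * G y" for y
    unfolding sum_poisson_hess[symmetric] by (simp add: sum_distrib_right mult.assoc)
  have i: "integrable lborel (?h i j)" for i j
    by (intro integrable_mult_right integrable_conv_integrand rapid_kernel_poisson_hess)
  then have "integrable lborel (\<lambda>y. \<Sum>i\<in>UNIV. \<Sum>j\<in>UNIV. ?h i j y)"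
    by (intro Bochner_Integration.integrable_sum)
  then show "integrable lborel (\<lambda>y. op_kernel x (x - y) * G y)" unfolding eq .
  have "ell_op pot x = (\<Sum>i\<in>UNIV. \<Sum>j\<in>UNIV. (\<integral>y. ?h i j y \<partial>lborel))"
    by (simp add: ell_op_def partial_deriv_pot partial_deriv_conv_poisson_grad conv_def)
  also have "\<dots> = (\<integral>y. (\<Sum>i\<in>UNIV. \<Sum>j\<in>UNIV. ?h i j y) \<partial>lborel)"
    using i by (simp add: Bochner_Integration.integral_sum Bochner_Integration.integrable_sum)
  finally show "ell_op pot x = (\<integral>y. op_kernel x (x - y) * G y \<partial>lborel)" unfolding eq .
qed

text \<open>In polar coordinates about 0 the integrand is a function of the direction times a radial
  factor whose integral is 1, so the right-hand side no longer contains \<open>x\<close>.\<close>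

lemma ell_op_pot: "ell_op pot x = real CARD('n) * (\<integral>z. indicator (ball 0 1) z * G (z /\<^sub>R norm z) \<partial>lborel)"
proof -
  let ?N = "CARD('n)"
  let ?f = "\<lambda>y. op_kernel x (x - y) * G y"
  have "ell_op pot x = (\<integral>z. \<integral>s. polar_weight (z, s) * ?f (s *\<^sub>R (z /\<^sub>R norm z)) \<partial>lborel \<partial>lborel)"
    unfolding ell_op_pot_eq by (rule integral_lborel_polar[OF integrable_op_kernel])
  also have "\<dots> = (\<integral>z. real ?N * (indicator (ball 0 1) z * G (z /\<^sub>R norm z)) \<partial>lborel)"
  proof (rule integral_cong_AE)
    show "AE z in lborel. (\<integral>s. polar_weight (z, s) * ?f (s *\<^sub>R (z /\<^sub>R norm z)) \<partial>lborel) =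
        real ?N * (indicator (ball 0 1) z * G (z /\<^sub>R norm z))"
      using AE_integrable_polar[OF integrable_op_kernel[of x]] AE_lborel_singleton[of "0::real^'n"]
    proof eventually_elim
      case (elim z)
      define \<theta> where "\<theta> = z /\<^sub>R norm z"
      have \<theta>: "norm \<theta> = 1" using elim by (simp add: \<theta>_def)
      have eq: "polar_weight (z, s) * ?f (s *\<^sub>R \<theta>) =
         (real ?N * indicator (ball 0 1) z * G \<theta>) * (indicator {0<..} s * (s ^ ?N * op_kernel x (x - s *\<^sub>R \<theta>)))" for s
      proof (cases "s > 0")
        case True
        \<comment> \<open>The Jacobian and the homogeneity of \<open>G\<close> combine to the power
          for which a primitive is known.\<close>
        have "s ^ (?N - 1) * s = s ^ ?N" by (metis power_minus_mult zero_less_card_finite)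
        then show ?thesis using True
          by (simp add: polar_weight_def G_scaleR mult_ac)
      next
        case False
        then show ?thesis by (simp add: polar_weight_def)
      qed
      \<comment> \<open>If the coefficient vanishes, integrability of the product says nothing about
        the radial factor, but then both sides are 0.\<close>
      show ?case
      proof (cases "real ?N * indicator (ball 0 1) z * G \<theta> = 0")
        case True
        then show ?thesis unfolding \<theta>_def[symmetric] eq by auto
      next
        case False
        have "integrable lborel (\<lambda>s. (real ?N * indicator (ball 0 1) z * G \<theta>) * (indicator {0<..} s * (s ^ ?N * op_kernel x (x - s *\<^sub>R \<theta>))))"
          using elim(1) unfolding \<theta>_def[symmetric] eq .
        then have "set_integrable lborel {0<..} (\<lambda>s. s ^ ?N * op_kernel x (x - s *\<^sub>R \<theta>))"
          using False by (simp add: set_integrable_def)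
        from integral_op_kernel_ray[OF \<theta> this]
        have "(\<integral>s. indicator {0<..} s * (s ^ ?N * op_kernel x (x - s *\<^sub>R \<theta>)) \<partial>lborel) = 1"
          by (simp add: set_lebesgue_integral_def)
        then show ?thesis unfolding \<theta>_def[symmetric] eq by (simp add: mult.assoc)
      qed
    qed
    have [measurable]: "(\<lambda>y. op_kernel x (x - y)) \<in> borel_measurable borel"
      by (intro borel_measurable_continuous_onI continuous_on_compose2[OF continuous_on_op_kernel[of x]] continuous_intros) auto
    have "(\<lambda>p. polar_weight p * ?f (snd p *\<^sub>R (fst p /\<^sub>R norm (fst p)))) \<in> borel_measurable (borel \<Otimes>\<^sub>M borel)"
      by measurable
    then show "(\<lambda>z. \<integral>s. polar_weight (z, s) * ?f (s *\<^sub>R (z /\<^sub>R norm z)) \<partial>lborel) \<in> borel_measurable lborel"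
      by (intro lborel.borel_measurable_lebesgue_integral) (simp add: split_beta')
    have [measurable]: "ball (0::real^'n) 1 \<in> sets borel" by simp
    have "(\<lambda>z. real ?N * (indicator (ball 0 1) z * G (z /\<^sub>R norm z))) \<in> borel_measurable borel"
      by measurable
    then show "(\<lambda>z. real ?N * (indicator (ball 0 1) z * G (z /\<^sub>R norm z))) \<in> borel_measurable lborel"
      by simp
  qed
  finally show ?thesis by simp
qed

section \<open>Behaviour at infinity\<close>

text \<open>\<open>G\<close> with its growth stopped at \<open>|y| = 2\<close>: near the unit sphere nothing changes, and the part of
  \<open>pot\<close> coming from \<open>clamped\<close> is an honest Poisson integral of a bounded function.\<close>

definition clamped :: "real^'n \<Rightarrow> real" where
  "clamped y = min 2 (norm y) / norm y * G y"

lemma clamped_eq: "norm y \<le> 2 \<Longrightarrow> clamped y = G y"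
  using G_scaleR[of 0 y] by (cases "y = 0") (auto simp: clamped_def)

lemma abs_clamped_le: "\<bar>clamped y\<bar> \<le> 2 * M"
proof (cases "y = 0")
  case False
  have "\<bar>clamped y\<bar> = min 2 (norm y) / norm y * \<bar>G y\<bar>" by (simp add: clamped_def abs_mult)
  also have "\<dots> \<le> min 2 (norm y) / norm y * (M * norm y)" by (intro mult_left_mono G_le) auto
  also have "\<dots> = min 2 (norm y) * M" using False by simp
  also have "\<dots> \<le> 2 * M" using M_nonneg by (intro mult_right_mono) auto
  finally show ?thesis .
qed (use M_nonneg in \<open>simp add: clamped_def\<close>)

lemma borel_measurable_clamped [measurable]: "clamped \<in> borel_measurable borel"
  unfolding clamped_def by measurable

text \<open>A point of the unit ball moved by less than 1 stays in the ball of radius 2, where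
  \<open>clamped\<close> is \<open>G\<close>; this fixes the clamping radius. Uniform continuity of
  \<open>G\<close> on that compact ball makes \<open>\<delta>\<close> independent of the
  direction.\<close>

lemma clamped_uniform:
  assumes "\<epsilon> > 0"
  obtains \<delta> where "0 < \<delta>" "\<delta> \<le> 1" "\<And>x h. norm x \<le> 1 \<Longrightarrow> norm h < \<delta> \<Longrightarrow> \<bar>clamped (x - h) - clamped x\<bar> \<le> \<epsilon>"
proof -
  have "uniformly_continuous_on (cball 0 2) G"
    by (intro compact_uniformly_continuous continuous_on_subset[OF continuous_G]) auto
  then obtain d where d: "d > 0"
    "\<And>x y. x \<in> cball 0 2 \<Longrightarrow> y \<in> cball 0 2 \<Longrightarrow> dist y x < d \<Longrightarrow> dist (G y) (G x) < \<epsilon>"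
    using assms unfolding uniformly_continuous_on_def by metis
  show thesis
  proof
    show "0 < min d 1" "min d 1 \<le> 1" using d by auto
    fix x h :: "real^'n" assume a: "norm x \<le> 1" "norm h < min d 1"
    have "norm (x - h) \<le> 2" using norm_triangle_ineq4[of x h] a by simp
    have "norm x \<le> 2" using a by simp
    show "\<bar>clamped (x - h) - clamped x\<bar> \<le> \<epsilon>"
    proof -
      have "dist (G (x - h)) (G x) < \<epsilon>"
        using \<open>norm (x - h) \<le> 2\<close> \<open>norm x \<le> 2\<close> a
        by (intro d(2)) (simp_all only: mem_cball_0, simp add: dist_norm)
      then show ?thesis
        using clamped_eq[OF \<open>norm (x - h) \<le> 2\<close>] clamped_eq[OF \<open>norm x \<le> 2\<close>] by (simp add: dist_real_def)
    qed
  qed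
qed

definition poisson_tail :: "real \<Rightarrow> real" where
  "poisson_tail R = (\<integral>z. indicator {z. norm z \<ge> R} z * poisson (z::real^'n) \<partial>lborel)"

lemma sets_norm_ge [measurable]: "{z::real^'n. norm z \<ge> R} \<in> sets borel"
  by (intro borel_closed closed_Collect_le continuous_intros)

lemma integrable_poisson_tail: "integrable lborel (\<lambda>z::real^'n. indicator {z. norm z \<ge> R} z * poisson z)"
  using integrable_mult_indicator[OF _ integrable_poisson, of "{z::real^'n. norm z \<ge> R}"] by simp

lemma poisson_tail_tendsto_0: "(poisson_tail \<longlongrightarrow> 0) at_top"
proof -
  have "((\<lambda>R. \<integral>z. indicator {z. norm z \<ge> R} z * poisson (z::real^'n) \<partial>lborel) \<longlongrightarrow> (\<integral>(z::real^'n). 0 \<partial>lborel)) at_top"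
  proof (rule integral_dominated_convergence_at_top)
    show "integrable lborel (poisson :: real^'n \<Rightarrow> real)" by (rule integrable_poisson)
    show "(\<lambda>z::real^'n. indicator {z. norm z \<ge> R} z * poisson z) \<in> borel_measurable lborel" for R
      using integrable_poisson_tail by (rule borel_measurable_integrable)
    show "AE z::real^'n in lborel. ((\<lambda>R. indicator {z. norm z \<ge> R} z * poisson z) \<longlongrightarrow> 0) at_top"
    proof (rule AE_I2)
      fix z :: "real^'n"
      have "\<forall>\<^sub>F R in at_top. indicator {z. norm z \<ge> R} z * poisson z = 0"
        using eventually_gt_at_top[of "norm z"] by eventually_elim simp
      then show "((\<lambda>R. indicator {z. norm z \<ge> R} z * poisson z) \<longlongrightarrow> 0) at_top"
        by (rule tendsto_eventually)
    qed
    show "\<forall>\<^sub>F R in at_top. AE z::real^'n in lborel. norm (indicator {z. norm z \<ge> R} z * poisson z) \<le> poisson z"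
      by (intro always_eventually allI AE_I2) (auto simp: indicator_def less_imp_le poisson_pos)
  qed simp
  then show ?thesis by (simp add: poisson_tail_def[abs_def])
qed

lemma poisson_tail_antimono: "R \<le> S \<Longrightarrow> poisson_tail S \<le> poisson_tail R"
  unfolding poisson_tail_def
  by (intro integral_mono integrable_poisson_tail) (auto simp: indicator_def less_imp_le poisson_pos)

lemma integrable_poisson_mult_clamped:
  "integrable lborel (\<lambda>z. poisson z * clamped (x + c *\<^sub>R z))"
proof (rule Bochner_Integration.integrable_bound[where f = "\<lambda>z. 2 * M * poisson z"])
  show "AE z in lborel. norm (poisson z * clamped (x + c *\<^sub>R z)) \<le> norm (2 * M * poisson z)"
  proof (rule AE_I2)
    fix z
    have "norm (poisson z * clamped (x + c *\<^sub>R z)) = poisson z * \<bar>clamped (x + c *\<^sub>R z)\<bar>"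
      using poisson_pos[of z] by (simp add: abs_mult)
    also have "\<dots> \<le> poisson z * (2 * M)"
      using poisson_pos[of z] by (intro mult_left_mono abs_clamped_le) auto
    finally show "norm (poisson z * clamped (x + c *\<^sub>R z)) \<le> norm (2 * M * poisson z)"
      using M_nonneg poisson_pos[of z] by (simp add: mult_ac)
  qed
  show "(\<lambda>z. poisson z * clamped (x + c *\<^sub>R z)) \<in> borel_measurable lborel" by simp
qed (intro integrable_mult_right integrable_poisson)

text \<open>Split at \<open>norm z = \<delta> * r\<close>: inside, the shift is smaller than
  \<open>\<delta>\<close> and the continuity bound applies; outside, the two values differ by at
  most \<open>4 * M\<close>, twice the bound on \<open>clamped\<close>, and only the tail of the
  kernel contributes.\<close>

lemma approximate_identity:
  assumes \<delta>: "0 < \<delta>" "\<And>h. norm h < \<delta> \<Longrightarrow> \<bar>clamped (x - h) - clamped x\<bar> \<le> \<epsilon>"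
    and r: "r > 0" and \<epsilon>: "\<epsilon> \<ge> 0"
  shows "\<bar>(\<integral>z. poisson z * clamped (x - z /\<^sub>R r) \<partial>lborel) - (\<integral>z. poisson (z::real^'n) \<partial>lborel) * clamped x\<bar>
    \<le> \<epsilon> * (\<integral>z. poisson (z::real^'n) \<partial>lborel) + 4 * M * poisson_tail (\<delta> * r)"
proof -
  have i1: "integrable lborel (\<lambda>z. poisson z * clamped (x - z /\<^sub>R r))"
    using integrable_poisson_mult_clamped[of x "- inverse r"] by simp
  have i2: "integrable lborel (\<lambda>z::real^'n. poisson z * clamped x)"
    by (intro integrable_mult_left integrable_poisson)
  have "(\<integral>z. poisson z * clamped (x - z /\<^sub>R r) \<partial>lborel) - (\<integral>z. poisson (z::real^'n) \<partial>lborel) * clamped x =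
     (\<integral>z. poisson z * clamped (x - z /\<^sub>R r) - poisson z * clamped x \<partial>lborel)"
    using Bochner_Integration.integral_diff[OF i1 i2] by simp
  also have "\<bar>\<dots>\<bar> \<le> (\<integral>z. \<epsilon> * poisson (z::real^'n) + 4 * M * (indicator {z. norm z \<ge> \<delta> * r} z * poisson z) \<partial>lborel)"
  proof (rule integral_abs_bound[THEN order_trans], rule integral_mono)
    show "integrable lborel (\<lambda>z. \<bar>poisson z * clamped (x - z /\<^sub>R r) - poisson z * clamped x\<bar>)"
      by (intro integrable_abs Bochner_Integration.integrable_diff i1 i2)
    show "integrable lborel (\<lambda>z::real^'n. \<epsilon> * poisson z + 4 * M * (indicator {z. norm z \<ge> \<delta> * r} z * poisson z))"
      by (intro Bochner_Integration.integrable_add integrable_mult_right integrable_poisson integrable_poisson_tail)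
    fix z :: "real^'n"
    have p: "poisson z \<ge> 0" using poisson_pos[of z] by simp
    have "\<bar>poisson z * clamped (x - z /\<^sub>R r) - poisson z * clamped x\<bar> = poisson z * \<bar>clamped (x - z /\<^sub>R r) - clamped x\<bar>"
      using p by (simp add: right_diff_distrib[symmetric] abs_mult)
    also have "\<dots> \<le> poisson z * (\<epsilon> + 4 * M * indicator {z. norm z \<ge> \<delta> * r} z)"
    proof (intro mult_left_mono p)
      show "\<bar>clamped (x - z /\<^sub>R r) - clamped x\<bar> \<le> \<epsilon> + 4 * M * indicator {z. norm z \<ge> \<delta> * r} z"
      proof (cases "norm z \<ge> \<delta> * r")
        case True
        have "\<bar>clamped (x - z /\<^sub>R r) - clamped x\<bar> \<le> 2 * M + 2 * M"
          using abs_clamped_le[of "x - z /\<^sub>R r"] abs_clamped_le[of x] by linarith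
        then show ?thesis using True \<epsilon> by simp
      next
        case False
        then have "norm (z /\<^sub>R r) < \<delta>" using r by (simp add: field_simps)
        from \<delta>(2)[OF this] show ?thesis using False by simp
      qed
    qed
    finally show "\<bar>poisson z * clamped (x - z /\<^sub>R r) - poisson z * clamped x\<bar> \<le>
        \<epsilon> * poisson z + 4 * M * (indicator {z. norm z \<ge> \<delta> * r} z * poisson z)"
      by (simp add: algebra_simps)
  qed
  also have "\<dots> = \<epsilon> * (\<integral>z. poisson (z::real^'n) \<partial>lborel) + 4 * M * poisson_tail (\<delta> * r)"
    by (simp add: poisson_tail_def integrable_poisson integrable_poisson_tail)
  finally show ?thesis .
qed

text \<open>The second factor vanishes for \<open>norm y\<close> up to \<open>2 * r\<close>. Farther
  out the segment from 0 to \<open>x\<close> is short compared with \<open>y\<close>, so the kernel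
  increment is controlled with a constant free of \<open>r\<close>. The result is \<open>r\<close>
  times a tail that tends to 0, hence of lower order than \<open>r\<close>.\<close>

lemma pot_far_part:
  assumes x: "norm x = r" "r > 0"
  shows "\<bar>\<integral>y. (poisson (x - y) - poisson y) * (G y - r * clamped (y /\<^sub>R r)) \<partial>lborel\<bar> \<le>
    (real CARD('n) + 1) * 4 powr ((real CARD('n) + 2) / 2) * M * r * poisson_tail r"
proof -
  let ?K = "(real CARD('n) + 1) * 4 powr ((real CARD('n) + 2) / 2) * M * r"
  have pw: "\<bar>(poisson (x - y) - poisson y) * (G y - r * clamped (y /\<^sub>R r))\<bar> \<le> ?K * (indicator {y. norm y \<ge> r} y * poisson y)" for y
  proof (cases "norm y \<le> 2 * r")
    case True
    then have "clamped (y /\<^sub>R r) = G (y /\<^sub>R r)" using x by (intro clamped_eq) (simp add: field_simps)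
    then have "G y - r * clamped (y /\<^sub>R r) = 0" using x by (simp add: G_scaleR)
    then show ?thesis using M_nonneg x poisson_pos[of y] by (simp add: indicator_def)
  next
    case False
    then have y: "norm y > 2 * r" by simp
    \<comment> \<open>On the segment \<open>norm (t *\<^sub>R x)\<close> is at most half of
      \<open>norm y\<close>, so the distance to \<open>y\<close> is at least the other half;
      squaring gives the constant 4.\<close>
    have b: "bracket y \<le> 4 * bracket (t *\<^sub>R x - y)" if "0 \<le> t" "t \<le> 1" for t
    proof -
      have "t * norm x \<le> r" using that x mult_left_le_one_le[of r t] by simp
      then have "norm (t *\<^sub>R x) \<le> norm y / 2" using that y by simp
      moreover have "norm y \<le> norm (t *\<^sub>R x) + norm (t *\<^sub>R x - y)"
        using norm_triangle_ineq4[of "t *\<^sub>R x" "t *\<^sub>R x - y"] by simp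
      ultimately have "norm y \<le> 2 * norm (t *\<^sub>R x - y)" by simp
      then have "(norm y)\<^sup>2 \<le> (2 * norm (t *\<^sub>R x - y))\<^sup>2" by (intro power_mono) auto
      then show ?thesis by (simp add: bracket_def power_mult_distrib)
    qed
    \<comment> \<open>After rescaling, clamping multiplies \<open>G y\<close> by a number
      \<open>m\<close> between 0 and 1, so removing the clamped part cannot increase the absolute
      value.\<close>
    have c: "\<bar>G y - r * clamped (y /\<^sub>R r)\<bar> \<le> \<bar>G y\<bar>"
    proof -
      define m where "m = min 2 (norm y / r) / (norm y / r)"
      have "norm y > 0" using x y by linarith
      then have a: "norm y / r > 0" using x by simp
      have "0 \<le> min 2 a / a \<and> min 2 a / a \<le> 1" if "a > 0" for a :: real
        using that by (auto intro!: divide_nonneg_pos simp: divide_le_eq_1_pos)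
      from this[OF a] have m: "0 \<le> m" "m \<le> 1" unfolding m_def by blast+
      have "G y - r * clamped (y /\<^sub>R r) = (1 - m) * G y"
        using x by (simp add: clamped_def m_def G_scaleR divide_inverse mult_ac algebra_simps)
      then show ?thesis using m by (simp add: abs_mult mult_left_le_one_le)
    qed
    have "\<bar>poisson (x - y) - poisson y\<bar> \<le> (real CARD('n) + 1) * r * 4 powr ((real CARD('n) + 2) / 2) * bracket y powr (- ((real CARD('n) + 2) / 2))"
      using abs_poisson_diff_le[OF _ b] x by simp
    then have "\<bar>(poisson (x - y) - poisson y) * (G y - r * clamped (y /\<^sub>R r))\<bar> \<le>
      (real CARD('n) + 1) * r * 4 powr ((real CARD('n) + 2) / 2) * bracket y powr (- ((real CARD('n) + 2) / 2)) * \<bar>G y\<bar>"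
      unfolding abs_mult using c x by (intro mult_mono) auto
    also have "\<dots> = (real CARD('n) + 1) * r * 4 powr ((real CARD('n) + 2) / 2) * (bracket y powr (- ((real CARD('n) + 2) / 2)) * \<bar>G y\<bar>)"
      by simp
    also have "\<dots> \<le> (real CARD('n) + 1) * r * 4 powr ((real CARD('n) + 2) / 2) * (M * poisson y)"
      using x by (intro mult_left_mono bracket_powr_mult_G_le) auto
    finally show ?thesis using y x by (simp add: mult_ac)
  qed
  have i: "integrable lborel (\<lambda>y::real^'n. ?K * (indicator {y. norm y \<ge> r} y * poisson y))"
    by (intro integrable_mult_right integrable_poisson_tail)
  have "integrable lborel (\<lambda>y. (poisson (x - y) - poisson y) * (G y - r * clamped (y /\<^sub>R r)))"
  proof (rule Bochner_Integration.integrable_bound[OF i])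
    show "(\<lambda>y. (poisson (x - y) - poisson y) * (G y - r * clamped (y /\<^sub>R r))) \<in> borel_measurable lborel" by simp
  qed (intro AE_I2, simp only: real_norm_def, rule order_trans[OF pw abs_ge_self])
  then have "\<bar>\<integral>y. (poisson (x - y) - poisson y) * (G y - r * clamped (y /\<^sub>R r)) \<partial>lborel\<bar> \<le>
     (\<integral>(y::real^'n). ?K * (indicator {y. norm y \<ge> r} y * poisson y) \<partial>lborel)"
    by (intro integral_abs_bound[THEN order_trans] integral_mono integrable_abs i pw)
  also have "\<dots> = ?K * poisson_tail r" by (simp add: poisson_tail_def)
  finally show ?thesis .
qed

text \<open>The clamped part is bounded, so its integrals against the two kernels converge
  separately; the substitution \<open>z = r *\<^sub>R \<phi> - y\<close>, with \<open>\<phi>\<close>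
  equal to \<open>\<theta>\<close> and to 0, turns them into Poisson averages at scale
  \<open>1 / r\<close> around \<open>\<theta>\<close> and around 0.\<close>

lemma pot_decompose:
  assumes r: "r > 0"
  shows "pot (r *\<^sub>R \<theta>) = r * ((\<integral>z. poisson z * clamped (\<theta> - z /\<^sub>R r) \<partial>lborel) - (\<integral>z. poisson z * clamped (0 - z /\<^sub>R r) \<partial>lborel)) +
    (\<integral>y. (poisson (r *\<^sub>R \<theta> - y) - poisson y) * (G y - r * clamped (y /\<^sub>R r)) \<partial>lborel)"
proof -
  let ?x = "r *\<^sub>R \<theta>"
  have int: "integrable lborel (\<lambda>z. poisson z * clamped (\<phi> - z /\<^sub>R r))" for \<phi>
    using integrable_poisson_mult_clamped[of \<phi> "- inverse r"] by simp
  have refl: "clamped (\<phi> - (r *\<^sub>R \<phi> - y) /\<^sub>R r) = clamped (y /\<^sub>R r)" for \<phi> y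
    using r by (simp add: scaleR_diff_right)
  have i: "integrable lborel (\<lambda>y. poisson (r *\<^sub>R \<phi> - y) * clamped (y /\<^sub>R r))" for \<phi>
    using integrable_lborel_reflect[OF int[of \<phi>], of "r *\<^sub>R \<phi>"] unfolding refl .
  have e: "(\<integral>z. poisson z * clamped (\<phi> - z /\<^sub>R r) \<partial>lborel) = (\<integral>y. poisson (r *\<^sub>R \<phi> - y) * clamped (y /\<^sub>R r) \<partial>lborel)" for \<phi>
    using integral_lborel_reflect[of "\<lambda>z. poisson z * clamped (\<phi> - z /\<^sub>R r)" "r *\<^sub>R \<phi>"] unfolding refl by simp
  have pm: "poisson (r *\<^sub>R 0 - y) = poisson y" for y :: "real^'n" by (simp add: poisson_def)
  have i0: "integrable lborel (\<lambda>y. poisson y * clamped (y /\<^sub>R r))" using i[of 0] unfolding pm .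
  have e0: "(\<integral>z. poisson z * clamped (0 - z /\<^sub>R r) \<partial>lborel) = (\<integral>y. poisson y * clamped (y /\<^sub>R r) \<partial>lborel)"
    using e[of 0] unfolding pm .
  have near: "r * ((\<integral>z. poisson z * clamped (\<theta> - z /\<^sub>R r) \<partial>lborel) - (\<integral>z. poisson z * clamped (0 - z /\<^sub>R r) \<partial>lborel)) =
     (\<integral>y. (poisson (?x - y) - poisson y) * (r * clamped (y /\<^sub>R r)) \<partial>lborel)"
    unfolding e[of \<theta>] e0 Bochner_Integration.integral_diff[OF i i0, symmetric] integral_mult_right_zero[symmetric]
    by (simp add: algebra_simps)
  have i1: "integrable lborel (\<lambda>y. (poisson (?x - y) - poisson y) * (r * clamped (y /\<^sub>R r)))"
    using integrable_mult_right[OF Bochner_Integration.integrable_diff[OF i[of \<theta>] i0], of r]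
    by (simp add: algebra_simps)
  have i2: "integrable lborel (\<lambda>y. (poisson (?x - y) - poisson y) * (G y - r * clamped (y /\<^sub>R r)))"
    using Bochner_Integration.integrable_diff[OF integrable_pot_integrand[of ?x] i1]
    by (simp add: right_diff_distrib)
  show ?thesis
    unfolding near pot_def Bochner_Integration.integral_add[OF i1 i2, symmetric]
    by (simp add: distrib_left[symmetric])
qed

text \<open>The average around 0 tends to the mass times \<open>clamped 0 = 0\<close>, so the term
  subtracted for convergence leaves no trace in the limit. All error bounds are independent of
  \<open>\<theta>\<close>.\<close>

lemma pot_asymptotics:
  assumes \<epsilon>: "\<epsilon> > 0"
  shows "\<forall>\<^sub>F r in at_top. \<forall>\<theta>. norm \<theta> = 1 \<longrightarrow> \<bar>pot (r *\<^sub>R \<theta>) / r - (\<integral>z. poisson (z::real^'n) \<partial>lborel) * G \<theta>\<bar> \<le> \<epsilon>"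
proof -
  define I where "I = (\<integral>z. poisson (z::real^'n) \<partial>lborel)"
  have I: "I \<ge> 0" unfolding I_def by (intro integral_nonneg_AE AE_I2 less_imp_le poisson_pos)
  \<comment> \<open>Two averages each contribute an error \<open>\<eta> * I\<close>, together at
    most \<open>\<epsilon> / 2\<close>; the other half is left for the tails, whose coefficient is
    \<open>4 * M\<close> twice plus \<open>K\<close>.\<close>
  define \<eta> where "\<eta> = \<epsilon> / (4 * (I + 1))"
  have \<eta>: "\<eta> > 0" using \<epsilon> I by (simp add: \<eta>_def)
  have \<eta>I: "2 * (\<eta> * I) \<le> \<epsilon> / 2"
    using \<epsilon> I by (simp add: \<eta>_def field_simps)
  define K where "K = (real CARD('n) + 1) * 4 powr ((real CARD('n) + 2) / 2) * M"
  have K: "K \<ge> 0" using M_nonneg by (simp add: K_def)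
  obtain \<delta> where \<delta>: "0 < \<delta>" "\<delta> \<le> 1" "\<And>x h. norm x \<le> 1 \<Longrightarrow> norm h < \<delta> \<Longrightarrow> \<bar>clamped (x - h) - clamped x\<bar> \<le> \<eta>"
    using clamped_uniform[OF \<eta>] by metis
  have "((\<lambda>r. poisson_tail (\<delta> * r)) \<longlongrightarrow> 0) at_top"
    by (rule filterlim_compose[OF poisson_tail_tendsto_0 filterlim_tendsto_pos_mult_at_top[OF tendsto_const \<delta>(1) filterlim_ident]])
  then have "((\<lambda>r. (8 * M + K) * poisson_tail (\<delta> * r)) \<longlongrightarrow> (8 * M + K) * 0) at_top"
    by (intro tendsto_intros)
  then have "\<forall>\<^sub>F r in at_top. (8 * M + K) * poisson_tail (\<delta> * r) < \<epsilon> / 2"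
    using \<epsilon> by (intro order_tendstoD(2)) auto
  then show ?thesis
    using eventually_gt_at_top[of 0]
  proof eventually_elim
    case (elim r)
    show ?case
    proof (intro allI impI)
      fix \<theta> :: "real^'n" assume \<theta>: "norm \<theta> = 1"
      define A where "A = (\<lambda>x. \<integral>z. poisson z * clamped (x - z /\<^sub>R r) \<partial>lborel)"
      define B where "B = (\<integral>y. (poisson (r *\<^sub>R \<theta> - y) - poisson y) * (G y - r * clamped (y /\<^sub>R r)) \<partial>lborel)"
      have c: "clamped \<theta> = G \<theta>" "clamped 0 = 0"
        using clamped_eq[of \<theta>] clamped_eq[of 0] G_scaleR[of 0 0] \<theta> by simp_all
      have a1: "\<bar>A x - I * clamped x\<bar> \<le> \<eta> * I + 4 * M * poisson_tail (\<delta> * r)" if "norm x \<le> 1" for x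
        unfolding A_def I_def using \<eta> elim by (intro approximate_identity \<delta> that) auto
      have b: "\<bar>B\<bar> \<le> K * r * poisson_tail r"
        unfolding B_def K_def using \<theta> elim by (intro pot_far_part) auto
      have "\<bar>B / r\<bar> \<le> K * poisson_tail r"
        using b elim by (simp add: field_simps)
      \<comment> \<open>Because \<open>\<delta>\<close> is at most 1, all tails can be measured from
        the same radius \<open>\<delta> * r\<close>.\<close>
      also have "\<dots> \<le> K * poisson_tail (\<delta> * r)"
        using K \<delta> elim by (intro mult_left_mono poisson_tail_antimono) (auto simp: mult_left_le_one_le)
      finally have b': "\<bar>B / r\<bar> \<le> K * poisson_tail (\<delta> * r)" .
      have "pot (r *\<^sub>R \<theta>) = r * (A \<theta> - A 0) + B"
        unfolding A_def B_def by (rule pot_decompose[OF elim(2)])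
      then have "pot (r *\<^sub>R \<theta>) / r - I * G \<theta> = (A \<theta> - I * clamped \<theta>) - (A 0 - I * clamped 0) + B / r"
        using elim(2) unfolding c by (simp add: field_simps)
      also have "\<bar>\<dots>\<bar> \<le> (\<eta> * I + 4 * M * poisson_tail (\<delta> * r)) + (\<eta> * I + 4 * M * poisson_tail (\<delta> * r)) + K * poisson_tail (\<delta> * r)"
      proof -
        have "\<bar>A \<theta> - I * clamped \<theta>\<bar> \<le> \<eta> * I + 4 * M * poisson_tail (\<delta> * r)"
          "\<bar>A 0 - I * clamped 0\<bar> \<le> \<eta> * I + 4 * M * poisson_tail (\<delta> * r)"
          using \<theta> by (auto intro: a1)
        with b' show ?thesis by linarith
      qed
      also have "\<dots> = 2 * (\<eta> * I) + (8 * M + K) * poisson_tail (\<delta> * r)"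
        by (simp add: algebra_simps)
      also have "\<dots> \<le> \<epsilon>" using \<eta>I elim by simp
      finally show "\<bar>pot (r *\<^sub>R \<theta>) / r - (\<integral>z. poisson (z::real^'n) \<partial>lborel) * G \<theta>\<bar> \<le> \<epsilon>"
        unfolding I_def .
    qed
  qed
qed

end

section \<open>The boundary value problem\<close>

lemma integral_sphere_measure:
  fixes g :: "'a::euclidean_space \<Rightarrow> real"
  assumes g: "continuous_on (sphere 0 1) g"
  shows "(LINT \<theta>|sphere_measure. g \<theta>) =
    (\<integral>z. indicator (ball 0 1) z * g (z /\<^sub>R norm z) \<partial>lborel) / measure lborel (ball (0::'a) 1)"
proof -
  let ?B = "ball (0::'a) 1" and ?S = "sphere (0::'a) 1"
  define m where "m = measure lborel ?B"
  have m: "m > 0" unfolding m_def using content_ball_pos[of 1 "0::'a"] by (simp add: measure_completion)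
  have em: "emeasure lborel ?B = ennreal m"
    unfolding m_def using emeasure_lborel_ball_finite[of "0::'a" 1]
    by (intro emeasure_eq_ennreal_measure) (auto simp: less_top)
  define gs where "gs = (\<lambda>y. indicator ?S y *\<^sub>R g y)"
  have [measurable]: "gs \<in> borel_measurable borel"
    unfolding gs_def by (rule borel_measurable_continuous_on_indicator[OF _ g]) simp
  have [measurable]: "?B \<in> sets borel" by simp
  have uni: "uniform_measure lborel ?B = density lborel (\<lambda>z. ennreal (indicator ?B z / m))"
    unfolding uniform_measure_def em
  proof (rule arg_cong[where f = "density lborel"], rule ext)
    fix z show "indicator ?B z / ennreal m = ennreal (indicator ?B z / m)"
      using m by (cases "z \<in> ?B") (auto simp: divide_ennreal[of 1 m, simplified])
  qed
  have "(LINT \<theta>|sphere_measure. g \<theta>) = (LINT y|distr (uniform_measure lborel ?B) borel (\<lambda>x. x /\<^sub>R norm x). gs y)"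
    unfolding sphere_measure_def gs_def by (rule integral_restrict_space) simp
  also have "\<dots> = (\<integral>z. gs (z /\<^sub>R norm z) \<partial>uniform_measure lborel ?B)"
    by (rule integral_distr) measurable
  also have "\<dots> = (\<integral>z. (indicator ?B z / m) *\<^sub>R gs (z /\<^sub>R norm z) \<partial>lborel)"
    unfolding uni by (rule integral_density) (use m in \<open>measurable, auto\<close>)
  also have "\<dots> = (\<integral>z. (indicator ?B z * gs (z /\<^sub>R norm z)) \<partial>lborel) / m"
    by simp
  also have "(\<integral>z. (indicator ?B z * gs (z /\<^sub>R norm z)) \<partial>lborel) = (\<integral>z. (indicator ?B z * g (z /\<^sub>R norm z)) \<partial>lborel)"
    (is "_ = ?rhs")
  proof -
    \<comment> \<open>Off the sphere \<open>g\<close> is arbitrary and perhaps not measurable, so it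
      is cut off to \<open>gs\<close>. The projection leaves the sphere only at
      \<open>z = 0\<close>, which it maps to 0; restoring the value \<open>g 0\<close> there gives a
      measurable function that agrees with \<open>g\<close> at every projected point.\<close>
    define gz where "gz = (\<lambda>y::'a. gs y + indicator {0} y * g 0)"
    have [measurable]: "gz \<in> borel_measurable borel" unfolding gz_def by measurable
    have "(\<integral>z. (indicator ?B z * gs (z /\<^sub>R norm z)) \<partial>lborel) = (\<integral>z. (indicator ?B z * gz (z /\<^sub>R norm z)) \<partial>lborel)"
    proof (rule integral_cong_AE)
      show "AE z in lborel. indicator ?B z * gs (z /\<^sub>R norm z) = indicator ?B z * gz (z /\<^sub>R norm z)"
        using AE_lborel_singleton[of "0::'a"] by eventually_elim (simp add: gz_def)
    qed simp_all
    also have "(\<lambda>z. indicator ?B z * gz (z /\<^sub>R norm z)) = (\<lambda>z. indicator ?B z * g (z /\<^sub>R norm z))"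
    proof (rule ext)
      fix z show "indicator ?B z * gz (z /\<^sub>R norm z) = indicator ?B z * g (z /\<^sub>R norm z)"
        by (cases "z = 0") (simp_all add: gz_def gs_def)
    qed
    finally show ?thesis .
  qed
  finally show ?thesis unfolding m_def .
qed

text \<open>At the origin the direction has no limit, and continuity comes from the bound
  \<open>M * norm y\<close> alone; elsewhere the extension is a composition of continuous
  maps.\<close>

lemma cone_extension_homogeneous_datum:
  fixes g :: "real^'n \<Rightarrow> real"
  assumes g: "continuous_on (sphere 0 1) g"
  obtains M where "homogeneous_datum (\<lambda>y. norm y * g (y /\<^sub>R norm y)) M"
proof -
  have "compact (g ` sphere 0 1)" using g by (intro compact_continuous_image) auto
  then have "bounded (g ` sphere 0 1)" by (rule compact_imp_bounded)
  then obtain M where "M > 0" "\<forall>y\<in>g ` sphere 0 1. norm y \<le> M"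
    unfolding bounded_pos by blast
  then have M: "M > 0" "\<And>\<theta>. norm \<theta> = 1 \<Longrightarrow> \<bar>g \<theta>\<bar> \<le> M" by auto
  let ?G = "\<lambda>y. norm y * g (y /\<^sub>R norm y)"
  have le: "\<bar>?G y\<bar> \<le> M * norm y" for y
  proof (cases "y = 0")
    case False
    then have "\<bar>g (y /\<^sub>R norm y)\<bar> \<le> M" by (intro M(2)) simp
    then have "norm y * \<bar>g (y /\<^sub>R norm y)\<bar> \<le> norm y * M" by (intro mult_left_mono) auto
    then show ?thesis by (simp add: abs_mult mult.commute)
  qed simp
  have "isCont ?G y" for y
  proof (cases "y = 0")
    case True
    have "((\<lambda>y::real^'n. norm y) \<longlongrightarrow> norm (0::real^'n)) (at 0)"
      using tendsto_norm[OF tendsto_ident_at, of "0::real^'n" UNIV] by simp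
    from tendsto_mult_left[OF this, of M]
    have "((\<lambda>y. M * norm y) \<longlongrightarrow> 0) (at (0::real^'n))" by simp
    then have "(?G \<longlongrightarrow> 0) (at 0)"
    proof (rule Lim_null_comparison[rotated])
      show "\<forall>\<^sub>F y in at 0. norm (?G y) \<le> M * norm y"
        using le by (intro always_eventually allI) (simp only: real_norm_def)
    qed
    then show ?thesis using True by (simp add: isCont_def)
  next
    case False
    have "continuous_on (- {0}) ?G"
      by (intro continuous_intros continuous_on_compose2[OF g]) (auto, metis left_inverse norm_eq_zero)
    then show ?thesis
      using False continuous_on_eq_continuous_at[of "- {0::real^'n}"] by auto
  qed
  then have "continuous_on UNIV ?G" by (simp add: continuous_on_eq_continuous_at)
  moreover have "?G (r *\<^sub>R y) = r * ?G y" if "r \<ge> 0" for r y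
  proof (cases "r = 0")
    case False
    then have "inverse (r * norm y) * r = inverse (norm y)" by simp
    then have "(r *\<^sub>R y) /\<^sub>R norm (r *\<^sub>R y) = y /\<^sub>R norm y"
      using that by (simp only: norm_scaleR abs_of_nonneg scaleR_scaleR)
    then show ?thesis using that by (simp only: norm_scaleR abs_of_nonneg mult.assoc)
  qed simp
  ultimately have "homogeneous_datum ?G M"
    using M(1) le by unfold_locales auto
  then show thesis by (rule that)
qed

text \<open>A real \<open>SUP\<close> dominates its members only if they are bounded above.
  Compactness of the sphere and continuity of \<open>u\<close> and \<open>g\<close> ensure this; the
  limit of suprema can then be read off pointwise.\<close>

lemma growth_of_uniform_limit:
  fixes u g :: "real^'n \<Rightarrow> real"
  assumes u: "continuous_on UNIV u" and g: "continuous_on (sphere 0 1) g"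
    and lim: "((\<lambda>r. SUP \<theta>\<in>sphere 0 1. \<bar>u (r *\<^sub>R \<theta>) / r - g \<theta>\<bar>) \<longlongrightarrow> 0) at_top"
    and \<epsilon>: "\<epsilon> > 0"
  shows "\<exists>R. \<forall>x. norm x \<ge> R \<longrightarrow> \<bar>u x - norm x * g (x /\<^sub>R norm x)\<bar> \<le> \<epsilon> * norm x"
proof -
  have "\<forall>\<^sub>F r in at_top. (SUP \<theta>\<in>sphere 0 1. \<bar>u (r *\<^sub>R \<theta>) / r - g \<theta>\<bar>) < \<epsilon>"
    using order_tendstoD(2)[OF lim \<epsilon>] .
  then obtain R where R: "\<And>r. r \<ge> R \<Longrightarrow> (SUP \<theta>\<in>sphere 0 1. \<bar>u (r *\<^sub>R \<theta>) / r - g \<theta>\<bar>) < \<epsilon>"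
    unfolding eventually_at_top_linorder by blast
  show ?thesis
  proof (intro exI allI impI)
    fix x :: "real^'n" assume x: "norm x \<ge> max R 1"
    define r where "r = norm x"
    have r: "r \<ge> R" "r > 0" using x by (auto simp: r_def)
    define \<theta> where "\<theta> = x /\<^sub>R r"
    have \<theta>: "\<theta> \<in> sphere 0 1" "r *\<^sub>R \<theta> = x" using r by (auto simp: \<theta>_def r_def)
    have "continuous_on (sphere 0 1) (\<lambda>\<theta>. \<bar>u (r *\<^sub>R \<theta>) / r - g \<theta>\<bar>)"
      using r by (intro continuous_intros continuous_on_compose2[OF u] g) auto
    then have "bdd_above ((\<lambda>\<theta>. \<bar>u (r *\<^sub>R \<theta>) / r - g \<theta>\<bar>) ` sphere 0 1)"
      by (intro bounded_imp_bdd_above compact_imp_bounded compact_continuous_image) auto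
    from cSUP_upper[OF \<theta>(1) this] R[OF r(1)] have "\<bar>u x / r - g \<theta>\<bar> < \<epsilon>"
      unfolding \<theta>(2) by linarith
    then have "r * \<bar>u x / r - g \<theta>\<bar> \<le> r * \<epsilon>" using r by (intro mult_left_mono) auto
    moreover have "r * \<bar>u x / r - g \<theta>\<bar> = \<bar>u x - r * g \<theta>\<bar>"
    proof -
      have "u x - r * g \<theta> = r * (u x / r - g \<theta>)" using r by (simp add: field_simps)
      then show ?thesis using r by (simp only: abs_mult abs_of_pos)
    qed
    ultimately show "\<bar>u x - norm x * g (x /\<^sub>R norm x)\<bar> \<le> \<epsilon> * norm x"
      by (simp add: r_def \<theta>_def mult.commute)
  qed
qed

text \<open>The left-hand side is the area of the unit sphere divided by the mass of the Poisson
  kernel. The factor 2 on the right cancels the 1/2 in front of the operator.\<close>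

lemma gamma_constant:
  fixes n :: nat
  assumes n: "n > 0"
  shows "real n * unit_ball_vol (real n) / (pi powr ((real n + 1) / 2) / Gamma ((real n + 1) / 2)) =
    2 * (1 / sqrt pi * (Gamma ((real n + 1) / 2) / Gamma (real n / 2)))"
proof -
  have G: "Gamma (real n / 2 + 1) = real n / 2 * Gamma (real n / 2)"
    using n by (intro Gamma_plus1) (auto simp: nonpos_Ints_def)
  have P: "pi powr ((real n + 1) / 2) = pi powr (real n / 2) * sqrt pi"
    by (simp add: powr_half_sqrt[symmetric] powr_add[symmetric] add_divide_distrib)
  have "Gamma (real n / 2) > 0" "Gamma ((real n + 1) / 2) > 0" using n by (auto intro: Gamma_real_pos)
  then show ?thesis
    using n unfolding unit_ball_vol_def G P by (simp add: field_simps)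
qed

theorem theorem1:
  fixes g :: "real^'n \<Rightarrow> real" and \<gamma> c :: real
  assumes "CARD('n) \<ge> 2"
    and "continuous_on (sphere 0 1) g"
    and "\<gamma> = 1 / sqrt pi * (Gamma ((real CARD('n) + 1) / 2) / Gamma (real CARD('n) / 2))"
    and "c = \<gamma> * (LINT \<theta>|sphere_measure. g \<theta>)"
  shows "\<exists>!u :: real^'n \<Rightarrow> real.
    C2 u \<and>
    (\<forall>x. 1 / 2 * (\<Sum>i\<in>UNIV. \<Sum>j\<in>UNIV.
        ((if i = j then 1 else 0) + x $ i * x $ j) * partial_deriv i (partial_deriv j u) x) = c) \<and>
    u 0 = 0 \<and>
    ((\<lambda>r::real. SUP \<theta>\<in>sphere 0 1. \<bar>u (r *\<^sub>R \<theta>) / r - g \<theta>\<bar>) \<longlongrightarrow> 0) at_top"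
  unfolding ell_op_def[symmetric]
proof (rule ex_ex1I)
  define I where "I = pi powr ((real CARD('n) + 1) / 2) / Gamma ((real CARD('n) + 1) / 2)"
  have I: "I > 0" unfolding I_def by (simp add: Gamma_real_pos)
  have II: "(\<integral>z. poisson (z::real^'n) \<partial>lborel) = I"
    using has_bochner_integral_integral_eq[OF has_bochner_integral_poisson[where 'a="real^'n"]] by (simp add: I_def)
  have gI: "continuous_on (sphere 0 1) (\<lambda>\<theta>. g \<theta> / I)"
    using assms(2) I by (intro continuous_intros) auto
  \<comment> \<open>Dividing by the mass \<open>I\<close> of the kernel makes the limit of
    \<open>pot (r *\<^sub>R \<theta>) / r\<close> equal to \<open>g \<theta>\<close>.\<close>
  define G where "G = (\<lambda>y. norm y * (g (y /\<^sub>R norm y) / I))"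
  obtain M where "homogeneous_datum G M"
    using cone_extension_homogeneous_datum[OF gI] unfolding G_def by blast
  then interpret homogeneous_datum G M .
  have Gg: "I * G \<theta> = g \<theta>" if "norm \<theta> = 1" for \<theta>
    using that I by (simp add: G_def)
  have op: "1 / 2 * ell_op pot x = c" for x
  proof -
    have cG: "continuous_on (sphere 0 1) G"
      using continuous_G by (rule continuous_on_subset) auto
    have "(LINT \<theta>|sphere_measure. G \<theta>) = (LINT \<theta>|sphere_measure. g \<theta> / I)"
      by (rule Bochner_Integration.integral_cong) (auto simp: G_def)
    moreover define X where "X = (\<integral>z. indicator (ball 0 1) z * G (z /\<^sub>R norm z) \<partial>lborel)"
    moreover have "(LINT \<theta>|sphere_measure. G \<theta>) = X / unit_ball_vol (real CARD('n))"
      using integral_sphere_measure[OF cG] content_ball[of 1 "0::real^'n"] by (simp add: X_def)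
    moreover have "unit_ball_vol (real CARD('n)) > 0" by simp
    ultimately have "X = unit_ball_vol (real CARD('n)) * ((LINT \<theta>|sphere_measure. g \<theta>) / I)"
      by (simp add: field_simps)
    then have "1 / 2 * ell_op pot x = 1 / 2 * (real CARD('n) * unit_ball_vol (real CARD('n)) / I) * (LINT \<theta>|sphere_measure. g \<theta>)"
      unfolding ell_op_pot X_def by simp
    also have "\<dots> = c"
      unfolding I_def by (subst gamma_constant) (simp_all add: assms(3,4))
    finally show ?thesis .
  qed
  have lim: "((\<lambda>r::real. SUP \<theta>\<in>sphere 0 1. \<bar>pot (r *\<^sub>R \<theta>) / r - g \<theta>\<bar>) \<longlongrightarrow> 0) at_top"
  proof (rule tendstoI)
    fix \<epsilon> :: real assume "\<epsilon> > 0"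
    then have "\<epsilon> / 2 > 0" by simp
    from pot_asymptotics[OF this]
    show "\<forall>\<^sub>F r in at_top. dist (SUP \<theta>\<in>sphere 0 1. \<bar>pot (r *\<^sub>R \<theta>) / r - g \<theta>\<bar>) 0 < \<epsilon>"
    proof eventually_elim
      case (elim r)
      let ?f = "\<lambda>\<theta>. \<bar>pot (r *\<^sub>R \<theta>) / r - g \<theta>\<bar>"
      have le: "?f \<theta> \<le> \<epsilon> / 2" if "\<theta> \<in> sphere 0 1" for \<theta>
      proof -
        have n: "norm \<theta> = 1" using that by simp
        show ?thesis using elim[rule_format, OF n] unfolding II Gg[OF n] .
      qed
      \<comment> \<open>One point of the sphere is needed twice: \<open>cSUP_least\<close> asks for
        a nonempty set, and a single nonnegative member bounds the supremum below by 0.\<close>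
      obtain \<theta> :: "real^'n" where \<theta>: "\<theta> \<in> sphere 0 1"
        using that[of "axis undefined 1"] by (simp add: norm_axis_1)
      have "(SUP \<theta>\<in>sphere 0 1. ?f \<theta>) \<le> \<epsilon> / 2"
        using \<theta> le by (intro cSUP_least) auto
      moreover have "?f \<theta> \<le> (SUP \<theta>\<in>sphere 0 1. ?f \<theta>)"
        by (intro cSUP_upper \<theta> bdd_aboveI2[of _ _ "\<epsilon> / 2"] le)
      moreover have "0 \<le> ?f \<theta>" by simp
      ultimately show ?case using \<open>\<epsilon> > 0\<close> by (simp add: dist_real_def)
    qed
  qed
  show "\<exists>u. C2 u \<and> (\<forall>x. 1 / 2 * ell_op u x = c) \<and> u 0 = 0 \<and>
      ((\<lambda>r::real. SUP \<theta>\<in>sphere 0 1. \<bar>u (r *\<^sub>R \<theta>) / r - g \<theta>\<bar>) \<longlongrightarrow> 0) at_top"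
    using C2_pot op pot_0 lim by blast
next
  \<comment> \<open>A one-sided inequality for an arbitrary ordered pair of solutions; exchanging
    the two gives equality.\<close>
  have le: "u x \<le> v x" if
    u: "C2 u \<and> (\<forall>x. 1 / 2 * ell_op u x = c) \<and> u 0 = 0 \<and>
      ((\<lambda>r::real. SUP \<theta>\<in>sphere 0 1. \<bar>u (r *\<^sub>R \<theta>) / r - g \<theta>\<bar>) \<longlongrightarrow> 0) at_top" and
    v: "C2 v \<and> (\<forall>x. 1 / 2 * ell_op v x = c) \<and> v 0 = 0 \<and>
      ((\<lambda>r::real. SUP \<theta>\<in>sphere 0 1. \<bar>v (r *\<^sub>R \<theta>) / r - g \<theta>\<bar>) \<longlongrightarrow> 0) at_top"
    for u v x
  proof (rule ell_op_comparison)
    show "C2 u" "C2 v" using u v by blast+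
    then have cont: "continuous_on UNIV u" "continuous_on UNIV v" by (simp_all add: C2_def C1_def)
    have "1 / 2 * ell_op u x = 1 / 2 * ell_op v x" for x using u v by simp
    then show "ell_op u x = ell_op v x" for x by simp
    show "u 0 = v 0" using u v by simp
    fix \<epsilon> :: real assume "\<epsilon> > 0"
    then have \<epsilon>: "\<epsilon> / 2 > 0" by simp
    obtain R where R: "\<And>x. norm x \<ge> R \<Longrightarrow> \<bar>u x - norm x * g (x /\<^sub>R norm x)\<bar> \<le> \<epsilon> / 2 * norm x"
      using growth_of_uniform_limit[OF cont(1) assms(2) _ \<epsilon>] u by blast
    obtain S where S: "\<And>x. norm x \<ge> S \<Longrightarrow> \<bar>v x - norm x * g (x /\<^sub>R norm x)\<bar> \<le> \<epsilon> / 2 * norm x"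
      using growth_of_uniform_limit[OF cont(2) assms(2) _ \<epsilon>] v by blast
    show "\<exists>R. \<forall>x. R \<le> norm x \<longrightarrow> u x - v x \<le> \<epsilon> * norm x"
    proof (intro exI allI impI)
      fix x :: "real^'n" assume "max R S \<le> norm x"
      then have "\<bar>u x - norm x * g (x /\<^sub>R norm x)\<bar> \<le> \<epsilon> / 2 * norm x"
        "\<bar>v x - norm x * g (x /\<^sub>R norm x)\<bar> \<le> \<epsilon> / 2 * norm x"
        using R[of x] S[of x] by simp_all
      then have "u x - v x \<le> 2 * (\<epsilon> / 2 * norm x)" by linarith
      then show "u x - v x \<le> \<epsilon> * norm x" by simp
    qed
  qed
  show "u = v" if
    "C2 u \<and> (\<forall>x. 1 / 2 * ell_op u x = c) \<and> u 0 = 0 \<and>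
      ((\<lambda>r::real. SUP \<theta>\<in>sphere 0 1. \<bar>u (r *\<^sub>R \<theta>) / r - g \<theta>\<bar>) \<longlongrightarrow> 0) at_top"
    "C2 v \<and> (\<forall>x. 1 / 2 * ell_op v x = c) \<and> v 0 = 0 \<and>
      ((\<lambda>r::real. SUP \<theta>\<in>sphere 0 1. \<bar>v (r *\<^sub>R \<theta>) / r - g \<theta>\<bar>) \<longlongrightarrow> 0) at_top"
    for u v
    using le[OF that] le[OF that(2,1)] by (intro ext antisym)
qed

end
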